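(* Let $k\geq1$ be an integer. The spectrum of $\mathscr{L}_k$ is the same on every $X^s$, $s\geq0$. With the Fredholm definition of essential spectrum, on every $X^s$, $$\sigma_{\mathrm{ess}}(\mathscr{L}_k)=\mathrm{i}\,[-k\sqrt{1+k^2},\,k\sqrt{1+k^2}].$$ Moreover, if $Y^s\subset X^s$ is a closed $\mathscr{L}_k$-invariant subspace defined by Fourier modes or by the reflections described in the context, and if the restricted operator $\mathscr{L}_k|_{Y^s}$ has spectral bound $\Lambda=\sup\{\operatorname{Re}z:z\in\sigma(\mathscr{L}_k|_{Y^s})\}$, then for every $s\geq0$ and $\eta>0$ there is a constant $C_{k,Y,s,\eta}$ such that $$\|e^{t\mathscr{L}_k}\|_{Y^s\to Y^s}\leq C_{k,Y,s,\eta}\,e^{(\Lambda+\eta)t},\qquad t\geq0.$$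
   Context: On $\mathbb{T}^2=(\mathbb{R}/2\pi\mathbb{Z})^2$, for $s\geq0$ let $X^s=H^{s-1}_0(\mathbb{T}^2;\mathbb{C})\times H^s(\mathbb{T}^2;\mathbb{C})\ni(\omega,F)$, where the subscript $0$ denotes mean zero. Define $A_k=I-(1+k^2)(1-\Delta)^{-1}$, $B_k=-(1+k^2)\Delta^{-1}$, and the operator, bounded on every $X^s$, $$\mathscr{L}_k=-k\cos(kx_1)\,\partial_{x_2}\begin{pmatrix}0 & A_k \\ B_k & 0\end{pmatrix}.$$ The Fredholm essential spectrum is $\sigma_{\mathrm{ess}}(T)=\{z\in\mathbb{C}: z-T\text{ is not Fredholm}\}$. Subspaces $Y^s$: those cut out of $X^s$ by restricting the Fourier modes allowed in $\omega$ and in $F$, and/or by requiring invariance under one or both of the reflections $R_1(x_1,x_2)=(\pi/k-x_1,x_2)$ and $R_2(x_1,x_2)=(x_1,-x_2)$, each acting on pairs by $(\omega,F)(x)\mapsto(-\omega(Rx),F(Rx))$, such that $Y^s$ is invariant under $\mathscr{L}_k$. *)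

theory Defs
  imports "HOL-Analysis.Analysis" "HOL-Library.Function_Algebras"
begin

section \<open>Distributions on the torus\<close>

text \<open>
  A distribution $u$ on $(\mathbb{R}/2\pi\mathbb{Z})^2$ is represented by the family of its Fourier
  coefficients, $u = \sum_n \hat u(n) e^{i n\cdot x}$.  The type admits arbitrary families; the ones
  in some Sobolev space below grow at most polynomially, so they are exactly the coefficient
  families of distributions of that Sobolev class.
\<close>

type_synonym distr = "int \<times> int \<Rightarrow> complex"
type_synonym state = "distr \<times> distr"

definition freq_sq :: "int \<times> int \<Rightarrow> real" where
  "freq_sq n = (real_of_int (fst n))\<^sup>2 + (real_of_int (snd n))\<^sup>2"

definition sobolev :: "real \<Rightarrow> distr set" where
  "sobolev s = {u. (\<lambda>n. (1 + freq_sq n) powr s * (cmod (u n))\<^sup>2) summable_on UNIV}"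

definition sobolev_norm :: "real \<Rightarrow> distr \<Rightarrow> real" where
  "sobolev_norm s u = sqrt (\<Sum>\<^sub>\<infinity>n. (1 + freq_sq n) powr s * (cmod (u n))\<^sup>2)"

definition sobolev0 :: "real \<Rightarrow> distr set" where
  "sobolev0 s = {u \<in> sobolev s. u (0, 0) = 0}"

definition X_space :: "real \<Rightarrow> state set" where
  "X_space s = sobolev0 (s - 1) \<times> sobolev s"

definition X_norm :: "real \<Rightarrow> state \<Rightarrow> real" where
  "X_norm s u = sqrt ((sobolev_norm (s - 1) (fst u))\<^sup>2 + (sobolev_norm s (snd u))\<^sup>2)"


section \<open>The operator\<close>

definition fourier_mult :: "(int \<times> int \<Rightarrow> complex) \<Rightarrow> distr \<Rightarrow> distr" where
  "fourier_mult m u = (\<lambda>n. m n * u n)"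

definition partial2 :: "distr \<Rightarrow> distr" where
  "partial2 = fourier_mult (\<lambda>n. \<i> * of_int (snd n))"

definition inv_one_minus_lap :: "distr \<Rightarrow> distr" where
  "inv_one_minus_lap = fourier_mult (\<lambda>n. of_real (1 / (1 + freq_sq n)))"

text \<open>The inverse Laplacian acts on mean-zero distributions; the value of its symbol at \<open>(0, 0)\<close>
  is irrelevant there.\<close>

definition inv_lap :: "distr \<Rightarrow> distr" where
  "inv_lap = fourier_mult (\<lambda>n. if n = (0, 0) then 0 else of_real (- 1 / freq_sq n))"

text \<open>Multiplication by $\cos(k x_1) = (e^{i k x_1} + e^{-i k x_1})/2$.\<close>

definition cos_mult :: "nat \<Rightarrow> distr \<Rightarrow> distr" where
  "cos_mult k u = (\<lambda>(n1, n2). (u (n1 - int k, n2) + u (n1 + int k, n2)) / 2)"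

definition A_op :: "nat \<Rightarrow> distr \<Rightarrow> distr" where
  "A_op k u = (\<lambda>n. u n - (1 + (of_nat k)\<^sup>2) * inv_one_minus_lap u n)"

definition B_op :: "nat \<Rightarrow> distr \<Rightarrow> distr" where
  "B_op k u = (\<lambda>n. - (1 + (of_nat k)\<^sup>2) * inv_lap u n)"

definition cscale :: "complex \<Rightarrow> state \<Rightarrow> state" where
  "cscale c u = ((\<lambda>n. c * fst u n), (\<lambda>n. c * snd u n))"

definition L_op :: "nat \<Rightarrow> state \<Rightarrow> state" where
  "L_op k u = cscale (- of_nat k)
     (cos_mult k (partial2 (A_op k (snd u))), cos_mult k (partial2 (B_op k (fst u))))"


section \<open>Reflections and the invariant subspaces\<close>

text \<open>Fourier coefficients of $u(\pi/k - x_1, x_2)$ and $u(x_1, -x_2)$.\<close>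

definition comp_R1 :: "nat \<Rightarrow> distr \<Rightarrow> distr" where
  "comp_R1 k u = (\<lambda>(n1, n2). cis (- (of_int n1 * (pi / of_nat k))) * u (- n1, n2))"

definition comp_R2 :: "distr \<Rightarrow> distr" where
  "comp_R2 u = (\<lambda>(n1, n2). u (n1, - n2))"

definition refl1 :: "nat \<Rightarrow> state \<Rightarrow> state" where
  "refl1 k u = (- comp_R1 k (fst u), comp_R1 k (snd u))"

definition refl2 :: "state \<Rightarrow> state" where
  "refl2 u = (- comp_R2 (fst u), comp_R2 (snd u))"

text \<open>\<open>M\<close> and \<open>N\<close> are the modes allowed in \<open>\<omega>\<close> and in \<open>F\<close>; \<open>P\<close> is the set of reflections imposed,
  a subset of \<open>{refl1 k, refl2}\<close>.\<close>

definition Y_space ::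
  "(int \<times> int) set \<Rightarrow> (int \<times> int) set \<Rightarrow> (state \<Rightarrow> state) set \<Rightarrow> real \<Rightarrow> state set" where
  "Y_space M N P s = {u \<in> X_space s.
     (\<forall>n. n \<notin> M \<longrightarrow> fst u n = 0) \<and> (\<forall>n. n \<notin> N \<longrightarrow> snd u n = 0) \<and> (\<forall>R\<in>P. R u = u)}"


section \<open>Operators on a normed space of states\<close>

text \<open>Below, \<open>V\<close> is a complex linear subspace of the space of states and \<open>N\<close> a norm on \<open>V\<close>; an
  operator on \<open>V\<close> is a function on states of which only the restriction to \<open>V\<close> matters.  Complex
  scalar multiplication is \<open>cscale\<close>; the type class structure provides the addition only.\<close>

interpretation state: vector_space cscale
  by unfold_locales (auto simp: cscale_def algebra_simps)

definition linear_on :: "state set \<Rightarrow> (state \<Rightarrow> state) \<Rightarrow> bool" where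
  "linear_on V T \<longleftrightarrow> (\<forall>u\<in>V. \<forall>v\<in>V. T (u + v) = T u + T v) \<and>
     (\<forall>c. \<forall>u\<in>V. T (cscale c u) = cscale c (T u))"

definition bounded_op :: "state set \<Rightarrow> (state \<Rightarrow> real) \<Rightarrow> (state \<Rightarrow> state) \<Rightarrow> bool" where
  "bounded_op V N T \<longleftrightarrow>
     T ` V \<subseteq> V \<and> linear_on V T \<and> (\<exists>C. \<forall>u\<in>V. N (T u) \<le> C * N u)"

definition closed_subspace :: "state set \<Rightarrow> (state \<Rightarrow> real) \<Rightarrow> state set \<Rightarrow> bool" where
  "closed_subspace V N W \<longleftrightarrow> state.subspace W \<and> W \<subseteq> V \<and>
     (\<forall>x l. (\<forall>i. x i \<in> W) \<and> l \<in> V \<and> (\<lambda>i::nat. N (x i - l)) \<longlonglongrightarrow> 0 \<longrightarrow> l \<in> W)"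

definition shifted :: "complex \<Rightarrow> (state \<Rightarrow> state) \<Rightarrow> state \<Rightarrow> state" where
  "shifted z T = (\<lambda>u. cscale z u - T u)"

definition resolvent_set :: "state set \<Rightarrow> (state \<Rightarrow> real) \<Rightarrow> (state \<Rightarrow> state) \<Rightarrow> complex set" where
  "resolvent_set V N T =
     {z. \<exists>S. bounded_op V N S \<and> (\<forall>u\<in>V. S (shifted z T u) = u \<and> shifted z T (S u) = u)}"

definition spectrum :: "state set \<Rightarrow> (state \<Rightarrow> real) \<Rightarrow> (state \<Rightarrow> state) \<Rightarrow> complex set" where
  "spectrum V N T = - resolvent_set V N T"

definition fredholm :: "state set \<Rightarrow> (state \<Rightarrow> real) \<Rightarrow> (state \<Rightarrow> state) \<Rightarrow> bool" where
  "fredholm V N T \<longleftrightarrow> bounded_op V N T \<and>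
     (\<exists>B. finite B \<and> {u \<in> V. T u = 0} \<subseteq> state.span B) \<and>
     closed_subspace V N (T ` V) \<and>
     (\<exists>B. finite B \<and> B \<subseteq> V \<and> (\<forall>u\<in>V. \<exists>v\<in>V. \<exists>w\<in>state.span B. u = T v + w))"

definition ess_spectrum :: "state set \<Rightarrow> (state \<Rightarrow> real) \<Rightarrow> (state \<Rightarrow> state) \<Rightarrow> complex set" where
  "ess_spectrum V N T = {z. \<not> fredholm V N (shifted z T)}"

definition spectral_bound :: "state set \<Rightarrow> (state \<Rightarrow> real) \<Rightarrow> (state \<Rightarrow> state) \<Rightarrow> real" where
  "spectral_bound V N T = Sup (Re ` spectrum V N T)"

text \<open>$e^{tT}u = \sum_j t^j T^j u / j!$, the series converging in \<open>V\<close> with respect to \<open>N\<close>.\<close>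

definition op_exp ::
  "state set \<Rightarrow> (state \<Rightarrow> real) \<Rightarrow> (state \<Rightarrow> state) \<Rightarrow> real \<Rightarrow> state \<Rightarrow> state" where
  "op_exp V N T t u = (THE v. v \<in> V \<and>
     (\<lambda>m. N ((\<Sum>j<m. cscale (of_real (t ^ j / fact j)) ((T ^^ j) u)) - v)) \<longlonglongrightarrow> 0)"

text \<open>Extended-valued, so that the norm of an unbounded operator is \<open>\<infinity>\<close>.\<close>

definition op_norm :: "state set \<Rightarrow> (state \<Rightarrow> real) \<Rightarrow> (state \<Rightarrow> state) \<Rightarrow> ennreal" where
  "op_norm V N T = (SUP u\<in>{u \<in> V. N u \<le> 1}. ennreal (N (T u)))"


section \<open>The coefficient formulas agree with the operations on functions\<close>

definition mode :: "int \<times> int \<Rightarrow> real \<times> real \<Rightarrow> complex" where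
  "mode n x = cis (of_int (fst n) * fst x + of_int (snd n) * snd x)"

definition synth :: "distr \<Rightarrow> real \<times> real \<Rightarrow> complex" where
  "synth u x = (\<Sum>\<^sub>\<infinity>n. u n * mode n x)"

lemma summable_mode:
  assumes "(\<lambda>n. norm (u n)) summable_on UNIV"
  shows "(\<lambda>n. u n * mode n x) summable_on UNIV"
  by (rule abs_summable_summable) (use assms in \<open>simp add: mode_def norm_mult\<close>)

lemma synth_reindex:
  assumes "bij h"
  shows "synth u x = (\<Sum>\<^sub>\<infinity>n. u (h n) * mode (h n) x)"
  unfolding synth_def using infsum_reindex_bij_betw[OF assms, of "\<lambda>n. u n * mode n x"] by simp

lemma synth_shift:
  "synth (\<lambda>(n1, n2). u (n1 - c, n2)) x = cis (of_int c * fst x) * synth u x"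
proof -
  have "bij (\<lambda>n::int \<times> int. (fst n + c, snd n))"
    by (rule bij_betw_byWitness[where f' = "\<lambda>n. (fst n - c, snd n)"]) auto
  from synth_reindex[OF this, of "\<lambda>(n1, n2). u (n1 - c, n2)" x]
  have "synth (\<lambda>(n1, n2). u (n1 - c, n2)) x
      = (\<Sum>\<^sub>\<infinity>n. cis (of_int c * fst x) * (u n * mode n x))"
    by (simp add: mode_def cis_mult algebra_simps)
  then show ?thesis by (simp add: synth_def infsum_cmult_right')
qed

lemma synth_cos_mult:
  assumes "(\<lambda>n. norm (u n)) summable_on UNIV"
  shows "synth (cos_mult k u) x = of_real (cos (real k * fst x)) * synth u x"
proof -
  have s: "(\<lambda>n. norm (case n of (n1, n2) \<Rightarrow> u (n1 - c, n2))) summable_on UNIV" for c :: int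
  proof -
    have "bij (\<lambda>n::int \<times> int. (fst n - c, snd n))"
      by (rule bij_betw_byWitness[where f' = "\<lambda>n. (fst n + c, snd n)"]) auto
    from summable_on_reindex_bij_betw[OF this, of "\<lambda>n. norm (u n)"] assms
    show ?thesis by (simp add: case_prod_beta)
  qed
  have "synth (cos_mult k u) x =
      (\<Sum>\<^sub>\<infinity>n. ((case n of (n1, n2) \<Rightarrow> u (n1 - int k, n2)) * mode n x
         + (case n of (n1, n2) \<Rightarrow> u (n1 - - int k, n2)) * mode n x) / 2)"
    unfolding synth_def cos_mult_def
    by (intro infsum_cong) (auto simp: field_simps split: prod.splits)
  also have "\<dots> = (\<Sum>\<^sub>\<infinity>n. (case n of (n1, n2) \<Rightarrow> u (n1 - int k, n2)) * mode n x
         + (case n of (n1, n2) \<Rightarrow> u (n1 - - int k, n2)) * mode n x) / 2"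
    by (simp only: divide_inverse infsum_cmult_left')
  also have "\<dots> = (synth (\<lambda>(n1, n2). u (n1 - int k, n2)) x
         + synth (\<lambda>(n1, n2). u (n1 - - int k, n2)) x) / 2"
    unfolding synth_def by (subst infsum_add) (rule summable_mode[OF s] refl)+
  also have "\<dots> = (cis (real k * fst x) + cis (- (real k * fst x))) / 2 * synth u x"
    by (simp only: synth_shift) (simp add: algebra_simps add_divide_distrib)
  also have "(cis (real k * fst x) + cis (- (real k * fst x))) / 2 = of_real (cos (real k * fst x))"
    by (simp add: complex_eq_iff)
  finally show ?thesis .
qed

lemma partial2_mode:
  "((\<lambda>y. mode n (a, y)) has_vector_derivative \<i> * of_int (snd n) * mode n (a, y)) (at y)"
proof -
  have "((\<lambda>y. exp (\<i> * (of_int (fst n) * of_real a + of_int (snd n) * y))) has_field_derivative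
      \<i> * of_int (snd n) * exp (\<i> * (of_int (fst n) * of_real a + of_int (snd n) * of_real y)))
      (at (of_real y))"
    by (auto intro!: derivative_eq_intros)
  from has_vector_derivative_real_field[OF this] show ?thesis
    by (simp add: mode_def cis_conv_exp)
qed

lemma synth_comp_R1:
  "synth (comp_R1 k u) x = synth u (pi / k - fst x, snd x)"
proof -
  have "bij (\<lambda>n::int \<times> int. (- fst n, snd n))"
    by (rule bij_betw_byWitness[where f' = "\<lambda>n. (- fst n, snd n)"]) auto
  from synth_reindex[OF this, of "comp_R1 k u" x] show ?thesis
    by (simp add: comp_R1_def mode_def cis_mult synth_def algebra_simps case_prod_beta)
qed

lemma synth_comp_R2:
  "synth (comp_R2 u) x = synth u (fst x, - snd x)"
proof -
  have "bij (\<lambda>n::int \<times> int. (fst n, - snd n))"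
    by (rule bij_betw_byWitness[where f' = "\<lambda>n. (fst n, - snd n)"]) auto
  from synth_reindex[OF this, of "comp_R2 u" x] show ?thesis
    by (simp add: comp_R2_def mode_def synth_def)
qed

end

theory Submission
  imports Defs "HOL-Complex_Analysis.Complex_Analysis" "HOL-Real_Asymp.Real_Asymp"
begin

text \<open>
  In Fourier coordinates the operator couples an index only to two neighbours, and with Sobolev
  weights on \<open>F\<close> and \<open>\<surd>(1 + k\<^sup>2)\<close> times Sobolev weights on \<open>\<omega>\<close> its matrix entries are asymptotic
  to those of a skew-adjoint operator \<open>L\<^sub>0\<close> of norm at most \<open>c = k \<surd>(1 + k\<^sup>2)\<close>, for every \<open>s\<close>.  Since
  \<open>\<parallel>(L\<^sub>0 + b) u\<parallel>\<^sup>2 \<le> (c\<^sup>2 + b\<^sup>2) \<parallel>u\<parallel>\<^sup>2\<close> for real \<open>b\<close>, and every \<open>z\<close> off \<open>\<i> [- c, c]\<close> satisfies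
  \<open>c\<^sup>2 + b\<^sup>2 < \<bar>z + b\<bar>\<^sup>2\<close> for a suitable \<open>b\<close>, there \<open>z - L\<close> is a finite rank perturbation of an
  operator inverted by a Neumann series: it is Fredholm, and invertible unless \<open>z\<close> is an eigenvalue.
  On the segment, quasimodes in distinct frequencies of \<open>x\<^sub>2\<close> rule out the Fredholm property.
  Eigenvectors for nonzero \<open>z\<close> may be projected to one frequency of \<open>x\<^sub>2\<close>, where the operator gains
  a derivative, so that the eigenvalues do not depend on \<open>s\<close>.

  The growth bound holds for every bounded operator \<open>T\<close> on a complete space: its spectrum lies in
  a disc around \<open>- a\<close> of radius \<open>a + \<Lambda> + \<eta> / 2\<close> for \<open>a\<close> large, so the powers of \<open>T + a\<close> are
  controlled by the spectral radius and \<open>e\<^bsup>tT\<^esup> = e\<^bsup>-ta\<^esup> e\<^bsup>t(T + a)\<^esup>\<close>.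
\<close>

section \<open>Square-summable families\<close>

text \<open>The operator has order zero only because \<open>X_space\<close> places \<omega> one
  derivative below \<open>F\<close>. In the weighted coordinates both off-diagonal blocks become, at
  high frequency, \<open>- k \<surd>(1 + k\<^sup>2) cos(k x1) d2 / <D>\<close> with
  \<open><D> = \<surd>(1 - Laplacian)\<close>: the factor \<open>\<surd>(1 + k\<^sup>2)\<close> on
  \<omega> shares the constant of \<open>B_op\<close> evenly between the blocks. Splitting
  \<open>1 / <D>\<close> evenly on both sides gives \<open>L\<^sub>0\<close>, and
  \<open>\<bar>n2\<bar> \<le> <n>\<close> gives its norm bound.

  The bound on \<open>L\<^sub>0\<close> alone would reach only \<open>\<bar>z\<bar> > c\<close>. The
  disc centred at \<open>- b\<close> with radius \<open>\<surd>(c\<^sup>2 + b\<^sup>2)\<close> has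
  \<open>\<i> c\<close> and \<open>- \<i> c\<close> on its boundary, and over all real
  \<open>b\<close> these discs intersect exactly in the segment; hence the shift.

  The correction to \<open>L\<^sub>0\<close> exceeds a given tolerance at finitely many indices
  only. Discarding those coordinates leaves a Neumann series, and restoring them costs finite rank,
  so that linear algebra takes the place of compact operators.

  A vector-valued resolvent is made scalar by finitely supported functionals of norm at most one
  that recover the norm; Cauchy's estimate is applied to each, with a constant common to
  all.\<close>

definition l2 :: "('i \<Rightarrow> complex) set" where
  "l2 = {x. (\<lambda>i. (cmod (x i))\<^sup>2) summable_on UNIV}"

definition l2norm :: "('i \<Rightarrow> complex) \<Rightarrow> real" where
  "l2norm x = sqrt (\<Sum>\<^sub>\<infinity>i. (cmod (x i))\<^sup>2)"

lemma l2norm_nonneg [simp]: "0 \<le> l2norm x"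
  by (simp add: l2norm_def infsum_nonneg)

lemma l2norm_square: "(l2norm x)\<^sup>2 = (\<Sum>\<^sub>\<infinity>i. (cmod (x i))\<^sup>2)"
  by (simp add: l2norm_def infsum_nonneg)

lemma l2_has_sum:
  assumes "x \<in> l2"
  shows "((\<lambda>i. (cmod (x i))\<^sup>2) has_sum (l2norm x)\<^sup>2) UNIV"
  using assms by (simp add: l2_def l2norm_square)

lemma l2_L2_set_le:
  assumes "x \<in> l2" "finite F"
  shows "L2_set (\<lambda>i. cmod (x i)) F \<le> l2norm x"
proof -
  have "(\<Sum>i\<in>F. (cmod (x i))\<^sup>2) \<le> (\<Sum>\<^sub>\<infinity>i. (cmod (x i))\<^sup>2)"
    by (rule finite_sum_le_infsum) (use assms in \<open>auto simp: l2_def\<close>)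
  then show ?thesis by (simp add: L2_set_def l2norm_def)
qed

text \<open>A uniform bound on finite sections yields membership and norm bound together, which
  reduces the \<open>l2\<close> estimates below to the finite inequalities for
  \<open>L2_set\<close>.\<close>

lemma
  assumes "\<And>F. finite F \<Longrightarrow> L2_set (\<lambda>i. cmod (x i)) F \<le> C"
  shows l2I: "x \<in> l2" and l2norm_le: "l2norm x \<le> C"
proof -
  have C: "0 \<le> C" using assms[of "{}"] by simp
  have le: "(\<Sum>i\<in>F. (cmod (x i))\<^sup>2) \<le> C\<^sup>2" if "finite F" for F
    using assms[OF that] C by (simp add: L2_set_def sqrt_le_D)
  then have "bdd_above (sum (\<lambda>i. (cmod (x i))\<^sup>2) ` {F. F \<subseteq> UNIV \<and> finite F})"
    by (auto simp: bdd_above_def)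
  then have s: "(\<lambda>i. (cmod (x i))\<^sup>2) summable_on UNIV"
    by (intro nonneg_bdd_above_summable_on) auto
  then show "x \<in> l2" by (simp add: l2_def)
  have "(\<Sum>\<^sub>\<infinity>i. (cmod (x i))\<^sup>2) \<le> C\<^sup>2"
    by (rule infsum_le_finite_sums[OF s]) (use le in auto)
  then show "l2norm x \<le> C"
    unfolding l2norm_def using C by (simp add: real_le_lsqrt infsum_nonneg)
qed

lemma cmod_le_l2norm: "x \<in> l2 \<Longrightarrow> cmod (x i) \<le> l2norm x"
  using l2_L2_set_le[of x "{i}"] by simp

lemma
  assumes "x \<in> l2" "y \<in> l2"
  shows l2_add: "(\<lambda>i. x i + y i) \<in> l2"
    and l2norm_add: "l2norm (\<lambda>i. x i + y i) \<le> l2norm x + l2norm y"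
proof -
  have "L2_set (\<lambda>i. cmod (x i + y i)) F \<le> l2norm x + l2norm y" if "finite F" for F
  proof -
    have "L2_set (\<lambda>i. cmod (x i + y i)) F \<le> L2_set (\<lambda>i. cmod (x i) + cmod (y i)) F"
      by (rule L2_set_mono) (auto simp: norm_triangle_ineq)
    also have "\<dots> \<le> L2_set (\<lambda>i. cmod (x i)) F + L2_set (\<lambda>i. cmod (y i)) F"
      by (rule L2_set_triangle_ineq)
    also have "\<dots> \<le> l2norm x + l2norm y"
      by (intro add_mono l2_L2_set_le assms that)
    finally show ?thesis .
  qed
  then show "(\<lambda>i. x i + y i) \<in> l2" "l2norm (\<lambda>i. x i + y i) \<le> l2norm x + l2norm y"
    by (auto intro: l2I l2norm_le)
qed

lemma
  assumes "x \<in> l2" "0 \<le> C" "\<And>i. cmod (y i) \<le> C * cmod (x i)"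
  shows l2_dominated: "y \<in> l2" and l2norm_dominated: "l2norm y \<le> C * l2norm x"
proof -
  have "L2_set (\<lambda>i. cmod (y i)) F \<le> C * l2norm x" if "finite F" for F
  proof -
    have "L2_set (\<lambda>i. cmod (y i)) F \<le> L2_set (\<lambda>i. C * cmod (x i)) F"
      by (rule L2_set_mono) (use assms in auto)
    also have "\<dots> = C * L2_set (\<lambda>i. cmod (x i)) F"
      by (simp add: L2_set_right_distrib assms(2))
    also have "\<dots> \<le> C * l2norm x"
      by (intro mult_left_mono l2_L2_set_le assms that)
    finally show ?thesis .
  qed
  then show "y \<in> l2" "l2norm y \<le> C * l2norm x" by (auto intro: l2I l2norm_le)
qed

lemma l2_zero [simp]: "(\<lambda>_. 0) \<in> l2" "l2norm (\<lambda>_. 0) = 0"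
  by (simp_all add: l2_def l2norm_def)

lemma l2_scale: "x \<in> l2 \<Longrightarrow> (\<lambda>i. c * x i) \<in> l2"
  by (rule l2_dominated[where C = "cmod c"]) (auto simp: norm_mult)

lemma l2norm_scale:
  shows "l2norm (\<lambda>i. c * x i) = cmod c * l2norm x"
  by (simp add: l2norm_def norm_mult power_mult_distrib infsum_cmult_right' real_sqrt_mult)

lemma
  assumes "bij h"
  shows l2_reindex: "(\<lambda>i. x (h i)) \<in> l2 \<longleftrightarrow> x \<in> l2"
    and l2norm_reindex: "l2norm (\<lambda>i. x (h i)) = l2norm x"
  using summable_on_reindex_bij_betw[OF assms, of "\<lambda>i. (cmod (x i))\<^sup>2"]
    infsum_reindex_bij_betw[OF assms, of "\<lambda>i. (cmod (x i))\<^sup>2"]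
  by (simp_all add: l2_def l2norm_def)

lemma
  assumes "finite {i. x i \<noteq> 0}"
  shows l2_finite_support: "x \<in> l2"
    and l2norm_finite_support: "(l2norm x)\<^sup>2 = (\<Sum>i\<in>{i. x i \<noteq> 0}. (cmod (x i))\<^sup>2)"
proof -
  have "((\<lambda>i. (cmod (x i))\<^sup>2) has_sum (\<Sum>i\<in>{i. x i \<noteq> 0}. (cmod (x i))\<^sup>2)) {i. x i \<noteq> 0}"
    using assms by (rule has_sum_finite)
  then have *: "((\<lambda>i. (cmod (x i))\<^sup>2) has_sum (\<Sum>i\<in>{i. x i \<noteq> 0}. (cmod (x i))\<^sup>2)) UNIV"
    by (rule has_sum_cong_neutral[THEN iffD1, rotated -1]) auto
  then show "x \<in> l2" by (auto simp: l2_def summable_on_def)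
  from * show "(l2norm x)\<^sup>2 = (\<Sum>i\<in>{i. x i \<noteq> 0}. (cmod (x i))\<^sup>2)"
    by (simp add: l2norm_square infsumI)
qed

text \<open>The finite partial sums exhaust the squared norm, so whatever lives off a large finite
  set and is dominated by \<open>x\<close> is small. This later rules out a square-summable vector
  with fibre parts of constant norm.\<close>

lemma l2_tail:
  assumes x: "x \<in> l2" and e: "0 < e"
  obtains F where "finite F"
    "\<And>y. (\<And>i. cmod (y i) \<le> cmod (x i)) \<Longrightarrow> (\<And>i. i \<in> F \<Longrightarrow> y i = 0) \<Longrightarrow> l2norm y \<le> e"
proof -
  let ?f = "\<lambda>i. (cmod (x i))\<^sup>2"
  have "(sum ?f \<longlongrightarrow> (l2norm x)\<^sup>2) (finite_subsets_at_top UNIV)"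
    using l2_has_sum[OF x] by (simp add: has_sum_def)
  then have "\<forall>\<^sub>F F in finite_subsets_at_top UNIV. dist (sum ?f F) ((l2norm x)\<^sup>2) < e\<^sup>2"
    using e by (intro tendstoD) auto
  then obtain F where F: "finite F" "\<And>G. finite G \<Longrightarrow> F \<subseteq> G \<Longrightarrow> dist (sum ?f G) ((l2norm x)\<^sup>2) < e\<^sup>2"
    by (auto simp: eventually_finite_subsets_at_top)
  show ?thesis
  proof
    fix y assume y: "\<And>i. cmod (y i) \<le> cmod (x i)" "\<And>i. i \<in> F \<Longrightarrow> y i = 0"
    show "l2norm y \<le> e"
    proof (rule l2norm_le)
      fix G :: "'a set" assume G: "finite G"
      have "(\<Sum>i\<in>G. (cmod (y i))\<^sup>2) = (\<Sum>i\<in>G - F. (cmod (y i))\<^sup>2)"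
        by (rule sum.mono_neutral_right) (use G y in auto)
      also have "\<dots> \<le> sum ?f (G - F)"
        by (intro sum_mono power_mono y) auto
      also have "\<dots> = sum ?f (G \<union> F) - sum ?f F"
      proof -
        have "sum ?f ((G - F) \<union> F) = sum ?f (G - F) + sum ?f F"
          by (rule sum.union_disjoint) (use G F(1) in auto)
        then show ?thesis by (simp only: Un_Diff_cancel2 eq_diff_eq)
      qed
      also have "sum ?f (G \<union> F) \<le> (l2norm x)\<^sup>2"
        using l2_L2_set_le[OF x, of "G \<union> F"] G F(1)
        by (simp add: L2_set_def sqrt_le_D)
      also have "(l2norm x)\<^sup>2 - sum ?f F < e\<^sup>2"
        using F(2)[OF F(1)] by (simp add: dist_real_def)
      finally show "L2_set (\<lambda>i. cmod (y i)) G \<le> e"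
        using e by (simp add: L2_set_def real_le_lsqrt)
    qed
  qed (fact F(1))
qed

text \<open>The Cauchy bound is uniform over finite sections, so it passes to the coordinatewise
  limit. Coordinatewise convergence is exported as well: it carries the mean-zero condition to the
  limit.\<close>

lemma l2_complete:
  assumes x: "\<And>m. x m \<in> l2"
    and cauchy: "\<And>e. 0 < e \<Longrightarrow> \<exists>n0. \<forall>i\<ge>n0. \<forall>j\<ge>n0. l2norm (\<lambda>p. x i p - x j p) < e"
  obtains y where "y \<in> l2" "(\<lambda>m::nat. l2norm (\<lambda>p. x m p - y p)) \<longlonglongrightarrow> 0"
    "\<And>p. (\<lambda>m. x m p) \<longlonglongrightarrow> y p"
proof -
  have diff: "(\<lambda>p. x i p - x j p) \<in> l2" for i j
    using l2_add[OF x l2_scale[OF x, of "-1"]] by simp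
  have "Cauchy (\<lambda>m. x m p)" for p
  proof (rule metric_CauchyI)
    fix e :: real assume "0 < e"
    with cauchy obtain n0 where n0: "\<forall>i\<ge>n0. \<forall>j\<ge>n0. l2norm (\<lambda>p. x i p - x j p) < e" by blast
    then show "\<exists>M. \<forall>m\<ge>M. \<forall>n\<ge>M. dist (x m p) (x n p) < e"
      by (metis cmod_le_l2norm[OF diff] dist_norm le_less_trans)
  qed
  then have "\<exists>l. (\<lambda>m. x m p) \<longlonglongrightarrow> l" for p
    by (simp add: Cauchy_convergent_iff convergent_def)
  then obtain y where y: "\<And>p. (\<lambda>m. x m p) \<longlonglongrightarrow> y p" by metis
  have close: "L2_set (\<lambda>p. cmod (x i p - y p)) F \<le> e"
    if n0: "\<forall>i\<ge>n0. \<forall>j\<ge>n0. l2norm (\<lambda>p. x i p - x j p) < e" and "i \<ge> n0" "finite F" for e n0 i F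
  proof (rule tendsto_upperbound)
    show "(\<lambda>j. L2_set (\<lambda>p. cmod (x i p - x j p)) F) \<longlonglongrightarrow> L2_set (\<lambda>p. cmod (x i p - y p)) F"
      unfolding L2_set_def by (intro tendsto_intros y)
    show "\<forall>\<^sub>F j in sequentially. L2_set (\<lambda>p. cmod (x i p - x j p)) F \<le> e"
      using eventually_ge_at_top[of n0]
    proof eventually_elim
      case (elim j)
      with that have "l2norm (\<lambda>p. x i p - x j p) < e" by blast
      then show ?case using l2_L2_set_le[OF diff \<open>finite F\<close>, of i j] by linarith
    qed
  qed auto
  obtain n1 where "\<forall>i\<ge>n1. \<forall>j\<ge>n1. l2norm (\<lambda>p. x i p - x j p) < 1" using cauchy[of 1] by auto
  from close[OF this order_refl] have "(\<lambda>p. x n1 p - y p) \<in> l2" by (rule l2I)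
  from l2_add[OF x[of n1] l2_scale[OF this, of "-1"]] have "y \<in> l2" by simp
  moreover have "(\<lambda>m. l2norm (\<lambda>p. x m p - y p)) \<longlonglongrightarrow> 0"
  proof (rule LIMSEQ_I)
    fix r :: real assume "0 < r"
    then obtain n0 where n0: "\<forall>i\<ge>n0. \<forall>j\<ge>n0. l2norm (\<lambda>p. x i p - x j p) < r/2"
      using cauchy[of "r/2"] by auto
    have "l2norm (\<lambda>p. x m p - y p) \<le> r/2" if "m \<ge> n0" for m
      by (rule l2norm_le) (rule close[OF n0 that])
    then show "\<exists>no. \<forall>n\<ge>no. norm (l2norm (\<lambda>p. x n p - y p) - 0) < r"
      using \<open>0 < r\<close> by (intro exI[of _ n0]) force
  qed
  ultimately show ?thesis using that y by blast
qed

text \<open>The test vector \<open>cnj (x i) / n\<close> on \<open>F\<close> attains the norm of the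
  section of \<open>x\<close> over \<open>F\<close>. Finitely supported functionals are therefore
  enough to recover the norm.\<close>

lemma l2_norming:
  assumes x: "x \<in> l2"
    and *: "\<And>F v. finite F \<Longrightarrow> L2_set (\<lambda>i. cmod (v i)) F \<le> 1 \<Longrightarrow> cmod (\<Sum>i\<in>F. v i * x i) \<le> c"
  shows "l2norm x \<le> c"
proof (rule l2norm_le)
  fix F :: "'a set" assume F: "finite F"
  define n where "n = L2_set (\<lambda>i. cmod (x i)) F"
  have c: "0 \<le> c" using *[of "{}" "\<lambda>_. 0"] by simp
  show "n \<le> c"
  proof (cases "n = 0")
    case False
    then have n: "0 < n" by (simp add: n_def order_less_le)
    have "L2_set (\<lambda>i. cmod (cnj (x i) / n)) F = L2_set (\<lambda>i. (1 / n) * cmod (x i)) F"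
      using n by (simp add: norm_divide)
    also have "\<dots> = (1 / n) * n"
      unfolding n_def by (rule L2_set_right_distrib[symmetric]) (simp add: L2_set_nonneg)
    also have "\<dots> = 1" using n by simp
    finally have "cmod (\<Sum>i\<in>F. cnj (x i) / n * x i) \<le> c" by (intro *[OF F]) simp
    also have "(\<Sum>i\<in>F. cnj (x i) / n * x i) = of_real ((\<Sum>i\<in>F. (cmod (x i))\<^sup>2) / n)"
      by (simp add: sum_divide_distrib complex_norm_square mult.commute flip: of_real_power)
    also have "(\<Sum>i\<in>F. (cmod (x i))\<^sup>2) = n\<^sup>2" by (simp add: n_def L2_set_def sum_nonneg)
    finally show ?thesis using n by (simp add: power2_eq_square)
  qed (use c in simp)
qed

lemma l2_pairing_le:
  assumes "x \<in> l2" "finite F" "L2_set (\<lambda>i. cmod (v i)) F \<le> 1"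
  shows "cmod (\<Sum>i\<in>F. v i * x i) \<le> l2norm x"
proof -
  have "cmod (\<Sum>i\<in>F. v i * x i) \<le> (\<Sum>i\<in>F. cmod (v i) * cmod (x i))"
    by (rule order_trans[OF norm_sum]) (simp add: norm_mult)
  also have "\<dots> \<le> L2_set (\<lambda>i. cmod (v i)) F * L2_set (\<lambda>i. cmod (x i)) F"
    using L2_set_mult_ineq[of "\<lambda>i. cmod (v i)" "\<lambda>i. cmod (x i)" F] by simp
  also have "\<dots> \<le> 1 * l2norm x"
    by (intro mult_mono l2_L2_set_le assms) auto
  finally show ?thesis by simp
qed

section \<open>Skew-adjoint shifts and weighted shifts\<close>

text \<open>The symmetric coefficients \<open>D\<close> times \<open>\<i> \<kappa>\<close> form a
  skew-adjoint operator, so its cross term with the real multiple \<open>b\<close> vanishes. What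
  remains is \<open>b\<^sup>2\<close> plus the squared norm of the two shifts, and \<open>\<bar>v +
  w\<bar>\<^sup>2 \<le> 2 (\<bar>v\<bar>\<^sup>2 + \<bar>w\<bar>\<^sup>2)\<close> accounts for the
  factor 4.\<close>

lemma
  fixes D :: "'i \<Rightarrow> real" and \<kappa> b :: real and x :: "'i \<Rightarrow> complex"
  assumes inv: "\<And>i. \<tau>' (\<tau> i) = i" "\<And>i. \<tau> (\<tau>' i) = i"
    and D: "\<And>i. \<bar>D i\<bar> \<le> 1" and x: "x \<in> l2"
  defines "y \<equiv> \<lambda>i. of_real b * x i + \<i> * of_real \<kappa> * (D i * x (\<tau> i) + D (\<tau>' i) * x (\<tau>' i))"
  shows skew_l2: "y \<in> l2" and skew_l2norm: "l2norm y \<le> sqrt (4 * \<kappa>\<^sup>2 + b\<^sup>2) * l2norm x"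
proof -
  have bij: "bij \<tau>"
    by (rule o_bij[of \<tau>']) (use inv in auto)
  have bij': "bij \<tau>'"
    by (rule o_bij[of \<tau>]) (use inv in auto)
  define p where "p i = D i * Im (cnj (x i) * x (\<tau> i))" for i
  let ?S = "(l2norm x)\<^sup>2"
  have S: "((\<lambda>i. (cmod (x i))\<^sup>2) has_sum ?S) UNIV" by (rule l2_has_sum[OF x])
  have S1: "((\<lambda>i. (cmod (x (\<tau> i)))\<^sup>2) has_sum ?S) UNIV"
    using has_sum_reindex_bij_betw[OF bij, of "\<lambda>i. (cmod (x i))\<^sup>2"] S by simp
  have S2: "((\<lambda>i. (cmod (x (\<tau>' i)))\<^sup>2) has_sum ?S) UNIV"
    using has_sum_reindex_bij_betw[OF bij', of "\<lambda>i. (cmod (x i))\<^sup>2"] S by simp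
  have "(\<lambda>i. norm (p i)) summable_on UNIV"
  proof (rule Infinite_Sum.abs_summable_on_comparison_test')
    show "(\<lambda>i. (cmod (x i))\<^sup>2 + (cmod (x (\<tau> i)))\<^sup>2) summable_on UNIV"
      using has_sum_add[OF S S1] by (auto simp: summable_on_def)
    fix i
    have "\<bar>Im (cnj (x i) * x (\<tau> i))\<bar> \<le> cmod (x i) * cmod (x (\<tau> i))"
      by (metis abs_Im_le_cmod complex_mod_cnj norm_mult)
    then have "\<bar>p i\<bar> \<le> 1 * (cmod (x i) * cmod (x (\<tau> i)))"
      unfolding p_def abs_mult by (intro mult_mono D) auto
    also have "\<dots> \<le> (cmod (x i))\<^sup>2 + (cmod (x (\<tau> i)))\<^sup>2"
      using sum_squares_bound[of "cmod (x i)" "cmod (x (\<tau> i))"]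
      by (simp add: mult.assoc) (smt (verit) norm_ge_zero mult_nonneg_nonneg)
    finally show "norm (p i) \<le> (cmod (x i))\<^sup>2 + (cmod (x (\<tau> i)))\<^sup>2" by simp
  qed
  from abs_summable_summable[OF this] obtain P where P: "(p has_sum P) UNIV"
    by (auto simp: summable_on_def)
  have P': "((\<lambda>i. p (\<tau>' i)) has_sum P) UNIV"
    using has_sum_reindex_bij_betw[OF bij', of p] P by simp
  \<comment> \<open>A pointwise majorant of \<open>(cmod (y i))\<^sup>2\<close> whose sum is known
    exactly.\<close>
  let ?g = "\<lambda>i. b\<^sup>2 * (cmod (x i))\<^sup>2 + 2 * b * \<kappa> * (p (\<tau>' i) + (-1) * p i)
    + 2 * \<kappa>\<^sup>2 * ((cmod (x (\<tau> i)))\<^sup>2 + (cmod (x (\<tau>' i)))\<^sup>2)"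
  have "(?g has_sum (b\<^sup>2 * ?S + 2 * b * \<kappa> * (P + (-1) * P) + 2 * \<kappa>\<^sup>2 * (?S + ?S))) UNIV"
    by (intro has_sum_add has_sum_cmult_right S S1 S2 P P')
  then have g: "(?g has_sum ((4 * \<kappa>\<^sup>2 + b\<^sup>2) * ?S)) UNIV" by (simp add: algebra_simps)
  have le: "(cmod (y i))\<^sup>2 \<le> ?g i" for i
  proof -
    define u v w where "u = x i" and "v = D i * x (\<tau> i)" and "w = D (\<tau>' i) * x (\<tau>' i)"
    have p1: "p i = Im (cnj u * v)" by (simp add: p_def u_def v_def algebra_simps)
    have p2: "p (\<tau>' i) = - Im (cnj u * w)"
      by (simp add: p_def u_def w_def inv algebra_simps)
    have v: "(cmod v)\<^sup>2 \<le> (cmod (x (\<tau> i)))\<^sup>2"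
      using mult_right_mono[OF D[of i], of "cmod (x (\<tau> i))"]
      by (simp add: v_def norm_mult power_mono)
    have w: "(cmod w)\<^sup>2 \<le> (cmod (x (\<tau>' i)))\<^sup>2"
      using mult_right_mono[OF D[of "\<tau>' i"], of "cmod (x (\<tau>' i))"]
      by (simp add: w_def norm_mult power_mono)
    have "(cmod (y i))\<^sup>2 = (cmod (of_real b * u + \<i> * of_real \<kappa> * (v + w)))\<^sup>2"
      by (simp add: y_def u_def v_def w_def)
    also have "\<dots> = b\<^sup>2 * (cmod u)\<^sup>2 + 2 * b * \<kappa> * (- Im (cnj u * w) - Im (cnj u * v))
        + \<kappa>\<^sup>2 * (cmod (v + w))\<^sup>2"
      unfolding cmod_power2 by (simp add: power2_eq_square algebra_simps)
    also have "(cmod (v + w))\<^sup>2 \<le> 2 * ((cmod v)\<^sup>2 + (cmod w)\<^sup>2)"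
    proof -
      have "(cmod (v + w))\<^sup>2 \<le> (cmod v + cmod w)\<^sup>2"
        by (intro power_mono norm_triangle_ineq) auto
      also have "\<dots> \<le> 2 * ((cmod v)\<^sup>2 + (cmod w)\<^sup>2)"
        using sum_squares_bound[of "cmod v" "cmod w"] by (simp add: power2_sum)
      finally show ?thesis .
    qed
    then have "\<kappa>\<^sup>2 * (cmod (v + w))\<^sup>2 \<le> \<kappa>\<^sup>2 * (2 * ((cmod (x (\<tau> i)))\<^sup>2 + (cmod (x (\<tau>' i)))\<^sup>2))"
      by (rule mult_left_mono[OF order_trans[OF _ mult_left_mono[OF add_mono[OF v w]]]]) simp_all
    finally show ?thesis by (simp add: p1 p2 u_def[symmetric] algebra_simps)
  qed
  let ?C = "sqrt (4 * \<kappa>\<^sup>2 + b\<^sup>2) * l2norm x"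
  have "L2_set (\<lambda>i. cmod (y i)) F \<le> ?C" if F: "finite F" for F
  proof -
    have "(\<Sum>i\<in>F. (cmod (y i))\<^sup>2) \<le> sum ?g F" by (intro sum_mono le)
    also have "\<dots> \<le> (4 * \<kappa>\<^sup>2 + b\<^sup>2) * ?S"
      by (rule finite_sum_le_has_sum[OF g F]) (use le order_trans[OF zero_le_power2] in blast)+
    finally show ?thesis
      unfolding L2_set_def by (intro real_le_lsqrt) (auto simp: power_mult_distrib sum_nonneg)
  qed
  then show "y \<in> l2" "l2norm y \<le> ?C" by (auto intro: l2I l2norm_le)
qed

text \<open>The coefficient bound is asked only where \<open>x (h i)\<close> is nonzero. Vectors
  that vanish on an exceptional finite set, or live on one fibre, thus meet only the coefficients
  controlled there.\<close>

lemma
  assumes "bij h" "x \<in> l2" "0 \<le> \<delta>" "\<And>i. x (h i) \<noteq> 0 \<Longrightarrow> cmod (e i) \<le> \<delta>"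
  shows shift_l2: "(\<lambda>i. e i * x (h i)) \<in> l2"
    and shift_l2norm: "l2norm (\<lambda>i. e i * x (h i)) \<le> \<delta> * l2norm x"
proof -
  have x': "(\<lambda>i. x (h i)) \<in> l2" using assms l2_reindex by blast
  have le: "cmod (e i * x (h i)) \<le> \<delta> * cmod (x (h i))" for i
    using assms(3) assms(4)[of i] by (cases "x (h i) = 0") (auto simp: norm_mult mult_right_mono)
  show "(\<lambda>i. e i * x (h i)) \<in> l2" by (rule l2_dominated[OF x' assms(3) le])
  show "l2norm (\<lambda>i. e i * x (h i)) \<le> \<delta> * l2norm x"
    using l2norm_dominated[OF x' assms(3) le] by (simp add: l2norm_reindex[OF assms(1)])
qed

section \<open>Bounded operators on complete spaces of states\<close>

lemma cscale_simps [simp]: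
  "cscale 1 u = u" "cscale 0 u = 0" "cscale c 0 = 0"
  "cscale c (cscale d u) = cscale (c * d) u"
  by (auto simp: cscale_def zero_prod_def zero_fun_def)

lemma cscale_distrib:
  "cscale c (u + v) = cscale c u + cscale c v"
  "cscale c (u - v) = cscale c u - cscale c v"
  "cscale (c + d) u = cscale c u + cscale d u"
  "cscale (c - d) u = cscale c u - cscale d u"
  "cscale c (- u) = - cscale c u"
  "cscale (- c) u = - cscale c u"
  by (rule state.scale_right_distrib state.scale_right_diff_distrib state.scale_left_distrib
      state.scale_left_diff_distrib state.scale_minus_right state.scale_minus_left)+

text \<open>Space and norm are parameters because the same arguments serve each
  \<open>X_space s\<close>, its closed subspaces, and two equivalent norms on it.\<close>

locale banach_states =
  fixes V :: "state set" and N :: "state \<Rightarrow> real"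
  assumes V_subspace: "state.subspace V"
    and N_nonneg: "u \<in> V \<Longrightarrow> 0 \<le> N u"
    and N_add: "u \<in> V \<Longrightarrow> v \<in> V \<Longrightarrow> N (u + v) \<le> N u + N v"
    and N_scale: "u \<in> V \<Longrightarrow> N (cscale c u) = cmod c * N u"
    and N_eq_0D: "u \<in> V \<Longrightarrow> N u = 0 \<Longrightarrow> u = 0"
    and N_complete: "(\<And>i. x i \<in> V) \<Longrightarrow>
      (\<And>e. 0 < e \<Longrightarrow> \<exists>n0. \<forall>i\<ge>n0. \<forall>j\<ge>n0. N (x i - x j) < e) \<Longrightarrow>
      \<exists>l\<in>V. (\<lambda>i::nat. N (x i - l)) \<longlonglongrightarrow> 0"
begin

lemma V_zero [simp, intro]: "0 \<in> V" using V_subspace by (rule state.subspace_0)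
lemma V_add [intro]: "u \<in> V \<Longrightarrow> v \<in> V \<Longrightarrow> u + v \<in> V" using V_subspace by (rule state.subspace_add)
lemma V_diff [intro]: "u \<in> V \<Longrightarrow> v \<in> V \<Longrightarrow> u - v \<in> V" using V_subspace by (rule state.subspace_diff)
lemma V_scale [intro]: "u \<in> V \<Longrightarrow> cscale c u \<in> V" using V_subspace by (rule state.subspace_scale)
lemma V_sum [intro]: "(\<And>i. i \<in> A \<Longrightarrow> f i \<in> V) \<Longrightarrow> sum f A \<in> V"
  using V_subspace by (rule state.subspace_sum)
lemma V_uminus [intro]: "u \<in> V \<Longrightarrow> - u \<in> V" using V_diff[of 0 u] by simp

lemma N_zero [simp]: "N 0 = 0" using N_scale[OF V_zero, of 0] by simp

lemma N_uminus: "u \<in> V \<Longrightarrow> N (- u) = N u"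
  using N_scale[of u "-1"] by (simp add: cscale_distrib)

lemma N_minus_commute: "u \<in> V \<Longrightarrow> v \<in> V \<Longrightarrow> N (u - v) = N (v - u)"
  using N_uminus[of "u - v"] by (simp add: V_diff)

lemma N_diff: "u \<in> V \<Longrightarrow> v \<in> V \<Longrightarrow> N (u - v) \<le> N u + N v"
  using N_add[of u "- v"] N_uminus[of v] by (simp add: V_uminus)

lemma N_diff_ge: "u \<in> V \<Longrightarrow> v \<in> V \<Longrightarrow> N u - N v \<le> N (u - v)"
  using N_add[of "u - v" v] by (simp add: V_diff)

lemma N_triangle3: "u \<in> V \<Longrightarrow> v \<in> V \<Longrightarrow> w \<in> V \<Longrightarrow> N (u - w) \<le> N (u - v) + N (v - w)"
  using N_add[of "u - v" "v - w"] by (simp add: V_diff)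

lemma N_sum: "finite A \<Longrightarrow> (\<And>i. i \<in> A \<Longrightarrow> f i \<in> V) \<Longrightarrow> N (sum f A) \<le> (\<Sum>i\<in>A. N (f i))"
proof (induction A rule: finite_induct)
  case (insert a A)
  then have "N (sum f (insert a A)) \<le> N (f a) + N (sum f A)"
    by (simp add: N_add V_sum)
  with insert show ?case by simp
qed simp

lemma limit_unique:
  assumes "\<And>i. x i \<in> V" "l \<in> V" "l' \<in> V"
    and "(\<lambda>i::nat. N (x i - l)) \<longlonglongrightarrow> 0" "(\<lambda>i. N (x i - l')) \<longlonglongrightarrow> 0"
  shows "l = l'"
proof -
  have "(\<lambda>i. N (x i - l) + N (x i - l')) \<longlonglongrightarrow> 0 + 0" by (intro tendsto_add assms)
  then have "(\<lambda>i. N (x i - l) + N (x i - l')) \<longlonglongrightarrow> 0" by simp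
  moreover have "N (l - l') \<le> N (x i - l) + N (x i - l')" for i
    using N_triangle3[OF assms(2) assms(1)[of i] assms(3)] N_minus_commute[OF assms(2) assms(1)[of i]]
    by simp
  ultimately have "N (l - l') \<le> 0" by (intro LIMSEQ_le_const) auto
  then show ?thesis
    using N_eq_0D[of "l - l'"] N_nonneg[of "l - l'"] assms(2,3) by (simp add: V_diff)
qed

lemma bounded_opD:
  assumes "bounded_op V N T"
  shows "u \<in> V \<Longrightarrow> T u \<in> V" "linear_on V T"
    "u \<in> V \<Longrightarrow> v \<in> V \<Longrightarrow> T (u + v) = T u + T v" "u \<in> V \<Longrightarrow> T (cscale c u) = cscale c (T u)"
  using assms unfolding bounded_op_def linear_on_def by blast+

lemma bounded_op_zero: "bounded_op V N T \<Longrightarrow> T 0 = 0"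
  using bounded_opD(4)[of T 0 0] by simp

lemma bounded_op_diff:
  assumes "bounded_op V N T" "u \<in> V" "v \<in> V"
  shows "T (u - v) = T u - T v"
proof -
  have "T (u + cscale (-1) v) = T u + cscale (-1) (T v)"
    using assms bounded_opD[OF assms(1)] by (metis V_scale)
  then show ?thesis by (simp add: cscale_distrib)
qed

lemma bounded_op_sum:
  assumes T: "bounded_op V N T" and "finite A" "\<And>i. i \<in> A \<Longrightarrow> f i \<in> V"
  shows "T (sum f A) = (\<Sum>i\<in>A. T (f i))"
  using assms(2,3)
proof (induction A rule: finite_induct)
  case (insert a A)
  then show ?case by (simp add: bounded_opD(3)[OF T] V_sum)
qed (simp add: bounded_op_zero[OF T])

lemma bounded_op_bound:
  assumes "bounded_op V N T"
  obtains C where "0 \<le> C" "\<And>u. u \<in> V \<Longrightarrow> N (T u) \<le> C * N u"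
proof -
  obtain C where C: "\<And>u. u \<in> V \<Longrightarrow> N (T u) \<le> C * N u"
    using assms unfolding bounded_op_def by blast
  have "N (T u) \<le> max 0 C * N u" if "u \<in> V" for u
    using C[OF that] mult_right_mono[of C "max 0 C" "N u"] N_nonneg[OF that] by linarith
  with that[of "max 0 C"] show ?thesis by simp
qed

lemma bounded_opI:
  assumes "\<And>u. u \<in> V \<Longrightarrow> T u \<in> V" "\<And>u v. u \<in> V \<Longrightarrow> v \<in> V \<Longrightarrow> T (u + v) = T u + T v"
    "\<And>c u. u \<in> V \<Longrightarrow> T (cscale c u) = cscale c (T u)" "\<And>u. u \<in> V \<Longrightarrow> N (T u) \<le> C * N u"
  shows "bounded_op V N T"
  unfolding bounded_op_def linear_on_def by (intro conjI image_subsetI ballI allI exI[of _ C] assms)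

lemma bounded_op_scale_minus:
  assumes "bounded_op V N T"
  shows "bounded_op V N (\<lambda>u. cscale z u - T u)"
proof -
  obtain C where C: "0 \<le> C" "\<And>u. u \<in> V \<Longrightarrow> N (T u) \<le> C * N u" using bounded_op_bound[OF assms] by blast
  note D = bounded_opD[OF assms]
  show ?thesis
  proof (rule bounded_opI)
    show "N (cscale z u - T u) \<le> (cmod z + C) * N u" if "u \<in> V" for u
      using N_diff[of "cscale z u" "T u"] C(2)[OF that] that by (simp add: D V_scale N_scale algebra_simps)
  qed (auto simp: D cscale_distrib algebra_simps)
qed

lemma shifted_bounded_op: "bounded_op V N T \<Longrightarrow> bounded_op V N (shifted z T)"
  unfolding shifted_def by (rule bounded_op_scale_minus)

lemma series_converges:
  assumes a: "\<And>i. a i \<in> V" and s: "summable (\<lambda>i. N (a i))"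
  obtains l where "l \<in> V" "(\<lambda>n::nat. N ((\<Sum>i<n. a i) - l)) \<longlonglongrightarrow> 0"
proof -
  let ?s = "\<lambda>n. \<Sum>i<n. a i"
  have "\<exists>l\<in>V. (\<lambda>n. N (?s n - l)) \<longlonglongrightarrow> 0"
  proof (rule N_complete)
    fix e :: real assume "0 < e"
    with s obtain n0 where n0: "\<And>m n. m \<ge> n0 \<Longrightarrow> norm (sum (\<lambda>i. N (a i)) {m..<n}) < e"
      unfolding summable_Cauchy by blast
    have *: "N (?s n - ?s m) < e" if "m \<ge> n0" "m \<le> n" for m n
    proof -
      have "?s n - ?s m = sum a {m..<n}"
        using that sum_diff_nat_ivl[of 0 m n a] by (simp add: atLeast0LessThan)
      also have "N \<dots> \<le> sum (\<lambda>i. N (a i)) {m..<n}" by (rule N_sum) (use a in auto)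
      also have "\<dots> < e" using n0[OF that(1), of n] by simp
      finally show ?thesis .
    qed
    have "N (?s i - ?s j) < e" if "i \<ge> n0" "j \<ge> n0" for i j
      using *[of i j] *[of j i] that N_minus_commute[OF V_sum V_sum, of "{..<i}" a "{..<j}" a] a
      by (cases "i \<le> j") auto
    then show "\<exists>n0. \<forall>i\<ge>n0. \<forall>j\<ge>n0. N (?s i - ?s j) < e" by blast
  qed (use a in auto)
  then show ?thesis using that by blast
qed

section \<open>Bounded inverses and the Neumann series\<close>

definition inv_op :: "(state \<Rightarrow> state) \<Rightarrow> bool" where
  "inv_op T \<longleftrightarrow> (\<exists>S. bounded_op V N S \<and> (\<forall>u\<in>V. S (T u) = u \<and> T (S u) = u))"

lemma resolvent_set_iff: "z \<in> resolvent_set V N T \<longleftrightarrow> inv_op (shifted z T)"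
  by (simp add: resolvent_set_def inv_op_def)

lemma inv_opI:
  assumes T: "bounded_op V N T" and \<delta>: "0 < \<delta>" "\<And>u. u \<in> V \<Longrightarrow> \<delta> * N u \<le> N (T u)"
    and surj: "\<And>v. v \<in> V \<Longrightarrow> \<exists>u\<in>V. T u = v"
  shows "inv_op T"
proof -
  note D = bounded_opD[OF T]
  obtain S where S: "\<And>v. v \<in> V \<Longrightarrow> S v \<in> V \<and> T (S v) = v" using surj by metis
  have inj: "u = v" if "u \<in> V" "v \<in> V" "T u = T v" for u v
  proof -
    have "\<delta> * N (u - v) \<le> 0" using \<delta>(2)[of "u - v"] that bounded_op_diff[OF T] by (simp add: V_diff)
    then have "N (u - v) = 0" using \<delta>(1) N_nonneg[of "u - v"] that
      by (smt (verit) V_diff mult_pos_pos)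
    then show ?thesis using N_eq_0D[of "u - v"] that by (simp add: V_diff)
  qed
  have ST: "S (T u) = u" if "u \<in> V" for u using S[OF D(1)[OF that]] that inj by blast
  have "bounded_op V N S"
  proof (rule bounded_opI)
    show "N (S u) \<le> (1 / \<delta>) * N u" if "u \<in> V" for u
      using \<delta>(2)[of "S u"] S[OF that] \<delta>(1) by (simp add: field_simps)
    show "S (u + v) = S u + S v" if "u \<in> V" "v \<in> V" for u v
      by (rule inj) (use S that in \<open>simp_all add: D V_add\<close>)
    show "S (cscale c u) = cscale c (S u)" if "u \<in> V" for c u
      by (rule inj) (use S that in \<open>simp_all add: D V_scale\<close>)
  qed (use S in blast)
  with ST S show ?thesis unfolding inv_op_def by blast
qed

text \<open>The geometric series of \<open>A = W / \<mu>\<close> has ratio at most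
  \<open>\<theta> = q / cmod \<mu> < 1\<close> and solves the equation; the lower bound
  \<open>cmod \<mu> - q\<close> makes the solution unique and the inverse bounded.\<close>

lemma neumann:
  assumes W: "bounded_op V N W" and q: "\<And>u. u \<in> V \<Longrightarrow> N (W u) \<le> q * N u" "q < cmod \<mu>" "0 \<le> q"
  shows "inv_op (\<lambda>u. cscale \<mu> u - W u)"
proof (rule inv_opI)
  note D = bounded_opD[OF W]
  have \<mu>: "\<mu> \<noteq> 0" using q by auto
  show "bounded_op V N (\<lambda>u. cscale \<mu> u - W u)" by (rule bounded_op_scale_minus[OF W])
  show "0 < cmod \<mu> - q" using q by simp
  show "(cmod \<mu> - q) * N u \<le> N (cscale \<mu> u - W u)" if "u \<in> V" for u
    using N_diff_ge[of "cscale \<mu> u" "W u"] q(1)[OF that] that by (simp add: V_scale D N_scale algebra_simps)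
  fix v assume v: "v \<in> V"
  define \<theta> where "\<theta> = q / cmod \<mu>"
  have \<theta>: "0 \<le> \<theta>" "\<theta> < 1" using q by (auto simp: \<theta>_def divide_simps)
  define A where "A u = cscale (1 / \<mu>) (W u)" for u
  have A_le: "N (A u) \<le> \<theta> * N u" if "u \<in> V" for u
    using q(1)[OF that] \<mu> by (simp add: A_def N_scale D that \<theta>_def norm_divide field_simps)
  then have A: "bounded_op V N A"
    by (intro bounded_opI[where C = \<theta>]) (simp_all add: A_def D V_scale cscale_distrib mult.commute)
  define a where "a i = (A ^^ i) (cscale (1 / \<mu>) v)" for i :: nat
  have aV: "a i \<in> V" and aN: "N (a i) \<le> \<theta> ^ i * N (a 0)" for i
  proof -
    have "a i \<in> V \<and> N (a i) \<le> \<theta> ^ i * N (a 0)"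
    proof (induction i)
      case (Suc i)
      have "N (A (a i)) \<le> \<theta> * (\<theta> ^ i * N (a 0))"
        using A_le[of "a i"] Suc \<theta> mult_left_mono[of _ _ \<theta>] by fastforce
      then show ?case using Suc bounded_opD(1)[OF A] by (simp add: a_def mult.assoc)
    qed (use v in \<open>auto simp: a_def\<close>)
    then show "a i \<in> V" "N (a i) \<le> \<theta> ^ i * N (a 0)" by auto
  qed
  have "summable (\<lambda>i. N (a i))"
  proof (rule summable_comparison_test')
    show "summable (\<lambda>i. \<theta> ^ i * N (a 0))" using \<theta> by (intro summable_mult2 summable_geometric) auto
    show "norm (N (a i)) \<le> \<theta> ^ i * N (a 0)" for i using aN N_nonneg[OF aV] by simp
  qed
  from series_converges[OF aV this]
  obtain l where l: "l \<in> V" "(\<lambda>n. N ((\<Sum>i<n. a i) - l)) \<longlonglongrightarrow> 0" .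
  let ?s = "\<lambda>n. \<Sum>i<n. a i"
  have sV: "?s n \<in> V" for n using aV by auto
  \<comment> \<open>Both sides of this recursion converge, so the limit satisfies
    \<open>l = a 0 + A l\<close>, which is the equation divided by \<open>\<mu>\<close>.\<close>
  have "?s (Suc n) = a 0 + A (?s n)" for n
  proof -
    have "A (?s n) = (\<Sum>i<n. a (Suc i))"
      using bounded_op_sum[OF A, of "{..<n}" a] aV by (simp add: a_def)
    then show ?thesis by (simp only: sum.lessThan_Suc_shift)
  qed
  moreover have "(\<lambda>n. N ((a 0 + A (?s n)) - (a 0 + A l))) \<longlonglongrightarrow> 0"
  proof (rule tendsto_sandwich[OF _ _ tendsto_const])
    have "N ((a 0 + A (?s n)) - (a 0 + A l)) \<le> \<theta> * N (?s n - l)" for n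
      using A_le[of "?s n - l"] bounded_op_diff[OF A sV l(1)] V_diff[OF sV l(1)] by simp
    then show "\<forall>\<^sub>F n in sequentially. N ((a 0 + A (?s n)) - (a 0 + A l)) \<le> \<theta> * N (?s n - l)" by simp
    show "(\<lambda>n. \<theta> * N (?s n - l)) \<longlonglongrightarrow> 0" using tendsto_mult_left[OF l(2), of \<theta>] by simp
    have "0 \<le> N ((a 0 + A (?s n)) - (a 0 + A l))" for n
      by (intro N_nonneg V_diff V_add aV bounded_opD(1)[OF A] sV l)
    then show "\<forall>\<^sub>F n in sequentially. 0 \<le> N ((a 0 + A (?s n)) - (a 0 + A l))" by simp
  qed
  ultimately have "(\<lambda>n. N (?s (Suc n) - (a 0 + A l))) \<longlonglongrightarrow> 0" by simp
  moreover have "(\<lambda>n. N (?s (Suc n) - l)) \<longlonglongrightarrow> 0" using l(2) by (rule LIMSEQ_Suc)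
  ultimately have "l = a 0 + A l"
    using limit_unique[of "\<lambda>n. ?s (Suc n)" l "a 0 + A l"] l(1) sV aV bounded_opD(1)[OF A] by blast
  then have "cscale \<mu> l = cscale \<mu> (a 0 + A l)" by simp
  then have "cscale \<mu> l - W l = v"
    using \<mu> by (simp add: cscale_distrib a_def A_def)
  with l(1) show "\<exists>u\<in>V. cscale \<mu> u - W u = v" by blast
qed

section \<open>Closedness under finite-dimensional extension\<close>

text \<open>A vector \<open>e\<close> outside the closed \<open>W\<close> has positive distance
  \<open>\<delta>\<close> from it. Hence the coefficient of \<open>e\<close> is controlled by the
  norm, the coefficients of a convergent sequence form a Cauchy sequence, and the parts in
  \<open>W\<close> converge too.\<close>

lemma closed_subspace_add_vector:
  assumes W: "closed_subspace V N W" and e: "e \<in> V"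
  shows "closed_subspace V N (state.span (insert e W))"
proof (cases "e \<in> W")
  case True
  then have "state.span (insert e W) = W"
    using W by (simp add: closed_subspace_def insert_absorb state.span_eq_iff)
  then show ?thesis using W by simp
next
  case False
  have sub: "state.subspace W" and WV: "W \<subseteq> V"
    using W unfolding closed_subspace_def by blast+
  have cl: "l \<in> W" if "\<forall>i. x i \<in> W" "l \<in> V" "(\<lambda>i::nat. N (x i - l)) \<longlonglongrightarrow> 0" for x l
    using W that unfolding closed_subspace_def by blast
  have span: "u \<in> state.span (insert e W) \<longleftrightarrow> (\<exists>c. u - cscale c e \<in> W)" for u
    using state.span_insert[of e W] sub by (simp add: state.span_eq_iff[THEN iffD2])
  obtain \<delta> where \<delta>: "0 < \<delta>" "\<And>w. w \<in> W \<Longrightarrow> \<delta> \<le> N (w - e)"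
  proof (rule ccontr)
    assume *: "\<not> thesis"
    have "\<exists>w\<in>W. N (w - e) < inverse (real (Suc n))" for n
      using that[of "inverse (real (Suc n))"] * by (force simp: not_le)
    then obtain w where w: "\<And>n. w n \<in> W" "\<And>n. N (w n - e) < inverse (real (Suc n))" by metis
    have "(\<lambda>n. N (w n - e)) \<longlonglongrightarrow> 0"
    proof (rule tendsto_sandwich[OF _ _ tendsto_const LIMSEQ_inverse_real_of_nat])
      show "\<forall>\<^sub>F n in sequentially. 0 \<le> N (w n - e)"
        using w(1) WV e N_nonneg by (intro always_eventually) blast
      show "\<forall>\<^sub>F n in sequentially. N (w n - e) \<le> inverse (real (Suc n))"
        using w(2) by (simp add: less_imp_le)
    qed
    with cl w(1) e False show False by blast
  qed
  have lower: "cmod c * \<delta> \<le> N (w + cscale c e)" if "w \<in> W" for w c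
  proof (cases "c = 0")
    case True
    then show ?thesis using that WV N_nonneg[of w] by (simp add: subsetD)
  next
    case c: False
    have "\<delta> \<le> N (cscale (- 1 / c) w - e)" by (intro \<delta> state.subspace_scale sub that)
    moreover have "w + cscale c e = cscale (- c) (cscale (- 1 / c) w - e)"
      using c by (simp add: cscale_distrib)
    moreover have "N (cscale (- c) (cscale (- 1 / c) w - e)) = cmod c * N (cscale (- 1 / c) w - e)"
      using that WV e by (subst N_scale) auto
    ultimately show ?thesis by (simp add: mult_left_mono)
  qed
  have "l \<in> state.span (insert e W)"
    if x: "\<forall>i. x i \<in> state.span (insert e W)" and l: "l \<in> V" "(\<lambda>i::nat. N (x i - l)) \<longlonglongrightarrow> 0" for x l
  proof -
    obtain c where c: "\<And>i. x i - cscale (c i) e \<in> W" using x unfolding span by metis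
    define w where "w i = x i - cscale (c i) e" for i
    have w: "w i \<in> W" "x i = w i + cscale (c i) e" for i using c by (auto simp: w_def)
    have xV: "x i \<in> V" for i using w(1)[of i] WV e unfolding w(2) by blast
    have "Cauchy c"
    proof (rule metric_CauchyI)
      fix \<epsilon> :: real assume "0 < \<epsilon>"
      with \<delta>(1) have "\<forall>\<^sub>F i in sequentially. N (x i - l) < \<epsilon> * \<delta> / 2"
        by (intro order_tendstoD(2)[OF l(2)]) simp
      then obtain M where M: "\<And>i. i \<ge> M \<Longrightarrow> N (x i - l) < \<epsilon> * \<delta> / 2"
        by (auto simp: eventually_sequentially)
      have "dist (c i) (c j) < \<epsilon>" if "i \<ge> M" "j \<ge> M" for i j
      proof -
        have "cmod (c i - c j) * \<delta> \<le> N ((w i - w j) + cscale (c i - c j) e)"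
          by (intro lower state.subspace_diff sub w)
        also have "(w i - w j) + cscale (c i - c j) e = x i - x j"
          by (simp add: w(2) cscale_distrib)
        also have "N \<dots> \<le> N (x i - l) + N (l - x j)" by (rule N_triangle3[OF xV l(1) xV])
        also have "\<dots> < \<epsilon> * \<delta>" using M[OF that(1)] M[OF that(2)] N_minus_commute[OF l(1) xV[of j]] by simp
        finally show ?thesis using \<delta>(1) by (simp add: dist_norm)
      qed
      then show "\<exists>M. \<forall>m\<ge>M. \<forall>n\<ge>M. dist (c m) (c n) < \<epsilon>" by blast
    qed
    then obtain d where d: "c \<longlonglongrightarrow> d" by (auto simp: Cauchy_convergent_iff convergent_def)
    have "(\<lambda>i. N (w i - (l - cscale d e))) \<longlonglongrightarrow> 0"
    proof (rule tendsto_sandwich[OF _ _ tendsto_const])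
      have "N (w i - (l - cscale d e)) \<le> N (x i - l) + cmod (d - c i) * N e" for i
      proof -
        have eq: "w i - (l - cscale d e) = (x i - l) + cscale (d - c i) e"
          by (simp add: w(2) cscale_distrib)
        show ?thesis
          unfolding eq using N_add[of "x i - l" "cscale (d - c i) e"] xV l(1) e
          by (simp add: V_diff V_scale N_scale)
      qed
      then show "\<forall>\<^sub>F i in sequentially. N (w i - (l - cscale d e)) \<le> N (x i - l) + cmod (d - c i) * N e" by simp
      have "(\<lambda>i. N (x i - l) + cmod (d - c i) * N e) \<longlonglongrightarrow> 0 + cmod (d - d) * N e"
        by (intro tendsto_intros l d)
      then show "(\<lambda>i. N (x i - l) + cmod (d - c i) * N e) \<longlonglongrightarrow> 0" by simp
      show "\<forall>\<^sub>F i in sequentially. 0 \<le> N (w i - (l - cscale d e))"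
        using w(1) WV l(1) e by (intro always_eventually allI N_nonneg V_diff V_scale) blast+
    qed
    moreover have "l - cscale d e \<in> V" using l(1) e by (intro V_diff V_scale)
    ultimately have "l - cscale d e \<in> W" using cl[of w] w(1) by blast
    then show ?thesis unfolding span by blast
  qed
  moreover have "state.span (insert e W) \<subseteq> V"
    using WV e V_subspace by (intro state.span_minimal) blast+
  ultimately show ?thesis unfolding closed_subspace_def using state.subspace_span by blast
qed

text \<open>Induction over the added vectors by exchange. If \<open>e\<close> cannot be dropped,
  some \<open>r\<close> in \<open>R\<close> involves it, so \<open>r\<close> may replace
  \<open>e\<close>; the space spanned by \<open>r\<close> and \<open>W\<close> is closed and still
  contained in \<open>R\<close>, and \<open>B\<close> has become smaller.\<close>

lemma closed_subspace_finite_codim: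
  assumes "finite B" "closed_subspace V N W" "B \<subseteq> V" "state.subspace R" "W \<subseteq> R"
    "R \<subseteq> state.span (W \<union> B)"
  shows "closed_subspace V N R"
  using assms
proof (induction B arbitrary: W rule: finite_induct)
  case empty
  then have "state.span W = W" by (simp add: closed_subspace_def state.span_eq_iff)
  with empty have "R = W" by (simp add: subset_antisym)
  with empty show ?case by simp
next
  case (insert e B)
  have sub: "state.subspace W" and WV: "W \<subseteq> V" using insert.prems(1) by (simp_all add: closed_subspace_def)
  show ?case
  proof (cases "R \<subseteq> state.span (W \<union> B)")
    case True
    with insert show ?thesis by simp
  next
    case False
    then obtain r where r: "r \<in> R" "r \<notin> state.span (W \<union> B)" by blast
    have "W \<union> insert e B \<subseteq> V" using WV insert.prems(2) by blast
    then have RV: "R \<subseteq> V"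
      using state.span_minimal[OF _ V_subspace] insert.prems(5) by blast
    have ins: "W \<union> insert e B = insert e (W \<union> B)" by auto
    have "r \<in> state.span (insert e (W \<union> B))" using r insert.prems(5) ins by auto
    then have e: "e \<in> state.span (insert r (W \<union> B))" using r(2) by (rule state.in_span_insert)
    have cl: "closed_subspace V N (state.span (insert r W))"
      using r(1) RV insert.prems(1) by (intro closed_subspace_add_vector) blast+
    show ?thesis
    proof (rule insert.IH[OF cl])
      show "B \<subseteq> V" "state.subspace R" using insert.prems(2,3) by blast+
      show "state.span (insert r W) \<subseteq> R"
        using r(1) insert.prems(3,4) by (intro state.span_minimal) blast+
      have "insert r (W \<union> B) \<subseteq> state.span (insert r W) \<union> B"
        by (auto simp: state.span_base)
      then have "state.span (insert r (W \<union> B)) \<subseteq> state.span (state.span (insert r W) \<union> B)"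
        by (rule state.span_mono)
      moreover have "state.span (W \<union> insert e B) \<subseteq> state.span (insert r (W \<union> B))"
        using e by (intro state.span_minimal state.subspace_span) (auto simp: state.span_base)
      ultimately show "R \<subseteq> state.span (state.span (insert r W) \<union> B)" using insert.prems(5) by blast
    qed
  qed
qed

end

section \<open>Finite rank perturbations of invertible operators\<close>

text \<open>\<open>T\<close> is the invertible \<open>Q\<close> minus an operator of finite rank.
  The vectors \<open>e\<close> are dual to the functionals \<open>x\<close>, which splits the space
  into the common kernel of the \<open>x g\<close> and the span of the \<open>e g\<close>.\<close>

locale finite_rank_perturbation = banach_states +
  fixes Q R T :: "state \<Rightarrow> state" and G :: "'g set" and x :: "'g \<Rightarrow> state \<Rightarrow> complex"
    and h e :: "'g \<Rightarrow> state" and c :: "'g \<Rightarrow> real"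
  assumes Q: "bounded_op V N Q" and R: "bounded_op V N R"
    and RQ: "u \<in> V \<Longrightarrow> R (Q u) = u" and QR: "u \<in> V \<Longrightarrow> Q (R u) = u"
    and G: "finite G" and h: "g \<in> G \<Longrightarrow> h g \<in> V" and e: "g \<in> G \<Longrightarrow> e g \<in> V"
    and x_add: "u \<in> V \<Longrightarrow> v \<in> V \<Longrightarrow> x g (u + v) = x g u + x g v"
    and x_scale: "u \<in> V \<Longrightarrow> x g (cscale a u) = a * x g u"
    and x_bound: "g \<in> G \<Longrightarrow> u \<in> V \<Longrightarrow> cmod (x g u) \<le> c g * N u"
    and x_e: "g \<in> G \<Longrightarrow> g' \<in> G \<Longrightarrow> x g (e g') = (if g = g' then 1 else 0)"
    and T_eq: "u \<in> V \<Longrightarrow> T u = Q u - (\<Sum>g\<in>G. cscale (x g u) (h g))"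
begin

abbreviation (input) K :: "state \<Rightarrow> state" where
  "K u \<equiv> \<Sum>g\<in>G. cscale (x g u) (h g)"

lemma K_in_V: "K u \<in> V"
  by (intro V_sum V_scale h)

lemma T_in_V: "u \<in> V \<Longrightarrow> T u \<in> V"
  by (simp add: T_eq V_diff K_in_V bounded_opD(1)[OF Q])

lemma T_bounded: "bounded_op V N T"
proof -
  obtain C where C: "0 \<le> C" "\<And>u. u \<in> V \<Longrightarrow> N (Q u) \<le> C * N u" using bounded_op_bound[OF Q] by blast
  have K: "N (K u) \<le> (\<Sum>g\<in>G. c g * N (h g)) * N u" if u: "u \<in> V" for u
  proof -
    have "N (K u) \<le> (\<Sum>g\<in>G. N (cscale (x g u) (h g)))" by (intro N_sum G V_scale h)
    also have "\<dots> \<le> (\<Sum>g\<in>G. (c g * N u) * N (h g))"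
      by (intro sum_mono) (simp add: N_scale h mult_right_mono x_bound u N_nonneg)
    finally show ?thesis by (simp add: sum_distrib_left sum_distrib_right mult.assoc mult.left_commute mult.commute)
  qed
  show ?thesis
  proof (rule bounded_opI[where C = "C + (\<Sum>g\<in>G. c g * N (h g))"])
    show "T (u + v) = T u + T v" if "u \<in> V" "v \<in> V" for u v
      using that by (simp add: T_eq V_add bounded_opD(3)[OF Q] x_add cscale_distrib sum.distrib)
    show "T (cscale a u) = cscale a (T u)" if "u \<in> V" for a u
      using that by (simp add: T_eq V_scale bounded_opD(4)[OF Q] x_scale cscale_distrib
          state.scale_sum_right)
    show "N (T u) \<le> (C + (\<Sum>g\<in>G. c g * N (h g))) * N u" if "u \<in> V" for u
      using N_diff[OF bounded_opD(1)[OF Q that] K_in_V[of u]] K[OF that] C(2)[OF that]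
      by (simp add: T_eq[OF that] distrib_right)
  qed (rule T_in_V)
qed

lemma R_K: "R (K u) = (\<Sum>g\<in>G. cscale (x g u) (R (h g)))"
  by (simp add: bounded_op_sum[OF R] G V_scale h bounded_opD(4)[OF R])

lemma subspace_T_range: "state.subspace (T ` V)"
proof -
  note D = bounded_opD[OF T_bounded]
  have "0 \<in> T ` V" using bounded_op_zero[OF T_bounded] by (metis V_zero image_eqI)
  moreover have "T u + T v \<in> T ` V" if "u \<in> V" "v \<in> V" for u v
    using D(3)[OF that] V_add[OF that] by (metis image_eqI)
  moreover have "cscale a (T u) \<in> T ` V" if "u \<in> V" for a u
    using D(4)[OF that] V_scale[OF that] by (metis image_eqI)
  ultimately show ?thesis by (intro state.subspaceI) blast+
qed

text \<open>On the common kernel \<open>W0\<close> of the functionals \<open>T\<close> agrees with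
  \<open>Q\<close>. The image of \<open>W0\<close> under \<open>Q\<close> is closed, since
  \<open>R\<close> and the \<open>x g\<close> are continuous, and the range of \<open>T\<close>
  exceeds it by the span of the finitely many \<open>T (e g)\<close>.\<close>

lemma closed_T_range: "closed_subspace V N (T ` V)"
proof -
  define W0 where "W0 = {u \<in> V. \<forall>g\<in>G. x g u = 0}"
  define W where "W = Q ` W0"
  have W0_V: "W0 \<subseteq> V" by (auto simp: W0_def)
  have x0: "x g 0 = 0" for g using x_scale[of 0 g 0] by simp
  have "state.subspace W"
  proof (rule state.subspaceI)
    show "0 \<in> W" unfolding W_def using bounded_op_zero[OF Q] by (intro image_eqI[of _ _ 0]) (auto simp: W0_def x0)
    show "u + v \<in> W" if uv: "u \<in> W" "v \<in> W" for u v
    proof -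
      obtain u' v' where *: "u' \<in> W0" "v' \<in> W0" "u = Q u'" "v = Q v'" using uv unfolding W_def by blast
      then have "u + v = Q (u' + v')" "u' + v' \<in> W0"
        using bounded_opD(3)[OF Q, of u' v'] by (simp_all add: W0_def V_add x_add)
      then show ?thesis by (simp add: W_def)
    qed
    show "cscale a u \<in> W" if u: "u \<in> W" for a u
    proof -
      obtain u' where *: "u' \<in> W0" "u = Q u'" using u unfolding W_def by blast
      then have "cscale a u = Q (cscale a u')" "cscale a u' \<in> W0"
        using bounded_opD(4)[OF Q, of u' a] by (simp_all add: W0_def V_scale x_scale)
      then show ?thesis by (simp add: W_def)
    qed
  qed
  moreover have "W \<subseteq> V" using W0_V bounded_opD(1)[OF Q] by (auto simp: W_def)
  moreover have "l \<in> W" if y: "\<forall>i. y i \<in> W" and l: "l \<in> V" "(\<lambda>i::nat. N (y i - l)) \<longlonglongrightarrow> 0" for y l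
  proof -
    obtain C where C: "0 \<le> C" "\<And>u. u \<in> V \<Longrightarrow> N (R u) \<le> C * N u" using bounded_op_bound[OF R] by blast
    have yV: "y i \<in> V" for i using y \<open>W \<subseteq> V\<close> by blast
    have RyW0: "R (y i) \<in> W0" for i
    proof -
      obtain u where "u \<in> W0" "y i = Q u" using y unfolding W_def by blast
      then show ?thesis using RQ[of u] W0_V by auto
    qed
    have "x g (R l) = 0" if g: "g \<in> G" for g
    proof -
      have le: "cmod (x g (R l)) \<le> \<bar>c g\<bar> * C * N (y i - l)" for i
      proof -
        have "x g (R (y i - l) + R l) = 0"
          using RyW0[of i] g bounded_opD(3)[OF R, of "y i - l" l] yV l(1) by (simp add: V_diff W0_def)
        then have "x g (R l) = - x g (R (y i - l))"
          using x_add[of "R (y i - l)" "R l" g] bounded_opD(1)[OF R] yV[of i] l(1)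
          by (simp add: V_diff eq_neg_iff_add_eq_0 add.commute)
        then have "cmod (x g (R l)) = cmod (x g (R (y i - l)))" by simp
        also have "\<dots> \<le> c g * N (R (y i - l))"
          using x_bound[OF g, of "R (y i - l)"] bounded_opD(1)[OF R] V_diff[OF yV[of i] l(1)] by blast
        also have "\<dots> \<le> \<bar>c g\<bar> * N (R (y i - l))"
          by (intro mult_right_mono N_nonneg bounded_opD(1)[OF R] V_diff yV l) auto
        also have "\<dots> \<le> \<bar>c g\<bar> * (C * N (y i - l))"
          by (intro mult_left_mono C V_diff yV l) auto
        finally show ?thesis by (simp add: mult.assoc)
      qed
      have "(\<lambda>i. \<bar>c g\<bar> * C * N (y i - l)) \<longlonglongrightarrow> \<bar>c g\<bar> * C * 0"
        by (intro tendsto_intros l)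
      then have "cmod (x g (R l)) \<le> \<bar>c g\<bar> * C * 0"
        by (rule LIMSEQ_le_const) (use le in blast)
      then show ?thesis by simp
    qed
    then have "R l \<in> W0" using bounded_opD(1)[OF R l(1)] by (simp add: W0_def)
    then show ?thesis using QR[OF l(1)] unfolding W_def by (metis image_eqI)
  qed
  ultimately have W: "closed_subspace V N W" unfolding closed_subspace_def by blast
  have T_W0: "T u = Q u" if "u \<in> W0" for u
    using that T_eq[of u] by (simp add: W0_def)
  show ?thesis
  proof (rule closed_subspace_finite_codim[OF _ W _ subspace_T_range])
    show "finite ((\<lambda>g. T (e g)) ` G)" using G by simp
    show "(\<lambda>g. T (e g)) ` G \<subseteq> V" using T_in_V e by blast
    show "W \<subseteq> T ` V" using T_W0 W0_V unfolding W_def by (metis image_mono image_cong)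
    show "T ` V \<subseteq> state.span (W \<union> (\<lambda>g. T (e g)) ` G)"
    proof (rule image_subsetI)
      fix u assume u: "u \<in> V"
      \<comment> \<open>The projection along \<open>W0\<close>: duality gives
        \<open>x g p = x g u\<close> for \<open>g\<close> in \<open>G\<close>, so
        \<open>u - p\<close> lies in \<open>W0\<close>.\<close>
      define p where "p = (\<Sum>g\<in>G. cscale (x g u) (e g))"
      have p: "p \<in> V" unfolding p_def by (intro V_sum V_scale e)
      have "x g (sum f A) = (\<Sum>a\<in>A. x g (f a))" if "finite A" "\<And>a. a \<in> A \<Longrightarrow> f a \<in> V" for A g and f :: "'g \<Rightarrow> state"
        using that by (induction A rule: finite_induct) (simp_all add: x0 x_add V_sum)
      then have "x g p = (\<Sum>g'\<in>G. x g (cscale (x g' u) (e g')))" for g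
        unfolding p_def by (simp add: G V_scale e)
      also have "\<dots> g = (\<Sum>g'\<in>G. if g' = g then x g u else 0)" if "g \<in> G" for g
        by (rule sum.cong) (use that in \<open>auto simp: x_scale e x_e\<close>)
      finally have "x g p = x g u" if "g \<in> G" for g using that G by simp
      then have "u - p \<in> W0"
        using x_add[of "u - p" p] u p by (simp add: W0_def V_diff)
      then have "T (u - p) \<in> W" using T_W0 by (auto simp: W_def)
      moreover have "T p = (\<Sum>g\<in>G. cscale (x g u) (T (e g)))"
        unfolding p_def by (simp add: bounded_op_sum[OF T_bounded] G V_scale e bounded_opD(4)[OF T_bounded])
      moreover have "T u = T (u - p) + T p"
        using bounded_opD(3)[OF T_bounded, of "u - p" p] u p by (simp add: V_diff)
      ultimately show "T u \<in> state.span (W \<union> (\<lambda>g. T (e g)) ` G)"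
        by (auto intro!: state.span_add state.span_sum state.span_scale intro: state.span_base)
    qed
  qed
qed

text \<open>\<open>T u = 0\<close> forces \<open>u = R (K u)\<close>, and every \<open>u\<close>
  equals \<open>T (R u) + K (R u)\<close>. So the kernel lies in the span of the
  \<open>R (h g)\<close> and the \<open>h g\<close> span a complement of the range up to
  overlap.\<close>

theorem fredholm_T: "fredholm V N T"
proof -
  have "{u \<in> V. T u = 0} \<subseteq> state.span ((\<lambda>g. R (h g)) ` G)"
  proof
    fix u assume "u \<in> {u \<in> V. T u = 0}"
    then have u: "u \<in> V" "T u = 0" by simp_all
    then have "Q u = K u" using T_eq by simp
    then have "u = R (K u)" using RQ[OF u(1)] by simp
    moreover have "R (K u) \<in> state.span ((\<lambda>g. R (h g)) ` G)"
      unfolding R_K by (intro state.span_sum state.span_scale state.span_base) simp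
    ultimately show "u \<in> state.span ((\<lambda>g. R (h g)) ` G)" by simp
  qed
  moreover have "\<forall>u\<in>V. \<exists>v\<in>V. \<exists>w\<in>state.span (h ` G). u = T v + w"
  proof
    fix u assume u: "u \<in> V"
    then have Ru: "R u \<in> V" by (rule bounded_opD(1)[OF R])
    have "u = T (R u) + K (R u)" by (simp add: T_eq[OF Ru] QR[OF u])
    moreover have "K (R u) \<in> state.span (h ` G)"
      by (intro state.span_sum state.span_scale state.span_base) simp
    ultimately show "\<exists>v\<in>V. \<exists>w\<in>state.span (h ` G). u = T v + w" using Ru by blast
  qed
  moreover have "h ` G \<subseteq> V" using h by blast
  ultimately show ?thesis
    unfolding fredholm_def using T_bounded closed_T_range G by blast
qed

text \<open>The map \<open>u \<mapsto> R (T u) = u - R (K u)\<close> leaves the finite-dimensional range of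
  \<open>R \<circ> K\<close> invariant; being injective it is onto there.\<close>

theorem inv_op_T_if_injective:
  assumes inj: "\<And>u. u \<in> V \<Longrightarrow> T u = 0 \<Longrightarrow> u = 0"
  shows "inv_op T"
proof -
  note TD = bounded_opD[OF T_bounded] and RD = bounded_opD[OF R]
  define D where "D u = R (T u)" for u
  have D_eq: "D u = u - R (K u)" if "u \<in> V" for u
    using that by (simp add: D_def T_eq bounded_op_diff[OF R] bounded_opD(1)[OF Q] K_in_V RQ)
  have D_add: "D (u + v) = D u + D v" if "u \<in> V" "v \<in> V" for u v
    using that by (simp add: D_def TD RD)
  have D_scale: "D (cscale a u) = cscale a (D u)" if "u \<in> V" for a u
    using that by (simp add: D_def TD RD)
  have D_sum: "D (sum f A) = (\<Sum>a\<in>A. D (f a))" if "finite A" "\<And>a. a \<in> A \<Longrightarrow> f a \<in> V"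
    for A and f :: "state \<Rightarrow> state"
    using that by (simp add: D_def bounded_op_sum[OF T_bounded] bounded_op_sum[OF R] TD)
  have D_0: "u = 0" if "u \<in> V" "D u = 0" for u
  proof -
    have "T u = Q (R (T u))" using QR[of "T u"] TD(1) that(1) by simp
    then have "T u = 0" using that(2) bounded_op_zero[OF Q] by (simp add: D_def)
    then show ?thesis using inj that(1) by blast
  qed
  let ?H = "(\<lambda>g. R (h g)) ` G"
  obtain B where B: "B \<subseteq> ?H" "state.independent B" "?H \<subseteq> state.span B"
    using state.maximal_independent_subset[of ?H] by blast
  have finB: "finite B" using B(1) G finite_subset by blast
  have HV: "?H \<subseteq> V" using RD(1) h by blast
  then have BV: "B \<subseteq> V" using B(1) by blast
  have spanHB: "state.span ?H \<subseteq> state.span B" using B(3) by (intro state.span_minimal) auto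
  have injD: "inj_on D B"
  proof (rule inj_onI)
    fix u v assume uv: "u \<in> B" "v \<in> B" "D u = D v"
    then have "u \<in> V" "v \<in> V" using BV by blast+
    then have "D (u - v) = 0" using D_add[of "u - v" v] uv(3) by (simp add: V_diff)
    then show "u = v" using D_0[of "u - v"] \<open>u \<in> V\<close> \<open>v \<in> V\<close> by (simp add: V_diff)
  qed
  have DB: "D ` B \<subseteq> state.span B"
  proof (rule image_subsetI)
    fix u assume u: "u \<in> B"
    have "R (K u) \<in> state.span ?H"
      unfolding R_K by (intro state.span_sum state.span_scale state.span_base) simp
    then have "R (K u) \<in> state.span B" using spanHB by blast
    moreover have "u \<in> state.span B" using u by (rule state.span_base)
    moreover have "D u = u - R (K u)" using D_eq BV u by blast
    ultimately show "D u \<in> state.span B" by (simp only: state.span_diff)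
  qed
  have indep: "state.independent (D ` B)"
  proof
    assume "state.dependent (D ` B)"
    then obtain a where a: "\<exists>v\<in>D ` B. a v \<noteq> 0" "(\<Sum>v\<in>D ` B. cscale (a v) v) = 0"
      using state.dependent_finite[of "D ` B"] finB by blast
    have "0 = (\<Sum>b\<in>B. cscale (a (D b)) (D b))" using a(2) by (simp add: sum.reindex[OF injD])
    also have "\<dots> = (\<Sum>b\<in>B. D (cscale (a (D b)) b))"
      by (intro sum.cong refl D_scale[symmetric] subsetD[OF BV])
    also have "\<dots> = D (\<Sum>b\<in>B. cscale (a (D b)) b)"
      by (rule D_sum[OF finB, symmetric]) (use BV in blast)
    finally have D0: "D (\<Sum>b\<in>B. cscale (a (D b)) b) = 0" by simp
    have "(\<Sum>b\<in>B. cscale (a (D b)) b) \<in> V" using BV by (intro V_sum V_scale) blast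
    from D_0[OF this D0] have "(\<Sum>b\<in>B. cscale (a (D b)) b) = 0" .
    moreover have "\<exists>b\<in>B. a (D b) \<noteq> 0" using a(1) by blast
    ultimately have "state.dependent B"
      unfolding state.dependent_finite[OF finB] by (intro exI[of _ "\<lambda>b. a (D b)"] conjI)
    with B(2) show False by blast
  qed
  have Bspan: "b \<in> state.span (D ` B)" if b: "b \<in> B" for b
  proof (rule ccontr)
    assume nb: "b \<notin> state.span (D ` B)"
    then have "state.independent (insert b (D ` B))" using indep by (rule state.independent_insertI)
    moreover have "insert b (D ` B) \<subseteq> state.span B" using DB state.span_base[OF b] by blast
    ultimately have "card (insert b (D ` B)) \<le> card B"
      using state.independent_span_bound[OF finB] by blast
    moreover have "b \<notin> D ` B" using nb state.span_base[of b "D ` B"] by blast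
    ultimately show False using finB by (simp add: card_image[OF injD])
  qed
  have "\<exists>y\<in>V. T y = h g" if g: "g \<in> G" for g
  proof -
    have sub: "state.subspace (D ` V)"
    proof (rule state.subspaceI)
      show "0 \<in> D ` V" using D_scale[of 0 0] by (metis V_zero cscale_simps(2) image_eqI)
      show "u + v \<in> D ` V" if uv: "u \<in> D ` V" "v \<in> D ` V" for u v
        proof -
        obtain u' v' where *: "u' \<in> V" "v' \<in> V" "u = D u'" "v = D v'" using uv by blast
        then have "u + v = D (u' + v')" using D_add by simp
        then show ?thesis using V_add *(1,2) by blast
      qed
      show "cscale a u \<in> D ` V" if uv: "u \<in> D ` V" for a u
        proof -
        obtain u' where *: "u' \<in> V" "u = D u'" using uv by blast
        then have "cscale a u = D (cscale a u')" using D_scale by simp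
        then show ?thesis using V_scale *(1) by blast
      qed
    qed
    have "state.span B \<subseteq> state.span (D ` B)"
      using Bspan by (intro state.span_minimal) blast+
    also have "\<dots> \<subseteq> D ` V" using BV by (intro state.span_minimal sub image_mono)
    finally have "R (h g) \<in> D ` V" using B(3) g by blast
    then obtain y where y: "y \<in> V" "R (h g) = R (T y)" unfolding D_def by blast
    then have "Q (R (h g)) = Q (R (T y))" by simp
    then have "T y = h g" using QR[OF h[OF g]] QR[OF TD(1)[OF y(1)]] by simp
    with y(1) show ?thesis by blast
  qed
  then obtain y where y: "\<And>g. g \<in> G \<Longrightarrow> y g \<in> V" "\<And>g. g \<in> G \<Longrightarrow> T (y g) = h g" by metis
  \<comment> \<open>\<open>T (R v)\<close> misses \<open>v\<close> by the combination of the
    \<open>h g\<close> with coefficients \<open>x g (R v)\<close>; the preimages \<open>y g\<close>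
    supply exactly that.\<close>
  define S where "S v = R v + (\<Sum>g\<in>G. cscale (x g (R v)) (y g))" for v
  have SV: "S v \<in> V" if "v \<in> V" for v
    unfolding S_def using that by (intro V_add V_sum V_scale y RD)
  have TS: "T (S v) = v" if v: "v \<in> V" for v
  proof -
    have "T (S v) = T (R v) + (\<Sum>g\<in>G. cscale (x g (R v)) (h g))"
      unfolding S_def using v
      by (simp add: TD RD V_sum V_scale y bounded_op_sum[OF T_bounded] G)
    then show ?thesis by (simp add: T_eq RD v QR)
  qed
  have ST: "S (T u) = u" if u: "u \<in> V" for u
  proof -
    have V: "S (T u) - u \<in> V" by (intro V_diff SV TD u)
    have "T (S (T u) - u) = 0" using TS[OF TD(1)[OF u]] u by (simp add: bounded_op_diff[OF T_bounded] SV TD)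
    then show ?thesis using inj[OF V] by simp
  qed
  have "bounded_op V N S"
  proof -
    obtain C where C: "0 \<le> C" "\<And>u. u \<in> V \<Longrightarrow> N (R u) \<le> C * N u" using bounded_op_bound[OF R] by blast
    show ?thesis
    proof (rule bounded_opI[where C = "C + (\<Sum>g\<in>G. \<bar>c g\<bar> * C * N (y g))"])
      show "S (u + v) = S u + S v" if "u \<in> V" "v \<in> V" for u v
        using that by (simp add: S_def RD x_add cscale_distrib sum.distrib)
      show "S (cscale a u) = cscale a (S u)" if "u \<in> V" for a u
        using that by (simp add: S_def RD x_scale cscale_distrib state.scale_sum_right)
      fix u assume u: "u \<in> V"
      have "N (S u) \<le> N (R u) + N (\<Sum>g\<in>G. cscale (x g (R u)) (y g))"
        unfolding S_def by (intro N_add RD u V_sum V_scale y)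
      also have "N (\<Sum>g\<in>G. cscale (x g (R u)) (y g)) \<le> (\<Sum>g\<in>G. N (cscale (x g (R u)) (y g)))"
        by (intro N_sum G V_scale y)
      also have "\<dots> \<le> (\<Sum>g\<in>G. (\<bar>c g\<bar> * (C * N u)) * N (y g))"
      proof (rule sum_mono)
        fix g assume g: "g \<in> G"
        have "cmod (x g (R u)) \<le> c g * N (R u)" by (intro x_bound g RD u)
        also have "\<dots> \<le> \<bar>c g\<bar> * N (R u)" by (intro mult_right_mono N_nonneg RD u) simp
        also have "\<dots> \<le> \<bar>c g\<bar> * (C * N u)" by (intro mult_left_mono C u) simp
        finally show "N (cscale (x g (R u)) (y g)) \<le> (\<bar>c g\<bar> * (C * N u)) * N (y g)"
          by (simp add: N_scale y g mult_right_mono N_nonneg)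
      qed
      also have "N (R u) \<le> C * N u" by (rule C(2)[OF u])
      finally show "N (S u) \<le> (C + (\<Sum>g\<in>G. \<bar>c g\<bar> * C * N (y g))) * N u"
        by (simp add: distrib_left sum_distrib_left mult.assoc mult.left_commute mult.commute)
    qed (rule SV)
  qed
  with ST TS show ?thesis unfolding inv_op_def by blast
qed

end

section \<open>Spectral bound and growth of the exponential\<close>

text \<open>\<open>\<Phi>\<close> plays the role of the dual unit ball: functionals of norm at most
  one that together recover \<open>N\<close>. Analytic statements about vectors can then be checked
  on scalar functions.\<close>

locale normed_banach_states = banach_states +
  fixes \<Phi> :: "(state \<Rightarrow> complex) set"
  assumes \<Phi>_add: "\<phi> \<in> \<Phi> \<Longrightarrow> u \<in> V \<Longrightarrow> v \<in> V \<Longrightarrow> \<phi> (u + v) = \<phi> u + \<phi> v"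
    and \<Phi>_scale: "\<phi> \<in> \<Phi> \<Longrightarrow> u \<in> V \<Longrightarrow> \<phi> (cscale c u) = c * \<phi> u"
    and \<Phi>_bound: "\<phi> \<in> \<Phi> \<Longrightarrow> u \<in> V \<Longrightarrow> cmod (\<phi> u) \<le> N u"
    and norming: "u \<in> V \<Longrightarrow> (\<And>\<phi>. \<phi> \<in> \<Phi> \<Longrightarrow> cmod (\<phi> u) \<le> B) \<Longrightarrow> N u \<le> B"
begin

lemma \<Phi>_zero: "\<phi> \<in> \<Phi> \<Longrightarrow> \<phi> 0 = 0"
  using \<Phi>_scale[of \<phi> 0 0] by simp

lemma \<Phi>_diff:
  assumes "\<phi> \<in> \<Phi>" "u \<in> V" "v \<in> V"
  shows "\<phi> (u - v) = \<phi> u - \<phi> v"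
  using \<Phi>_add[OF assms(1) V_diff[OF assms(2,3)] assms(3)] by simp

lemma \<Phi>_sum:
  assumes "\<phi> \<in> \<Phi>" "finite A" "\<And>i. i \<in> A \<Longrightarrow> f i \<in> V"
  shows "\<phi> (sum f A) = (\<Sum>i\<in>A. \<phi> (f i))"
  using assms(2,3)
proof (induction A rule: finite_induct)
  case (insert a A)
  then show ?case by (simp add: \<Phi>_add[OF assms(1)] V_sum)
qed (simp add: \<Phi>_zero[OF assms(1)])

lemma \<Phi>_tendsto:
  assumes \<phi>: "\<phi> \<in> \<Phi>" and x: "\<And>i. x i \<in> V" "l \<in> V" "(\<lambda>i::nat. N (x i - l)) \<longlonglongrightarrow> 0"
  shows "(\<lambda>i. \<phi> (x i)) \<longlonglongrightarrow> \<phi> l"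
proof (rule LIM_zero_cancel)
  show "(\<lambda>i. \<phi> (x i) - \<phi> l) \<longlonglongrightarrow> 0"
  proof (rule Lim_null_comparison[OF _ x(3)])
    have "norm (\<phi> (x i) - \<phi> l) \<le> N (x i - l)" for i
      using \<Phi>_bound[OF \<phi> V_diff[OF x(1)[of i] x(2)]] \<Phi>_diff[OF \<phi> x(1)[of i] x(2)]
      by simp
    then show "\<forall>\<^sub>F i in sequentially. norm (\<phi> (x i) - \<phi> l) \<le> N (x i - l)" by simp
  qed
qed

lemma funpow_bounded_op:
  assumes S: "bounded_op V N S" and K: "0 \<le> K" "\<And>u. u \<in> V \<Longrightarrow> N (S u) \<le> K * N u" and u: "u \<in> V"
  shows "(S ^^ n) u \<in> V" "N ((S ^^ n) u) \<le> K ^ n * N u"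
proof -
  have "(S ^^ n) u \<in> V \<and> N ((S ^^ n) u) \<le> K ^ n * N u"
  proof (induction n)
    case (Suc n)
    have "N (S ((S ^^ n) u)) \<le> K * (K ^ n * N u)"
      using K(2)[of "(S ^^ n) u"] Suc mult_left_mono[OF _ K(1)] by (meson order_trans)
    then show ?case using Suc bounded_opD(1)[OF S] by (simp add: mult.assoc)
  qed (use u in simp)
  then show "(S ^^ n) u \<in> V" "N ((S ^^ n) u) \<le> K ^ n * N u" by blast+
qed

text \<open>The Neumann series \<open>\<Sum>\<^sub>n w\<^sup>n S\<^sup>n\<close> of \<open>(1 - w S)\<inverse>\<close>, tested against a functional, is the
  Taylor series of a function holomorphic on the disc of radius \<open>1 / r\<close>; Cauchy's estimate on the
  circle of radius \<open>1 / \<rho>\<close> bounds its coefficients.\<close>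

lemma power_bound:
  assumes S: "bounded_op V N S" and r: "0 < r" "r < \<rho>"
    and res: "\<And>z. r < cmod z \<Longrightarrow> inv_op (shifted z S)"
  obtains C where "0 \<le> C" "\<And>n u. u \<in> V \<Longrightarrow> N ((S ^^ n) u) \<le> C * \<rho> ^ n * N u"
proof -
  note D = bounded_opD[OF S]
  let ?B = "ball (0::complex) (1 / r)"
  have "\<exists>H. bounded_op V N H \<and>
      (\<forall>u\<in>V. H u - cscale w (S (H u)) = u \<and> H (u - cscale w (S u)) = u)" if w: "w \<in> ?B" for w
  proof (cases "w = 0")
    case True
    have "bounded_op V N (\<lambda>u. u)" by (rule bounded_opI[where C = 1]) simp_all
    with True show ?thesis by (intro exI[of _ "\<lambda>u. u"]) simp
  next
    case False
    then have "r < cmod (1 / w)" using w r by (simp add: norm_divide field_simps)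
    then obtain R where R: "bounded_op V N R" "\<And>u. u \<in> V \<Longrightarrow> R (cscale (1 / w) u - S u) = u"
      "\<And>u. u \<in> V \<Longrightarrow> cscale (1 / w) (R u) - S (R u) = u"
      using res[of "1 / w"] unfolding inv_op_def shifted_def by blast
    note RD = bounded_opD[OF R(1)]
    obtain C where C: "0 \<le> C" "\<And>u. u \<in> V \<Longrightarrow> N (R u) \<le> C * N u"
      using bounded_op_bound[OF R(1)] by blast
    \<comment> \<open>The factor \<open>1 / w\<close> turns the inverse of \<open>1 / w - S\<close>
      into the inverse of \<open>1 - w S\<close>; at \<open>w = 0\<close> the latter is the
      identity.\<close>
    define H where "H u = cscale (1 / w) (R u)" for u
    have H: "bounded_op V N H"
    proof (rule bounded_opI[where C = "cmod (1 / w) * C"])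
      show "N (H u) \<le> cmod (1 / w) * C * N u" if "u \<in> V" for u
        using mult_left_mono[OF C(2)[OF that], of "cmod (1 / w)"]
        by (simp add: H_def N_scale RD that mult.assoc del: norm_divide)
    qed (simp_all add: H_def RD V_scale cscale_distrib mult.commute)
    have 1: "H u - cscale w (S (H u)) = u" if "u \<in> V" for u
      using R(3)[OF that] False by (simp add: H_def D RD that)
    have 2: "H (u - cscale w (S u)) = u" if "u \<in> V" for u
    proof -
      have "u - cscale w (S u) = cscale w (cscale (1 / w) u - S u)"
        using False by (simp add: cscale_distrib)
      then show ?thesis
        using R(2)[OF that] False by (simp add: H_def RD D that V_diff V_scale)
    qed
    from H 1 2 show ?thesis by blast
  qed
  then obtain H where H: "\<And>w. w \<in> ?B \<Longrightarrow> bounded_op V N (H w)"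
    "\<And>w u. w \<in> ?B \<Longrightarrow> u \<in> V \<Longrightarrow> H w u - cscale w (S (H w u)) = u"
    "\<And>w u. w \<in> ?B \<Longrightarrow> u \<in> V \<Longrightarrow> H w (u - cscale w (S u)) = u"
    by metis
  note HV = bounded_opD(1)[OF H(1)]
  obtain K1 where K1: "0 \<le> K1" "\<And>u. u \<in> V \<Longrightarrow> N (S u) \<le> K1 * N u"
    using bounded_op_bound[OF S] by blast
  \<comment> \<open>The resolvent identity, from \<open>u = (1 - w S) y + (w - w0) S y\<close> with
    \<open>y = H w0 u\<close>. It drives both the local bounds and the differentiability.\<close>
  have resolvent_id: "H w u = H w0 u + cscale (w - w0) (H w (S (H w0 u)))"
    if w: "w \<in> ?B" "w0 \<in> ?B" and u: "u \<in> V" for w w0 u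
  proof -
    define y where "y = H w0 u"
    have y: "y \<in> V" using HV[OF w(2) u] by (simp add: y_def)
    have "u = y - cscale w0 (S y)" using H(2)[OF w(2) u] by (simp add: y_def)
    also have "\<dots> = (y - cscale w (S y)) + cscale (w - w0) (S y)" by (simp add: cscale_distrib)
    finally have "H w u = H w ((y - cscale w (S y)) + cscale (w - w0) (S y))" by simp
    also have "\<dots> = y + cscale (w - w0) (H w (S y))"
      using bounded_opD(3)[OF H(1)[OF w(1)], of "y - cscale w (S y)" "cscale (w - w0) (S y)"]
        bounded_opD(4)[OF H(1)[OF w(1)], of "S y"] H(3)[OF w(1) y] y
      by (simp add: V_diff V_scale D)
    finally show ?thesis by (simp add: y_def)
  qed
  have local_bound: "\<exists>\<epsilon>>0. \<exists>K\<ge>0. \<forall>w\<in>?B. dist w w0 < \<epsilon> \<longrightarrow> (\<forall>u\<in>V. N (H w u) \<le> K * N u)"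
    if w0: "w0 \<in> ?B" for w0
  proof -
    obtain K0 where K0: "0 \<le> K0" "\<And>u. u \<in> V \<Longrightarrow> N (H w0 u) \<le> K0 * N u"
      using bounded_op_bound[OF H(1)[OF w0]] by blast
    \<comment> \<open>With this radius \<open>\<epsilon> * (K0 * K1) \<le> 1 / 2\<close>, so the
      correction term is at most half of \<open>N (H w u)\<close> and is absorbed on the left; hence
      the local bound \<open>2 * K0\<close>.\<close>
    define \<epsilon> where "\<epsilon> = 1 / (2 * (K0 * K1 + 1))"
    have pos: "0 < K0 * K1 + 1" using K0(1) K1(1) by (simp add: add_nonneg_pos)
    have "N (H w u) \<le> 2 * K0 * N u" if w: "w \<in> ?B" "dist w w0 < \<epsilon>" and u: "u \<in> V" for w u
    proof -
      let ?y = "H w u"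
      have y: "?y \<in> V" by (rule HV[OF w(1) u])
      have "?y = H w0 u - cscale (w0 - w) (H w0 (S ?y))"
        using resolvent_id[OF w0 w(1) u] by (simp add: algebra_simps)
      then have "N ?y \<le> N (H w0 u) + N (cscale (w0 - w) (H w0 (S ?y)))"
        using N_diff[OF HV[OF w0 u] V_scale[OF HV[OF w0 D(1)[OF y]]], of "w0 - w"] by simp
      also have "N (cscale (w0 - w) (H w0 (S ?y))) = cmod (w0 - w) * N (H w0 (S ?y))"
        by (intro N_scale HV w0 D y)
      also have "\<dots> \<le> \<epsilon> * (K0 * (K1 * N ?y))"
      proof (intro mult_mono)
        show "cmod (w0 - w) \<le> \<epsilon>" using w(2) by (simp add: dist_norm norm_minus_commute)
        show "N (H w0 (S ?y)) \<le> K0 * (K1 * N ?y)"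
          using K0(2)[OF D(1)[OF y]] mult_left_mono[OF K1(2)[OF y] K0(1)] by linarith
      qed (use pos in \<open>auto simp: \<epsilon>_def intro!: N_nonneg HV w0 D y w u\<close>)
      also have "\<dots> = (\<epsilon> * (K0 * K1)) * N ?y" by simp
      also have "\<dots> \<le> (1 / 2) * N ?y"
        using pos by (intro mult_right_mono N_nonneg y) (simp add: \<epsilon>_def field_simps)
      finally show ?thesis using K0(2)[OF u] by simp
    qed
    moreover have "0 < \<epsilon>" using pos by (simp add: \<epsilon>_def)
    moreover have "0 \<le> 2 * K0" using K0 by simp
    ultimately show ?thesis by blast
  qed
  have deriv: "((\<lambda>w. \<phi> (H w u)) has_field_derivative \<phi> (H w0 (S (H w0 u)))) (at w0)"
    if \<phi>: "\<phi> \<in> \<Phi>" and u: "u \<in> V" and w0: "w0 \<in> ?B" for \<phi> u w0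
  proof -
    define y where "y = S (H w0 u)"
    have y: "y \<in> V" unfolding y_def by (intro D HV w0 u)
    obtain \<epsilon> K where \<epsilon>: "0 < \<epsilon>" "0 \<le> K"
      "\<And>w u. w \<in> ?B \<Longrightarrow> dist w w0 < \<epsilon> \<Longrightarrow> u \<in> V \<Longrightarrow> N (H w u) \<le> K * N u"
      using local_bound[OF w0] by blast
    have "\<forall>\<^sub>F w in at w0. w \<in> ?B" by (rule eventually_at_in_open') (use w0 in auto)
    moreover have "\<forall>\<^sub>F w in at w0. dist w w0 < \<epsilon>"
      using \<epsilon>(1) by (auto simp: eventually_at)
    ultimately have ev: "\<forall>\<^sub>F w in at w0. w \<in> ?B \<and> dist w w0 < \<epsilon>" by (rule eventually_conj)
    have diff: "\<phi> (H w u') - \<phi> (H w0 u') = (w - w0) * \<phi> (H w (S (H w0 u')))"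
      if "w \<in> ?B" "u' \<in> V" for w u'
    proof -
      have "\<phi> (H w u') = \<phi> (H w0 u') + \<phi> (cscale (w - w0) (H w (S (H w0 u'))))"
        using resolvent_id[OF that(1) w0 that(2)]
          \<Phi>_add[OF \<phi> HV[OF w0 that(2)] V_scale[OF HV[OF that(1) D(1)[OF HV[OF w0 that(2)]]]]]
        by simp
      then show ?thesis
        by (simp add: \<Phi>_scale[OF \<phi> HV[OF that(1) D(1)[OF HV[OF w0 that(2)]]]])
    qed
    \<comment> \<open>By the resolvent identity the difference quotient at \<open>w\<close> equals
      \<open>\<phi> (H w y)\<close>. Differentiability thus reduces to continuity of this function
      at \<open>w0\<close>, which the local bound provides.\<close>
    have "((\<lambda>w. \<phi> (H w y) - \<phi> (H w0 y)) \<longlongrightarrow> 0) (at w0)"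
    proof (rule Lim_null_comparison)
      show "\<forall>\<^sub>F w in at w0. norm (\<phi> (H w y) - \<phi> (H w0 y)) \<le> cmod (w - w0) * (K * N (S (H w0 y)))"
        using ev
      proof eventually_elim
        case (elim w)
        have V: "S (H w0 y) \<in> V" by (intro D HV w0 y)
        have "norm (\<phi> (H w y) - \<phi> (H w0 y)) = cmod (w - w0) * cmod (\<phi> (H w (S (H w0 y))))"
          using diff[of w y] elim y by (simp add: norm_mult)
        also have "\<dots> \<le> cmod (w - w0) * (K * N (S (H w0 y)))"
          using \<Phi>_bound[OF \<phi> HV[OF _ V], of w] \<epsilon>(3)[OF _ _ V, of w] elim
          by (intro mult_left_mono) auto
        finally show ?case .
      qed
      have "((\<lambda>w. cmod (w - w0) * (K * N (S (H w0 y)))) \<longlongrightarrow> cmod (w0 - w0) * (K * N (S (H w0 y)))) (at w0)"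
        by (intro tendsto_intros)
      then show "((\<lambda>w. cmod (w - w0) * (K * N (S (H w0 y)))) \<longlongrightarrow> 0) (at w0)" by simp
    qed
    then have "((\<lambda>w. \<phi> (H w y)) \<longlongrightarrow> \<phi> (H w0 y)) (at w0)" by (simp add: LIM_zero_iff)
    moreover have "\<forall>\<^sub>F w in at w0. \<phi> (H w y) = (\<phi> (H w u) - \<phi> (H w0 u)) / (w - w0)"
      using ev eventually_neq_at_within[of w0]
    proof eventually_elim
      case (elim w)
      then show ?case using diff[of w u] u by (simp add: y_def)
    qed
    ultimately have "((\<lambda>w. (\<phi> (H w u) - \<phi> (H w0 u)) / (w - w0)) \<longlongrightarrow> \<phi> (H w0 y)) (at w0)"
      by (rule Lim_transform_eventually)
    then show ?thesis by (simp add: has_field_derivative_iff y_def)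
  qed
  have power_series: "\<phi> ((S ^^ n) u) = (deriv ^^ n) (\<lambda>w. \<phi> (H w u)) 0 / fact n"
    if \<phi>: "\<phi> \<in> \<Phi>" and u: "u \<in> V" for \<phi> u n
  proof -
    have B0: "(0::complex) \<in> ?B" using r by simp
    obtain \<epsilon> K where \<epsilon>: "0 < \<epsilon>" "0 \<le> K"
      "\<And>w u. w \<in> ?B \<Longrightarrow> dist w 0 < \<epsilon> \<Longrightarrow> u \<in> V \<Longrightarrow> N (H w u) \<le> K * N u"
      using local_bound[OF B0] by blast
    have expand: "\<phi> (H w v) = (\<Sum>j<n. \<phi> ((S ^^ j) v) * w ^ j) + w ^ n * \<phi> (H w ((S ^^ n) v))"
      if w: "w \<in> ?B" and v: "v \<in> V" for w n v
    proof (induction n)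
      case (Suc n)
      let ?s = "(S ^^ n) v"
      have s: "?s \<in> V" by (rule funpow_bounded_op[OF S K1 v])
      have "H w (?s - cscale w (S ?s)) = H w ?s - H w (cscale w (S ?s))"
        by (rule bounded_op_diff[OF H(1)[OF w] s V_scale[OF D(1)[OF s]]])
      then have "H w ?s = ?s + cscale w (H w (S ?s))"
        using H(3)[OF w s] bounded_opD(4)[OF H(1)[OF w] D(1)[OF s], of w] by (simp add: algebra_simps)
      then have "\<phi> (H w ?s) = \<phi> ?s + w * \<phi> (H w (S ?s))"
        using \<Phi>_add[OF \<phi> s V_scale[OF HV[OF w D(1)[OF s]]], of w]
          \<Phi>_scale[OF \<phi> HV[OF w D(1)[OF s]], of w] by simp
      with Suc show ?case by (simp add: algebra_simps)
    qed simp
    \<comment> \<open>Within this radius the local bound at 0 holds and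
      \<open>cmod w * K1 \<le> 1 / 2\<close>, so the remainder
      \<open>w ^ n * \<phi> (H w ((S ^^ n) u))\<close> decays geometrically.\<close>
    define \<delta> where "\<delta> = min (1 / r) (min \<epsilon> (1 / (2 * (K1 + 1))))"
    have \<delta>: "0 < \<delta>" using r \<epsilon> K1 by (simp add: \<delta>_def)
    have sums: "(\<lambda>j. \<phi> ((S ^^ j) u) * w ^ j) sums \<phi> (H w u)" if w: "dist w 0 < \<delta>" for w
    proof -
      have wB: "w \<in> ?B" "dist w 0 < \<epsilon>" using w by (auto simp: \<delta>_def)
      have "cmod w * K1 \<le> 1 / (2 * (K1 + 1)) * K1"
        using w K1 by (intro mult_right_mono) (auto simp: \<delta>_def)
      also have "\<dots> \<le> 1 / 2" using K1 by (simp add: field_simps)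
      finally have wK: "cmod w * K1 \<le> 1 / 2" .
      have "(\<lambda>n. w ^ n * \<phi> (H w ((S ^^ n) u))) \<longlonglongrightarrow> 0"
      proof (rule Lim_null_comparison)
        have "norm (w ^ n * \<phi> (H w ((S ^^ n) u))) \<le> (1 / 2) ^ n * (K * N u)" for n
        proof -
          note s = funpow_bounded_op[OF S K1 u, of n]
          have "cmod (\<phi> (H w ((S ^^ n) u))) \<le> K * (K1 ^ n * N u)"
            using \<Phi>_bound[OF \<phi> HV[OF wB(1) s(1)]] \<epsilon>(3)[OF wB s(1)]
              mult_left_mono[OF s(2) \<epsilon>(2)] by linarith
          then have "norm (w ^ n * \<phi> (H w ((S ^^ n) u))) \<le> cmod w ^ n * (K * (K1 ^ n * N u))"
            by (simp add: norm_mult norm_power mult_left_mono)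
          also have "\<dots> = (cmod w * K1) ^ n * (K * N u)" by (simp add: power_mult_distrib)
          also have "\<dots> \<le> (1 / 2) ^ n * (K * N u)"
            using wK \<epsilon>(2) N_nonneg[OF u] K1(1) by (intro mult_right_mono power_mono) auto
          finally show ?thesis .
        qed
        then show "\<forall>\<^sub>F n in sequentially. norm (w ^ n * \<phi> (H w ((S ^^ n) u))) \<le> (1 / 2) ^ n * (K * N u)"
          by simp
        show "(\<lambda>n. (1 / 2) ^ n * (K * N u)) \<longlonglongrightarrow> 0"
          by (intro tendsto_mult_left_zero LIMSEQ_power_zero) simp
      qed
      then have "(\<lambda>n. \<phi> (H w u) - w ^ n * \<phi> (H w ((S ^^ n) u))) \<longlonglongrightarrow> \<phi> (H w u) - 0"
        by (intro tendsto_intros)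
      moreover have "(\<lambda>n. \<phi> (H w u) - w ^ n * \<phi> (H w ((S ^^ n) u))) = (\<lambda>n. \<Sum>j<n. \<phi> ((S ^^ j) u) * w ^ j)"
      proof
        fix n
        show "\<phi> (H w u) - w ^ n * \<phi> (H w ((S ^^ n) u)) = (\<Sum>j<n. \<phi> ((S ^^ j) u) * w ^ j)"
          by (subst expand[OF wB(1) u, of n]) simp
      qed
      ultimately show ?thesis by (simp add: sums_def)
    qed
    have "(\<lambda>w. \<phi> (H w u)) has_fps_expansion Abs_fps (\<lambda>j. \<phi> ((S ^^ j) u))"
    proof (rule has_fps_expansionI)
      have "\<forall>\<^sub>F w in nhds 0. dist w (0::complex) < \<delta>"
        using \<delta> by (auto simp: eventually_nhds_metric)
      then show "\<forall>\<^sub>F w in nhds 0. (\<lambda>j. fps_nth (Abs_fps (\<lambda>j. \<phi> ((S ^^ j) u))) j * w ^ j) sums \<phi> (H w u)"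
        by eventually_elim (simp add: sums)
    qed
    from fps_nth_fps_expansion[OF this, of n] show ?thesis by simp
  qed
  have "1 / \<rho> < 1 / r" using r by (intro divide_strict_left_mono) auto
  then have sphere: "sphere 0 (1 / \<rho>) \<subseteq> ?B" "cball 0 (1 / \<rho>) \<subseteq> ?B"
    by (auto simp del: divide_less_eq_1_pos)
  define P where "P w0 \<epsilon> K \<longleftrightarrow> 0 < \<epsilon> \<and> 0 \<le> K \<and>
      (\<forall>w\<in>?B. dist w w0 < \<epsilon> \<longrightarrow> (\<forall>u\<in>V. N (H w u) \<le> K * N u))" for w0 \<epsilon> K
  have "\<exists>\<epsilon> K. P w0 \<epsilon> K" if "w0 \<in> ?B" for w0
    using local_bound[OF that] unfolding P_def by blast
  then obtain \<epsilon> K where P: "\<And>w0. w0 \<in> ?B \<Longrightarrow> P w0 (\<epsilon> w0) (K w0)" by metis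
  then have \<epsilon>: "\<And>w0. w0 \<in> ?B \<Longrightarrow> 0 < \<epsilon> w0" "\<And>w0. w0 \<in> ?B \<Longrightarrow> 0 \<le> K w0"
      "\<And>w w0 u. w0 \<in> ?B \<Longrightarrow> w \<in> ?B \<Longrightarrow> dist w w0 < \<epsilon> w0 \<Longrightarrow> u \<in> V \<Longrightarrow> N (H w u) \<le> K w0 * N u"
    unfolding P_def by blast+
  \<comment> \<open>Compactness of the circle turns the local bounds into a single constant,
    independent of the functional and the vector; the sum of the finitely many \<open>K w0\<close>
    dominates each of them.\<close>
  obtain F where F: "F \<subseteq> sphere 0 (1 / \<rho>)" "finite F" "sphere 0 (1 / \<rho>) \<subseteq> (\<Union>w0\<in>F. ball w0 (\<epsilon> w0))"
  proof (rule compactE_image[OF compact_sphere])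
    show "open (ball w0 (\<epsilon> w0))" for w0 by simp
    show "sphere 0 (1 / \<rho>) \<subseteq> (\<Union>w0\<in>sphere 0 (1 / \<rho>). ball w0 (\<epsilon> w0))"
      using \<epsilon>(1) sphere(1) by force
  qed
  define C where "C = (\<Sum>w0\<in>F. K w0)"
  have FB: "w0 \<in> ?B" if "w0 \<in> F" for w0 using that F(1) sphere(1) by blast
  have C: "0 \<le> C" unfolding C_def by (intro sum_nonneg \<epsilon>(2) FB)
  have C_bound: "N (H w u) \<le> C * N u" if w: "w \<in> sphere 0 (1 / \<rho>)" and u: "u \<in> V" for w u
  proof -
    obtain w0 where w0: "w0 \<in> F" "w \<in> ball w0 (\<epsilon> w0)" using w F(3) by blast
    have "w \<in> ?B" using w sphere(1) by blast
    moreover have "dist w w0 < \<epsilon> w0" using w0(2) by (simp add: dist_commute)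
    ultimately have "N (H w u) \<le> K w0 * N u" by (intro \<epsilon>(3) FB[OF w0(1)] u)
    also have "K w0 \<le> C" unfolding C_def by (intro member_le_sum w0 F(2) \<epsilon>(2) FB) simp
    finally show ?thesis using N_nonneg[OF u] by (simp add: mult_right_mono)
  qed
  have "N ((S ^^ n) u) \<le> C * \<rho> ^ n * N u" if u: "u \<in> V" for n u
  proof (rule norming)
    show "(S ^^ n) u \<in> V" by (rule funpow_bounded_op[OF S K1 u])
    fix \<phi> assume \<phi>: "\<phi> \<in> \<Phi>"
    let ?f = "\<lambda>w. \<phi> (H w u)"
    have holo: "?f holomorphic_on ?B"
      unfolding holomorphic_on_open[OF open_ball] using deriv[OF \<phi> u] by blast
    have "norm ((deriv ^^ n) ?f 0) \<le> fact n * (C * N u) / (1 / \<rho>) ^ n"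
    proof (rule Cauchy_inequality)
      show "?f holomorphic_on ball 0 (1 / \<rho>)"
        using holo by (rule holomorphic_on_subset) (use sphere(2) ball_subset_cball in blast)
      show "continuous_on (cball 0 (1 / \<rho>)) ?f"
        using holomorphic_on_imp_continuous_on[OF holo] by (rule continuous_on_subset) (rule sphere(2))
      show "norm (?f w) \<le> C * N u" if "norm (0 - w) = 1 / \<rho>" for w
      proof -
        have w: "w \<in> sphere 0 (1 / \<rho>)" using that by simp
        have "norm (?f w) \<le> N (H w u)" using w sphere(1) by (intro \<Phi>_bound \<phi> HV u) blast
        with C_bound[OF w u] show ?thesis by linarith
      qed
    qed (use r in simp)
    then have "norm ((deriv ^^ n) ?f 0) / fact n \<le> C * N u * \<rho> ^ n"
      by (simp add: power_one_over divide_simps mult.commute mult.left_commute)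
    then show "cmod (\<phi> ((S ^^ n) u)) \<le> C * \<rho> ^ n * N u"
      by (simp add: power_series[OF \<phi> u] norm_divide mult_ac)
  qed
  with C show ?thesis by (rule that)
qed

section \<open>The exponential series\<close>

text \<open>The series converges absolutely because \<open>N ((T ^^ j) u) \<le> K ^ j * N u\<close>,
  so the definite description denotes its limit. The exponential is used below only through the
  resulting scalar series.\<close>

lemma op_exp:
  assumes T: "bounded_op V N T" and u: "u \<in> V"
  shows op_exp_in: "op_exp V N T t u \<in> V"
    and \<Phi>_op_exp: "\<phi> \<in> \<Phi> \<Longrightarrow> (\<lambda>j. of_real (t ^ j / fact j) * \<phi> ((T ^^ j) u)) sums \<phi> (op_exp V N T t u)"
proof -
  obtain K where K: "0 \<le> K" "\<And>u. u \<in> V \<Longrightarrow> N (T u) \<le> K * N u"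
    using bounded_op_bound[OF T] by blast
  note s = funpow_bounded_op[OF T K u]
  define a where "a j = cscale (of_real (t ^ j / fact j)) ((T ^^ j) u)" for j
  have aV: "a j \<in> V" for j unfolding a_def by (intro V_scale s)
  have "summable (\<lambda>j. N (a j))"
  proof (rule summable_comparison_test')
    show "summable (\<lambda>j. inverse (fact j) * (\<bar>t\<bar> * K) ^ j * N u)"
      by (intro summable_mult2 summable_exp)
    fix j
    have "N (a j) = \<bar>t\<bar> ^ j / fact j * N ((T ^^ j) u)"
      by (simp only: a_def N_scale[OF s(1)] norm_of_real abs_divide power_abs) simp
    also have "\<dots> \<le> \<bar>t\<bar> ^ j / fact j * (K ^ j * N u)"
      by (intro mult_left_mono s divide_nonneg_nonneg zero_le_power abs_ge_zero fact_ge_zero)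
    finally show "norm (N (a j)) \<le> inverse (fact j) * (\<bar>t\<bar> * K) ^ j * N u"
      using N_nonneg[OF aV] by (simp add: power_mult_distrib field_simps)
  qed
  from series_converges[OF aV this]
  obtain v where v: "v \<in> V" "(\<lambda>n. N ((\<Sum>j<n. a j) - v)) \<longlonglongrightarrow> 0" .
  have sV: "(\<Sum>j<n. a j) \<in> V" for n by (intro V_sum aV)
  have eq: "op_exp V N T t u = v"
    unfolding op_exp_def a_def[symmetric]
  proof (rule the_equality)
    fix v' assume *: "v' \<in> V \<and> (\<lambda>m. N ((\<Sum>j<m. a j) - v')) \<longlonglongrightarrow> 0"
    show "v' = v"
      by (rule limit_unique[where x = "\<lambda>n. \<Sum>j<n. a j"]) (use * v sV in simp_all)
  qed (use v in simp)
  show "op_exp V N T t u \<in> V" using eq v by simp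
  assume \<phi>: "\<phi> \<in> \<Phi>"
  have "(\<lambda>n. \<phi> (\<Sum>j<n. a j)) \<longlonglongrightarrow> \<phi> v" by (rule \<Phi>_tendsto[OF \<phi> sV v])
  then show "(\<lambda>j. of_real (t ^ j / fact j) * \<phi> ((T ^^ j) u)) sums \<phi> (op_exp V N T t u)"
    unfolding \<Phi>_sum[OF \<phi> finite_lessThan aV] by (simp add: sums_def eq a_def \<Phi>_scale[OF \<phi> s(1)])
qed

text \<open>The binomial theorem for \<open>S - a\<close>, where the scalar commutes with
  \<open>S\<close>. The vector is generalised in the induction because the step applies the
  hypothesis to both \<open>S u\<close> and \<open>u\<close>.\<close>

lemma \<Phi>_binomial:
  assumes S: "bounded_op V N S" and TS: "\<And>u. u \<in> V \<Longrightarrow> T u = S u - cscale a u"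
    and T: "bounded_op V N T" and \<phi>: "\<phi> \<in> \<Phi>" and u: "u \<in> V"
  shows "\<phi> ((T ^^ n) u) = (\<Sum>i\<le>n. of_nat (n choose i) * (- a) ^ (n - i) * \<phi> ((S ^^ i) u))"
  using u
proof (induction n arbitrary: u)
  case (Suc n)
  obtain K where K: "0 \<le> K" "\<And>u. u \<in> V \<Longrightarrow> N (T u) \<le> K * N u"
    using bounded_op_bound[OF T] by blast
  let ?x = "\<lambda>i. \<phi> ((S ^^ i) u)"
  have lin: "\<phi> ((T ^^ n) (S u - cscale a u)) = \<phi> ((T ^^ n) (S u)) - a * \<phi> ((T ^^ n) u)"
  proof -
    have TV: "(T ^^ m) v \<in> V" if "v \<in> V" for m v by (rule funpow_bounded_op[OF T K that])
    have "(T ^^ m) (v - cscale a w) = (T ^^ m) v - cscale a ((T ^^ m) w)" if "v \<in> V" "w \<in> V" for m v w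
    proof (induction m)
      case (Suc m)
      then show ?case
        using that by (simp add: bounded_op_diff[OF T] TV V_scale bounded_opD(4)[OF T])
    qed simp
    then show ?thesis
      using Suc.prems bounded_opD(1)[OF S] by (simp add: \<Phi>_diff[OF \<phi>] \<Phi>_scale[OF \<phi>] TV V_scale)
  qed
  have "\<phi> ((T ^^ Suc n) u) = \<phi> ((T ^^ n) (S u - cscale a u))"
    by (simp only: funpow_Suc_right o_apply TS[OF Suc.prems])
  also have "\<dots> = (\<Sum>i\<le>n. of_nat (n choose i) * (- a) ^ (n - i) * ?x (Suc i))
      + (\<Sum>i\<le>n. of_nat (n choose i) * (- a) ^ (Suc n - i) * ?x i)"
    unfolding lin Suc.IH[OF bounded_opD(1)[OF S Suc.prems]] Suc.IH[OF Suc.prems]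
    by (simp add: sum_distrib_left Suc_diff_le funpow_Suc_right mult_ac flip: sum_negf del: funpow.simps)
  also have "(\<Sum>i\<le>n. of_nat (n choose i) * (- a) ^ (Suc n - i) * ?x i)
      = (\<Sum>i\<le>Suc n. of_nat (n choose i) * (- a) ^ (Suc n - i) * ?x i)"
    by simp
  also have "\<dots> = (- a) ^ Suc n * ?x 0
      + (\<Sum>i\<le>n. of_nat (n choose Suc i) * (- a) ^ (n - i) * ?x (Suc i))"
    by (subst sum.atMost_Suc_shift) simp
  finally have "\<phi> ((T ^^ Suc n) u) = (- a) ^ Suc n * ?x 0
      + (\<Sum>i\<le>n. of_nat (Suc n choose Suc i) * (- a) ^ (n - i) * ?x (Suc i))"
    by (simp add: sum.distrib[symmetric] algebra_simps)
  also have "\<dots> = (\<Sum>i\<le>Suc n. of_nat (Suc n choose i) * (- a) ^ (Suc n - i) * ?x i)"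
    by (subst sum.atMost_Suc_shift) simp
  finally show ?case .
qed simp

text \<open>The factorisation into \<open>exp (- a t)\<close> and the exponential of
  \<open>t S\<close> becomes, after testing with a functional, a Cauchy product of the scalar series
  \<open>p\<close> and \<open>q\<close>. The power bound on \<open>S\<close> majorises
  \<open>p\<close> by the series of \<open>C * N u * exp (\<rho> * t)\<close>.\<close>

lemma op_exp_bound:
  fixes a :: real
  assumes S: "bounded_op V N S" and TS: "\<And>u. u \<in> V \<Longrightarrow> T u = S u - cscale (of_real a) u"
    and T: "bounded_op V N T"
    and C: "0 \<le> C" "0 \<le> \<rho>" "\<And>n u. u \<in> V \<Longrightarrow> N ((S ^^ n) u) \<le> C * \<rho> ^ n * N u"
    and t: "0 \<le> t" and u: "u \<in> V"
  shows "N (op_exp V N T t u) \<le> C * exp ((\<rho> - a) * t) * N u"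
proof (rule norming[OF op_exp_in[OF T u]])
  fix \<phi> assume \<phi>: "\<phi> \<in> \<Phi>"
  obtain K where K: "0 \<le> K" "\<And>u. u \<in> V \<Longrightarrow> N (S u) \<le> K * N u"
    using bounded_op_bound[OF S] by blast
  define x where "x i = \<phi> ((S ^^ i) u)" for i
  define p where "p i = of_real (t ^ i / fact i) * x i" for i
  define q where "q i = complex_of_real ((- a * t) ^ i / fact i)" for i
  define b where "b i = C * N u * (inverse (fact i) * (\<rho> * t) ^ i)" for i
  have p_le: "cmod (p i) \<le> b i" for i
  proof -
    have "cmod (x i) \<le> C * \<rho> ^ i * N u"
      using \<Phi>_bound[OF \<phi> funpow_bounded_op(1)[OF S K u]] C(3)[OF u] unfolding x_def
      by (rule order_trans)
    then have "cmod (p i) \<le> t ^ i / fact i * (C * \<rho> ^ i * N u)"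
      unfolding p_def norm_mult using t by (intro mult_mono) (auto simp: norm_divide norm_power norm_mult)
    then show ?thesis by (simp add: b_def power_mult_distrib field_simps)
  qed
  have b_sums: "b sums (C * N u * exp (\<rho> * t))"
    unfolding b_def using exp_converges[of "\<rho> * t"] by (intro sums_mult) (simp add: scaleR_conv_of_real)
  have p: "summable (\<lambda>i. norm (p i))"
    by (rule summable_comparison_test'[OF sums_summable[OF b_sums]]) (use p_le in simp)
  have q_sums: "q sums of_real (exp (- a * t))"
    unfolding q_def using exp_converges[of "- a * t"]
    by (intro sums_of_real) (simp add: scaleR_conv_of_real divide_inverse mult.commute)
  have q: "summable (\<lambda>i. norm (q i))"
  proof -
    have "(\<lambda>i. norm (q i)) = (\<lambda>i. norm ((- a * t) ^ i /\<^sub>R fact i))"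
      unfolding q_def norm_of_real by (intro ext) (simp add: divide_inverse mult.commute)
    with summable_norm_exp[of "- a * t"] show ?thesis by simp
  qed
  have "(\<Sum>i\<le>n. p i * q (n - i)) = of_real (t ^ n / fact n) * \<phi> ((T ^^ n) u)" for n
  proof (simp only: \<Phi>_binomial[OF S TS T \<phi> u] sum_distrib_left, rule sum.cong[OF refl])
    fix i assume i: "i \<in> {..n}"
    then have "complex_of_real t ^ n = of_real t ^ i * of_real t ^ (n - i)"
      by (simp add: power_add[symmetric])
    moreover have "of_nat (n choose i) = (fact n / (fact i * fact (n - i)) :: complex)"
      using i by (intro binomial_fact) simp
    moreover have "(- (complex_of_real a * of_real t)) ^ (n - i)
        = of_real t ^ (n - i) * (- of_real a) ^ (n - i)"
      by (metis mult.commute mult_minus_left power_mult_distrib)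
    ultimately show "p i * q (n - i) = of_real (t ^ n / fact n) *
        (of_nat (n choose i) * (- of_real a) ^ (n - i) * \<phi> ((S ^^ i) u))"
      by (simp add: p_def q_def x_def power_mult_distrib)
  qed
  then have "(\<lambda>n. of_real (t ^ n / fact n) * \<phi> ((T ^^ n) u)) sums ((\<Sum>i. p i) * (\<Sum>i. q i))"
    using Cauchy_product_sums[OF p q] by simp
  with \<Phi>_op_exp[OF T u \<phi>, of t] have "\<phi> (op_exp V N T t u) = (\<Sum>i. p i) * (\<Sum>i. q i)"
    by (rule sums_unique2)
  then have "cmod (\<phi> (op_exp V N T t u)) = cmod (\<Sum>i. p i) * exp (- a * t)"
    by (simp add: sums_unique[OF q_sums, symmetric] norm_mult)
  also have "cmod (\<Sum>i. p i) \<le> (\<Sum>i. norm (p i))" by (rule summable_norm[OF p])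
  also have "\<dots> \<le> (\<Sum>i. b i)" by (intro suminf_le p_le p sums_summable[OF b_sums])
  also have "\<dots> = C * N u * exp (\<rho> * t)" using sums_unique[OF b_sums] by simp
  finally show "cmod (\<phi> (op_exp V N T t u)) \<le> C * exp ((\<rho> - a) * t) * N u"
    by (simp add: left_diff_distrib exp_diff exp_minus field_simps)
qed

text \<open>The spectrum is bounded and lies in \<open>Re z \<le> \<Lambda>\<close>, hence in the disc with centre \<open>- a\<close> and
  radius \<open>a + \<Lambda> + \<eta> / 2\<close> once \<open>a\<close> is large.\<close>

theorem op_exp_growth:
  assumes T: "bounded_op V N T" and \<eta>: "0 < \<eta>"
  shows "\<exists>C. \<forall>t\<ge>0. op_norm V N (op_exp V N T t)
    \<le> ennreal (C * exp ((spectral_bound V N T + \<eta>) * t))"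
proof -
  note D = bounded_opD[OF T]
  obtain K where K: "0 \<le> K" "\<And>u. u \<in> V \<Longrightarrow> N (T u) \<le> K * N u"
    using bounded_op_bound[OF T] by blast
  define \<Lambda> where "\<Lambda> = spectral_bound V N T"
  have sK: "cmod z \<le> K" if "z \<in> spectrum V N T" for z
  proof (rule ccontr)
    assume "\<not> cmod z \<le> K"
    then have "inv_op (shifted z T)"
      unfolding shifted_def using K by (intro neumann[OF T, of K]) auto
    with that show False by (simp add: spectrum_def resolvent_set_iff)
  qed
  have s\<Lambda>: "Re z \<le> \<Lambda>" if "z \<in> spectrum V N T" for z
    unfolding \<Lambda>_def spectral_bound_def
  proof (rule cSup_upper)
    show "bdd_above (Re ` spectrum V N T)"
      using sK abs_Re_le_cmod by (intro bdd_aboveI2[where M = K]) (meson abs_le_D1 order_trans)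
  qed (use that in simp)
  \<comment> \<open>The first entry gives \<open>K\<^sup>2 \<le> a * \<eta>\<close>, so the estimate
    \<open>K\<^sup>2 + 2 a \<Lambda> + a\<^sup>2\<close> for the squared distance of a spectral
    point from \<open>- a\<close> is at most \<open>r\<^sup>2\<close>. The second makes
    \<open>r\<close> positive. Using \<open>\<eta> / 2\<close> in \<open>r\<close> leaves room for
    \<open>r < \<rho>\<close>.\<close>
  define a where "a = max (K\<^sup>2 / \<eta>) (1 + \<bar>\<Lambda>\<bar>)"
  define r where "r = a + \<Lambda> + \<eta> / 2"
  have "K\<^sup>2 / \<eta> \<le> a" "1 + \<bar>\<Lambda>\<bar> \<le> a" by (simp_all add: a_def)
  then have a: "0 \<le> a" "K\<^sup>2 \<le> a * \<eta>" and r: "0 < r"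
    using \<eta> by (auto simp: r_def field_simps)
  define S where "S u = T u + cscale (of_real a) u" for u
  have S: "bounded_op V N S"
  proof (rule bounded_opI[where C = "K + a"])
    show "N (S u) \<le> (K + a) * N u" if "u \<in> V" for u
      using N_add[OF D(1)[OF that] V_scale[OF that], of "of_real a"] K(2)[OF that] a(1)
      by (simp add: S_def N_scale that distrib_right)
  qed (simp_all add: S_def D V_add V_scale cscale_distrib mult.commute)
  have res: "inv_op (shifted z S)" if z: "r < cmod z" for z
  proof (rule ccontr)
    assume "\<not> inv_op (shifted z S)"
    moreover have "shifted z S = shifted (z - of_real a) T"
      by (rule ext) (simp add: shifted_def S_def cscale_distrib)
    ultimately have s: "z - of_real a \<in> spectrum V N T" by (simp add: spectrum_def resolvent_set_iff)
    define w where "w = z - of_real a"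
    have w: "cmod w \<le> K" "Re w \<le> \<Lambda>" using sK[OF s] s\<Lambda>[OF s] by (simp_all add: w_def)
    have "(cmod z)\<^sup>2 = (cmod w)\<^sup>2 + 2 * a * Re w + a\<^sup>2"
      unfolding cmod_power2 by (simp add: w_def power2_eq_square algebra_simps)
    also have "\<dots> \<le> K\<^sup>2 + 2 * a * \<Lambda> + a\<^sup>2"
      using w a(1) by (intro add_mono power_mono mult_left_mono) auto
    also have "\<dots> \<le> a * \<eta> + 2 * a * \<Lambda> + a\<^sup>2" using a(2) by simp
    also have "\<dots> \<le> a * \<eta> + 2 * a * \<Lambda> + a\<^sup>2 + (\<Lambda> + \<eta> / 2)\<^sup>2" by simp
    also have "\<dots> = r\<^sup>2" by (simp add: r_def power2_eq_square algebra_simps)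
    finally have "(cmod z)\<^sup>2 \<le> r\<^sup>2" .
    then have "cmod z \<le> r" by (rule power2_le_imp_le) (use r in simp)
    with z show False by simp
  qed
  define \<rho> where "\<rho> = a + \<Lambda> + \<eta>"
  have \<rho>: "r < \<rho>" using \<eta> by (simp add: r_def \<rho>_def)
  obtain C where C: "0 \<le> C" "\<And>n u. u \<in> V \<Longrightarrow> N ((S ^^ n) u) \<le> C * \<rho> ^ n * N u"
    using power_bound[OF S r \<rho> res] by blast
  have "op_norm V N (op_exp V N T t) \<le> ennreal (C * exp ((\<Lambda> + \<eta>) * t))" if t: "0 \<le> t" for t
    unfolding op_norm_def
  proof (rule SUP_least)
    fix u assume "u \<in> {u \<in> V. N u \<le> 1}"
    then have u: "u \<in> V" "N u \<le> 1" by simp_all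
    have "N (op_exp V N T t u) \<le> C * exp ((\<rho> - a) * t) * N u"
      by (rule op_exp_bound[OF S _ T C(1) _ C(2) t u(1)]) (use r \<rho> in \<open>simp_all add: S_def\<close>)
    also have "\<dots> \<le> C * exp ((\<rho> - a) * t) * 1"
      using C(1) u(2) by (intro mult_left_mono) auto
    finally show "ennreal (N (op_exp V N T t u)) \<le> ennreal (C * exp ((\<Lambda> + \<eta>) * t))"
      by (intro ennreal_leI) (simp add: \<rho>_def)
  qed
  then show ?thesis unfolding \<Lambda>_def by blast
qed

end

section \<open>Coordinates\<close>

text \<open>The Boolean selects the component, \<open>True\<close> for \<omega> and
  \<open>False\<close> for \<open>F\<close>. With one index set for the pair, the coupling by the
  operator is a shift along a bijection.\<close>

definition coef :: "state \<Rightarrow> bool \<times> int \<times> int \<Rightarrow> complex" where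
  "coef u i = (if fst i then fst u (snd i) else snd u (snd i))"

definition of_coef :: "(bool \<times> int \<times> int \<Rightarrow> complex) \<Rightarrow> state" where
  "of_coef x = ((\<lambda>n. x (True, n)), (\<lambda>n. x (False, n)))"

lemma coef_of_coef [simp]: "coef (of_coef x) i = x i"
  by (cases i) (simp add: coef_def of_coef_def)

lemma state_eqI: "(\<And>i. coef u i = coef v i) \<Longrightarrow> u = v"
proof -
  assume *: "\<And>i. coef u i = coef v i"
  have "fst u n = fst v n" "snd u n = snd v n" for n
    using *[of "(True, n)"] *[of "(False, n)"] by (simp_all add: coef_def)
  then show "u = v" by (intro prod_eqI ext)
qed

lemma coef_simps [simp]:
  "coef 0 i = 0" "coef (u + v) i = coef u i + coef v i" "coef (u - v) i = coef u i - coef v i"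
  "coef (cscale c u) i = c * coef u i"
  by (simp_all add: coef_def cscale_def)

lemma coef_sum: "coef (sum f A) i = (\<Sum>a\<in>A. coef (f a) i)"
  by (induction A rule: infinite_finite_induct) simp_all

text \<open>The square of the Japanese bracket of the frequency; half powers of it count one
  derivative.\<close>

definition jap :: "bool \<times> int \<times> int \<Rightarrow> real" where
  "jap i = 1 + freq_sq (snd i)"

lemma jap_ge_1: "1 \<le> jap i"
  by (simp add: jap_def freq_sq_def)

lemma jap_pos [simp]: "0 < jap i"
  using jap_ge_1[of i] by linarith

lemma jap_nonneg [simp]: "0 \<le> jap i" and jap_nz [simp]: "jap i \<noteq> 0"
  by (simp_all add: less_imp_le less_imp_neq[OF jap_pos, symmetric])

text \<open>The parameter \<open>\<gamma>\<close> balances \<omega> against \<open>F\<close>: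
  \<open>\<gamma> = 1\<close> gives \<open>X_norm\<close>, while \<open>\<gamma> = amp k\<close>
  gives the norm in which the model operator is skew-adjoint.\<close>

definition wt :: "real \<Rightarrow> real \<Rightarrow> bool \<times> int \<times> int \<Rightarrow> real" where
  "wt \<gamma> s i = (if fst i then \<gamma> * jap i powr ((s - 1) / 2) else jap i powr (s / 2))"

definition emb :: "real \<Rightarrow> real \<Rightarrow> state \<Rightarrow> bool \<times> int \<times> int \<Rightarrow> complex" where
  "emb \<gamma> s u i = of_real (wt \<gamma> s i) * coef u i"

lemma wt_pos: "0 < \<gamma> \<Longrightarrow> 0 < wt \<gamma> s i"
  by (simp add: wt_def)

lemma emb_simps:
  "emb \<gamma> s 0 i = 0" "emb \<gamma> s (u + v) i = emb \<gamma> s u i + emb \<gamma> s v i"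
  "emb \<gamma> s (u - v) i = emb \<gamma> s u i - emb \<gamma> s v i" "emb \<gamma> s (cscale c u) i = c * emb \<gamma> s u i"
  by (simp_all add: emb_def algebra_simps)

lemma
  fixes x :: "bool \<times> 'a \<Rightarrow> complex"
  shows l2_bool_iff: "x \<in> l2 \<longleftrightarrow> (\<lambda>n. x (True, n)) \<in> l2 \<and> (\<lambda>n. x (False, n)) \<in> l2"
    and l2norm_bool: "x \<in> l2 \<Longrightarrow>
      (l2norm x)\<^sup>2 = (l2norm (\<lambda>n. x (True, n)))\<^sup>2 + (l2norm (\<lambda>n. x (False, n)))\<^sup>2"
proof -
  let ?f = "\<lambda>i. (cmod (x i))\<^sup>2"
  have U: "UNIV = range (Pair True) \<union> (range (Pair False) :: (bool \<times> 'a) set)"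
    by (auto simp: image_iff)
  have inj: "inj (Pair b :: 'a \<Rightarrow> bool \<times> 'a)" for b by (auto intro: injI)
  have sum: "(?f has_sum (l2norm (\<lambda>n. x (True, n)))\<^sup>2 + (l2norm (\<lambda>n. x (False, n)))\<^sup>2) UNIV"
    if "(\<lambda>n. x (True, n)) \<in> l2" "(\<lambda>n. x (False, n)) \<in> l2"
    unfolding U
  proof (rule has_sum_Un_disjoint)
    show "(?f has_sum (l2norm (\<lambda>n. x (True, n)))\<^sup>2) (range (Pair True))"
      "(?f has_sum (l2norm (\<lambda>n. x (False, n)))\<^sup>2) (range (Pair False))"
      using l2_has_sum[OF that(1)] l2_has_sum[OF that(2)] by (simp_all add: has_sum_reindex inj o_def)
  qed auto
  have sub: "(\<lambda>n. x (b, n)) \<in> l2" if "x \<in> l2" for b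
  proof -
    have "?f summable_on range (Pair b)"
      using that unfolding l2_def by (auto intro: summable_on_subset_banach)
    then show ?thesis by (simp add: l2_def summable_on_reindex inj o_def)
  qed
  show "x \<in> l2 \<longleftrightarrow> (\<lambda>n. x (True, n)) \<in> l2 \<and> (\<lambda>n. x (False, n)) \<in> l2"
    using sub sum by (auto simp: l2_def summable_on_def)
  show "(l2norm x)\<^sup>2 = (l2norm (\<lambda>n. x (True, n)))\<^sup>2 + (l2norm (\<lambda>n. x (False, n)))\<^sup>2" if "x \<in> l2"
    using infsumI[OF sum[OF sub sub]] that by (simp add: l2norm_square)
qed

lemma
  shows sobolev_iff: "u \<in> sobolev s \<longleftrightarrow> (\<lambda>n. of_real ((1 + freq_sq n) powr (s / 2)) * u n) \<in> l2"
    and sobolev_norm_eq: "sobolev_norm s u = l2norm (\<lambda>n. of_real ((1 + freq_sq n) powr (s / 2)) * u n)"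
proof -
  have "(cmod (of_real ((1 + freq_sq n) powr (s / 2)) * u n))\<^sup>2 = (1 + freq_sq n) powr s * (cmod (u n))\<^sup>2" for n
    by (simp add: norm_mult power_mult_distrib power2_eq_square[of "_ powr _"] powr_add[symmetric])
  then show "u \<in> sobolev s \<longleftrightarrow> (\<lambda>n. of_real ((1 + freq_sq n) powr (s / 2)) * u n) \<in> l2"
    "sobolev_norm s u = l2norm (\<lambda>n. of_real ((1 + freq_sq n) powr (s / 2)) * u n)"
    by (simp_all add: sobolev_def l2_def sobolev_norm_def l2norm_def)
qed

lemma
  assumes "0 < \<gamma>"
  shows X_space_iff: "u \<in> X_space s \<longleftrightarrow> coef u (True, 0, 0) = 0 \<and> emb \<gamma> s u \<in> l2"
    and l2norm_emb: "u \<in> X_space s \<Longrightarrow>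
      (l2norm (emb \<gamma> s u))\<^sup>2 = \<gamma>\<^sup>2 * (sobolev_norm (s - 1) (fst u))\<^sup>2 + (sobolev_norm s (snd u))\<^sup>2"
proof -
  have t: "(\<lambda>n. emb \<gamma> s u (True, n))
      = (\<lambda>n. of_real \<gamma> * (of_real ((1 + freq_sq n) powr ((s - 1) / 2)) * fst u n))" for u
    by (simp add: emb_def wt_def coef_def jap_def mult_ac)
  have f: "(\<lambda>n. emb \<gamma> s u (False, n)) = (\<lambda>n. of_real ((1 + freq_sq n) powr (s / 2)) * snd u n)" for u
    by (simp add: emb_def wt_def coef_def jap_def)
  have t': "(\<lambda>n. emb \<gamma> s u (True, n)) \<in> l2 \<longleftrightarrow> fst u \<in> sobolev (s - 1)" for u
  proof
    assume "(\<lambda>n. emb \<gamma> s u (True, n)) \<in> l2"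
    moreover have "(\<lambda>n. of_real (1 / \<gamma>) * emb \<gamma> s u (True, n))
        = (\<lambda>n. of_real ((1 + freq_sq n) powr ((s - 1) / 2)) * fst u n)"
      using assms by (intro ext) (simp add: emb_def wt_def coef_def jap_def)
    ultimately show "fst u \<in> sobolev (s - 1)"
      unfolding sobolev_iff by (metis l2_scale)
  qed (unfold t sobolev_iff, rule l2_scale)
  have "u \<in> X_space s \<longleftrightarrow> coef u (True, 0, 0) = 0 \<and> emb \<gamma> s u \<in> l2" for u
    unfolding l2_bool_iff[of "emb \<gamma> s u"] t' f
    by (cases u) (auto simp: X_space_def sobolev0_def sobolev_iff[of "snd u" s] sobolev_iff[of _ s] coef_def)
  then show *: "u \<in> X_space s \<longleftrightarrow> coef u (True, 0, 0) = 0 \<and> emb \<gamma> s u \<in> l2" .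
  show "(l2norm (emb \<gamma> s u))\<^sup>2 = \<gamma>\<^sup>2 * (sobolev_norm (s - 1) (fst u))\<^sup>2 + (sobolev_norm s (snd u))\<^sup>2"
    if "u \<in> X_space s"
    using l2norm_bool[of "emb \<gamma> s u"] that unfolding * t f
    by (simp add: l2norm_scale sobolev_norm_eq power_mult_distrib)
qed

lemma X_norm_eq: "u \<in> X_space s \<Longrightarrow> X_norm s u = l2norm (emb 1 s u)"
  using l2norm_emb[of 1 u s] by (simp add: X_norm_def real_sqrt_unique)

lemma X_space_coef_0: "u \<in> X_space s \<Longrightarrow> coef u (True, 0, 0) = 0"
  using X_space_iff[of 1] by simp

text \<open>The finitely supported part of the dual unit ball in weighted coordinates; by
  \<open>l2_norming\<close> it recovers the norm.\<close>

definition pairings :: "real \<Rightarrow> real \<Rightarrow> (state \<Rightarrow> complex) set" where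
  "pairings \<gamma> s = {\<lambda>u. \<Sum>i\<in>F. v i * emb \<gamma> s u i | F v. finite F \<and> L2_set (\<lambda>i. cmod (v i)) F \<le> 1}"

lemma normed_banach_states_X:
  assumes \<gamma>: "0 < \<gamma>" and N: "\<And>u. u \<in> X_space s \<Longrightarrow> N u = l2norm (emb \<gamma> s u)"
  shows "normed_banach_states (X_space s) N (pairings \<gamma> s)"
proof -
  note X = X_space_iff[OF \<gamma>, of _ s]
  have e_add: "emb \<gamma> s (u + v) = (\<lambda>i. emb \<gamma> s u i + emb \<gamma> s v i)" for u v by (rule ext) (simp add: emb_simps)
  have e_scale: "emb \<gamma> s (cscale c u) = (\<lambda>i. c * emb \<gamma> s u i)" for c u by (rule ext) (simp add: emb_simps)
  have e_diff: "emb \<gamma> s (u - v) = (\<lambda>i. emb \<gamma> s u i - emb \<gamma> s v i)" for u v by (rule ext) (simp add: emb_simps)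
  have e_0: "emb \<gamma> s 0 = (\<lambda>_. 0)" by (rule ext) (simp add: emb_simps)
  have add: "u + v \<in> X_space s" if "u \<in> X_space s" "v \<in> X_space s" for u v
    using that l2_add[of "emb \<gamma> s u" "emb \<gamma> s v"] by (simp add: X e_add)
  have scale: "cscale c u \<in> X_space s" if "u \<in> X_space s" for c u
    using that l2_scale[of "emb \<gamma> s u"] by (simp add: X e_scale)
  have sub: "state.subspace (X_space s)"
    by (rule state.subspaceI) (use add scale in \<open>simp_all add: X e_0\<close>)
  note diff = state.subspace_diff[OF sub]
  have le: "cmod (emb \<gamma> s u i) \<le> N u" if "u \<in> X_space s" for u i
    using that cmod_le_l2norm[of "emb \<gamma> s u"] by (simp add: N X)
  show ?thesis
  proof
    show "state.subspace (X_space s)" by (rule sub)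
    show "0 \<le> N u" if "u \<in> X_space s" for u using that by (simp add: N)
    show "N (u + v) \<le> N u + N v" if "u \<in> X_space s" "v \<in> X_space s" for u v
      using that add[OF that] l2norm_add[of "emb \<gamma> s u" "emb \<gamma> s v"] by (simp add: N X e_add)
    show "N (cscale c u) = cmod c * N u" if "u \<in> X_space s" for c u
      using that scale[OF that, of c] by (simp add: N l2norm_scale e_scale)
    show "u = 0" if "u \<in> X_space s" "N u = 0" for u
    proof (rule state_eqI)
      fix i
      have "emb \<gamma> s u i = 0" using le[OF that(1), of i] that(2) by simp
      then show "coef u i = coef 0 i" using wt_pos[OF \<gamma>, of s i] by (simp add: emb_def)
    qed
    show "\<exists>l\<in>X_space s. (\<lambda>i. N (x i - l)) \<longlonglongrightarrow> 0"
      if x: "\<And>i. x i \<in> X_space s" and c: "\<And>e. 0 < e \<Longrightarrow> \<exists>n0. \<forall>i\<ge>n0. \<forall>j\<ge>n0. N (x i - x j) < e"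
      for x :: "nat \<Rightarrow> state"
    proof -
      have Nd: "N (x i - x j) = l2norm (\<lambda>p. emb \<gamma> s (x i) p - emb \<gamma> s (x j) p)" for i j
        using N[OF diff[OF x x]] by (simp add: e_diff)
      obtain y where y: "y \<in> l2" "(\<lambda>m. l2norm (\<lambda>p. emb \<gamma> s (x m) p - y p)) \<longlonglongrightarrow> 0"
        "\<And>p. (\<lambda>m. emb \<gamma> s (x m) p) \<longlonglongrightarrow> y p"
      proof (rule l2_complete)
        show "emb \<gamma> s (x m) \<in> l2" for m using x X by blast
        show "\<exists>n0. \<forall>i\<ge>n0. \<forall>j\<ge>n0. l2norm (\<lambda>p. emb \<gamma> s (x i) p - emb \<gamma> s (x j) p) < e" if "0 < e" for e
          using c[OF that] by (simp add: Nd)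
      qed (rule that)
      define l where "l = of_coef (\<lambda>i. y i / of_real (wt \<gamma> s i))"
      have el: "emb \<gamma> s l = y"
        by (rule ext) (use wt_pos[OF \<gamma>, of s] in \<open>simp add: emb_def l_def less_imp_neq[symmetric]\<close>)
      \<comment> \<open>Mean zero is a condition on one coordinate, so it survives the
        coordinatewise limit.\<close>
      have "(\<lambda>m. emb \<gamma> s (x m) (True, 0, 0)) \<longlonglongrightarrow> y (True, 0, 0)" by (rule y(3))
      moreover have "emb \<gamma> s (x m) (True, 0, 0) = 0" for m using x X by (simp add: emb_def)
      ultimately have "y (True, 0, 0) = 0" by (simp add: LIMSEQ_const_iff)
      then have l: "l \<in> X_space s" using y(1) by (simp add: X el) (simp add: l_def)
      have "N (x m - l) = l2norm (\<lambda>p. emb \<gamma> s (x m) p - y p)" for m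
        using N[OF diff[OF x l]] by (simp add: e_diff el)
      with y(2) have "(\<lambda>m. N (x m - l)) \<longlonglongrightarrow> 0" by simp
      with l show ?thesis by blast
    qed
    show "\<phi> (u + v) = \<phi> u + \<phi> v" if "\<phi> \<in> pairings \<gamma> s" for \<phi> u v
      using that by (auto simp: pairings_def e_add algebra_simps sum.distrib)
    show "\<phi> (cscale c u) = c * \<phi> u" if "\<phi> \<in> pairings \<gamma> s" for \<phi> c u
      using that by (auto simp: pairings_def e_scale sum_distrib_left mult_ac)
    show "cmod (\<phi> u) \<le> N u" if "\<phi> \<in> pairings \<gamma> s" "u \<in> X_space s" for \<phi> u
      using that by (auto simp: pairings_def N X intro: l2_pairing_le)
    show "N u \<le> B" if "u \<in> X_space s" "\<And>\<phi>. \<phi> \<in> pairings \<gamma> s \<Longrightarrow> cmod (\<phi> u) \<le> B" for u B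
      unfolding N[OF that(1)]
    proof (rule l2_norming)
      show "emb \<gamma> s u \<in> l2" using that X by blast
      show "cmod (\<Sum>i\<in>F. v i * emb \<gamma> s u i) \<le> B" if "finite F" "L2_set (\<lambda>i. cmod (v i)) F \<le> 1" for F v
        using \<open>\<And>\<phi>. \<phi> \<in> pairings \<gamma> s \<Longrightarrow> cmod (\<phi> u) \<le> B\<close>[of "\<lambda>u. \<Sum>i\<in>F. v i * emb \<gamma> s u i"] that
        by (auto simp: pairings_def)
    qed
  qed
qed

lemma (in normed_banach_states) closed_subspace_normed_banach_states:
  assumes W: "closed_subspace V N W"
  shows "normed_banach_states W N \<Phi>"
proof
  show sub: "state.subspace W" using W by (simp add: closed_subspace_def)
  have WV: "u \<in> W \<Longrightarrow> u \<in> V" for u using W unfolding closed_subspace_def by blast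
  show "0 \<le> N u" if "u \<in> W" for u by (intro N_nonneg WV that)
  show "N (u + v) \<le> N u + N v" if "u \<in> W" "v \<in> W" for u v by (intro N_add WV that)
  show "N (cscale c u) = cmod c * N u" if "u \<in> W" for c u by (intro N_scale WV that)
  show "u = 0" if "u \<in> W" "N u = 0" for u by (intro N_eq_0D WV that)
  show "\<exists>l\<in>W. (\<lambda>i. N (x i - l)) \<longlonglongrightarrow> 0"
    if x: "\<And>i. x i \<in> W" and c: "\<And>e. 0 < e \<Longrightarrow> \<exists>n0. \<forall>i\<ge>n0. \<forall>j\<ge>n0. N (x i - x j) < e"
    for x :: "nat \<Rightarrow> state"
  proof -
    have "\<exists>l\<in>V. (\<lambda>i. N (x i - l)) \<longlonglongrightarrow> 0" by (rule N_complete[OF WV[OF x] c])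
    then obtain l where l: "l \<in> V" "(\<lambda>i. N (x i - l)) \<longlonglongrightarrow> 0" by blast
    moreover have "l \<in> W" using W x l unfolding closed_subspace_def by blast
    ultimately show ?thesis by blast
  qed
  show "\<phi> (u + v) = \<phi> u + \<phi> v" if "\<phi> \<in> \<Phi>" "u \<in> W" "v \<in> W" for \<phi> u v by (intro \<Phi>_add WV that)
  show "\<phi> (cscale c u) = c * \<phi> u" if "\<phi> \<in> \<Phi>" "u \<in> W" for \<phi> u c by (intro \<Phi>_scale WV that)
  show "cmod (\<phi> u) \<le> N u" if "\<phi> \<in> \<Phi>" "u \<in> W" for \<phi> u by (intro \<Phi>_bound WV that)
  show "N u \<le> B" if "u \<in> W" "\<And>\<phi>. \<phi> \<in> \<Phi> \<Longrightarrow> cmod (\<phi> u) \<le> B" for u B by (intro norming WV that)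
qed

section \<open>The operator in coordinates\<close>

text \<open>Multiplication by \<open>cos (k x1)\<close> moves the first frequency by
  \<open>k\<close> either way and the block structure swaps the components. \<open>\<tau>\<close>
  and \<open>\<tau>'\<close> combine the two; the second frequency is untouched.\<close>

definition \<tau> :: "nat \<Rightarrow> bool \<times> int \<times> int \<Rightarrow> bool \<times> int \<times> int" where
  "\<tau> k i = (\<not> fst i, fst (snd i) + int k, snd (snd i))"

definition \<tau>' :: "nat \<Rightarrow> bool \<times> int \<times> int \<Rightarrow> bool \<times> int \<times> int" where
  "\<tau>' k i = (\<not> fst i, fst (snd i) - int k, snd (snd i))"

lemma \<tau>_simps [simp]:
  "\<tau>' k (\<tau> k i) = i" "\<tau> k (\<tau>' k i) = i"
  "fst (\<tau> k i) \<longleftrightarrow> \<not> fst i" "fst (\<tau>' k i) \<longleftrightarrow> \<not> fst i"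
  "snd (snd (\<tau> k i)) = snd (snd i)" "snd (snd (\<tau>' k i)) = snd (snd i)"
  by (simp_all add: \<tau>_def \<tau>'_def)

lemma bij_\<tau>: "bij (\<tau> k)" "bij (\<tau>' k)"
  by (rule o_bij[of "\<tau>' k"]; force) (rule o_bij[of "\<tau> k"]; force)

text \<open>The Fourier symbols of \<open>B_op\<close> and \<open>A_op\<close>, selected by the
  component on which each acts: \<omega> for \<open>B_op\<close>, \<open>F\<close> for
  \<open>A_op\<close>.\<close>

definition symb :: "nat \<Rightarrow> bool \<times> int \<times> int \<Rightarrow> real" where
  "symb k j = (if fst j then if snd j = (0, 0) then 0 else (1 + (real k)\<^sup>2) / freq_sq (snd j)
    else 1 - (1 + (real k)\<^sup>2) / jap j)"

lemma coef_L_op: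
  "coef (L_op k u) i = - (\<i> * of_nat k * of_int (snd (snd i)) / 2) *
     (of_real (symb k (\<tau> k i)) * coef u (\<tau> k i) + of_real (symb k (\<tau>' k i)) * coef u (\<tau>' k i))"
proof -
  have A: "A_op k v n = of_real (symb k (False, n)) * v n" for v n
    by (simp add: A_op_def inv_one_minus_lap_def fourier_mult_def symb_def jap_def algebra_simps
        add_divide_distrib)
  have B: "B_op k v n = of_real (symb k (True, n)) * v n" for v n
    by (simp add: B_op_def inv_lap_def fourier_mult_def symb_def divide_inverse algebra_simps)
  obtain b n1 n2 where "i = (b, n1, n2)" by (cases i)
  then show ?thesis
    by (simp add: coef_def L_op_def cscale_def cos_mult_def partial2_def fourier_mult_def A B
        \<tau>_def \<tau>'_def) (simp add: algebra_simps)
qed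

lemma L_op_linear:
  "L_op k (u + v) = L_op k u + L_op k v" "L_op k (u - v) = L_op k u - L_op k v"
  "L_op k (cscale c u) = cscale c (L_op k u)" "L_op k 0 = 0"
  by (rule state_eqI; simp add: coef_L_op algebra_simps)+

section \<open>Asymptotics at high frequency\<close>

text \<open>Sublevel sets of \<open>jap\<close> lie in finite boxes. High frequency can therefore be
  expressed by the cofinite filter, and every limit along it comes with a finite exceptional set for
  each tolerance.\<close>

lemma filterlim_jap: "filterlim jap at_top cofinite"
  unfolding filterlim_at_top
proof
  fix Z :: real
  define m where "m = \<lceil>Z\<rceil>"
  have "{i. \<not> Z \<le> jap i} \<subseteq> UNIV \<times> {- m..m} \<times> {- m..m}"
  proof
    fix i assume "i \<in> {i. \<not> Z \<le> jap i}"
    then have *: "(real_of_int (fst (snd i)))\<^sup>2 + (real_of_int (snd (snd i)))\<^sup>2 < Z"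
      by (simp add: jap_def freq_sq_def)
    have "\<bar>n\<bar> \<le> m" if "(real_of_int n)\<^sup>2 < Z" for n
    proof -
      have "\<bar>n\<bar> * 1 \<le> \<bar>n\<bar> * \<bar>n\<bar>" by (cases "n = 0", simp, intro mult_left_mono) auto
      then have "\<bar>n\<bar> \<le> n\<^sup>2" by (simp add: power2_eq_square)
      then have "real_of_int \<bar>n\<bar> \<le> real_of_int (n\<^sup>2)" by (simp only: of_int_le_iff)
      with that have "real_of_int \<bar>n\<bar> \<le> Z" by simp
      then show ?thesis unfolding m_def by linarith
    qed
    from this[of "fst (snd i)"] this[of "snd (snd i)"] *
    have "\<bar>fst (snd i)\<bar> \<le> m" "\<bar>snd (snd i)\<bar> \<le> m"
      by (smt (verit) zero_le_power2)+
    then show "i \<in> UNIV \<times> {- m..m} \<times> {- m..m}"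
      by (cases i) auto
  qed
  then show "\<forall>\<^sub>F i in cofinite. Z \<le> jap i"
    unfolding eventually_cofinite by (rule finite_subset) simp
qed

lemma filterlim_inj_cofinite:
  fixes f :: "'a \<Rightarrow> 'b"
  assumes "inj f"
  shows "filterlim f cofinite cofinite"
  unfolding filterlim_iff eventually_cofinite
proof (intro allI impI)
  fix P :: "'b \<Rightarrow> bool"
  assume "finite {y. \<not> P y}"
  from finite_vimageI[OF this assms] show "finite {x. \<not> P (f x)}" by (simp add: vimage_def)
qed

lemma cofinite_tendsto_bounded:
  fixes f :: "'a \<Rightarrow> real"
  assumes "(f \<longlongrightarrow> L) cofinite"
  obtains B where "0 < B" "\<And>i. \<bar>f i\<bar> \<le> B"
proof -
  have "\<forall>\<^sub>F i in cofinite. dist (f i) L < 1" by (rule tendstoD[OF assms]) simp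
  then have fin: "finite {i. \<not> dist (f i) L < 1}" by (simp add: eventually_cofinite)
  define B where "B = \<bar>L\<bar> + 1 + (\<Sum>i\<in>{i. \<not> dist (f i) L < 1}. \<bar>f i\<bar>)"
  have nn: "0 \<le> (\<Sum>i\<in>{i. \<not> dist (f i) L < 1}. \<bar>f i\<bar>)" by (rule sum_nonneg) simp
  have "\<bar>f i\<bar> \<le> B" for i
  proof (cases "dist (f i) L < 1")
    case True
    then have "\<bar>f i - L\<bar> < 1" by (simp add: dist_real_def)
    then show ?thesis using nn unfolding B_def by linarith
  next
    case False
    then have "\<bar>f i\<bar> \<le> (\<Sum>i\<in>{i. \<not> dist (f i) L < 1}. \<bar>f i\<bar>)"
      using fin by (intro member_le_sum) auto
    then show ?thesis by (simp add: B_def)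
  qed
  moreover have "0 < B" using nn unfolding B_def by linarith
  ultimately show ?thesis using that by blast
qed

lemma tendsto_if_both:
  assumes "(f \<longlongrightarrow> L) F" "(g \<longlongrightarrow> L) F"
  shows "((\<lambda>i. if P i then f i else g i) \<longlongrightarrow> L) F"
proof (rule topological_tendstoI)
  fix S assume "open S" "L \<in> S"
  then have "\<forall>\<^sub>F i in F. f i \<in> S" "\<forall>\<^sub>F i in F. g i \<in> S"
    using assms by (auto dest: topological_tendstoD)
  then show "\<forall>\<^sub>F i in F. (if P i then f i else g i) \<in> S" by eventually_elim simp
qed

text \<open>A shift changes \<open>jap\<close> by a term affine in the first frequency, which is at
  most of size \<open>jap i powr (1 / 2)\<close>; relative to \<open>jap i\<close> the change is
  \<open>O(jap i powr (- 1 / 2))\<close>.\<close>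

lemma jap_ratio_tendsto:
  fixes a b :: real
  assumes j: "\<And>i. jap (t i) = jap i + a * fst (snd i) + b"
  shows "((\<lambda>i. jap (t i) / jap i) \<longlongrightarrow> 1) cofinite"
proof (rule LIM_zero_cancel, rule Lim_null_comparison)
  have "norm (jap (t i) / jap i - 1) \<le> (\<bar>a\<bar> + \<bar>b\<bar>) * jap i powr (- 1 / 2)" for i
  proof -
    let ?J = "jap i" and ?n = "real_of_int (fst (snd i))"
    have n: "\<bar>?n\<bar> \<le> ?J powr (1 / 2)"
      by (simp add: powr_half_sqrt less_imp_le real_le_rsqrt jap_def freq_sq_def)
    have "?J powr 0 \<le> ?J powr (1 / 2)" using jap_ge_1 by (intro powr_mono) auto
    then have 1: "1 \<le> ?J powr (1 / 2)" using jap_pos[of i] by simp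
    have "jap (t i) / ?J - 1 = (a * ?n + b) / ?J"
      using jap_pos[of i] by (simp add: j field_simps del: jap_pos)
    also have "norm \<dots> \<le> (\<bar>a\<bar> * ?J powr (1 / 2) + \<bar>b\<bar> * ?J powr (1 / 2)) / ?J"
    proof -
      have "\<bar>a * ?n + b\<bar> \<le> \<bar>a\<bar> * \<bar>?n\<bar> + \<bar>b\<bar> * 1" by (simp add: abs_mult[symmetric] abs_triangle_ineq)
      also have "\<dots> \<le> \<bar>a\<bar> * ?J powr (1 / 2) + \<bar>b\<bar> * ?J powr (1 / 2)"
        using n 1 by (intro add_mono mult_left_mono) auto
      finally show ?thesis using jap_pos[of i] by (simp add: divide_right_mono)
    qed
    also have "\<dots> = (\<bar>a\<bar> + \<bar>b\<bar>) * (?J powr (1 / 2) / ?J powr 1)"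
      by (simp add: field_simps)
    also have "?J powr (1 / 2) / ?J powr 1 = ?J powr (- 1 / 2)"
      by (subst powr_diff[symmetric]) simp
    finally show ?thesis .
  qed
  then show "\<forall>\<^sub>F i in cofinite. norm (jap (t i) / jap i - 1) \<le> (\<bar>a\<bar> + \<bar>b\<bar>) * jap i powr (- 1 / 2)"
    by simp
  have "((\<lambda>i. jap i powr (- 1 / 2)) \<longlongrightarrow> 0) cofinite"
    by (rule tendsto_neg_powr[OF _ filterlim_jap]) simp
  then show "((\<lambda>i. (\<bar>a\<bar> + \<bar>b\<bar>) * jap i powr (- 1 / 2)) \<longlongrightarrow> 0) cofinite"
    by (rule tendsto_mult_right_zero)
qed

lemma jap_\<tau>:
  "jap (\<tau> k i) = jap i + (2 * real k) * fst (snd i) + (real k)\<^sup>2"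
  "jap (\<tau>' k i) = jap i + (- 2 * real k) * fst (snd i) + (real k)\<^sup>2"
  by (simp_all add: jap_def freq_sq_def \<tau>_def \<tau>'_def power2_eq_square algebra_simps)

lemmas jap_\<tau>_tendsto = jap_ratio_tendsto[OF jap_\<tau>(1)] jap_ratio_tendsto[OF jap_\<tau>(2)]

text \<open>The paper's \<open>k \<surd>(1 + k\<^sup>2)\<close> is \<open>k * amp k\<close>.  With \<open>\<omega>\<close> weighted by the extra factor \<open>amp k\<close>, the
  matrix entries of the operator are those of the skew-adjoint model
  \<open>- \<i> k (amp k) / 2 * dd k i j\<close> times a correction \<open>rho\<close> that tends to 1 at infinity.\<close>

definition amp :: "nat \<Rightarrow> real" where
  "amp k = sqrt (1 + (real k)\<^sup>2)"

lemma amp_pos [simp]: "0 < amp k"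
  by (simp add: amp_def add_pos_nonneg)

lemma amp_nonneg [simp]: "0 \<le> amp k" and amp_nz [simp]: "amp k \<noteq> 0"
  by (simp_all add: less_imp_le less_imp_neq[OF amp_pos, symmetric])

lemma amp_square: "(amp k)\<^sup>2 = 1 + (real k)\<^sup>2"
  by (simp add: amp_def)

text \<open>The symbol \<open>n2 / <n>\<close> with the bracket split evenly between source and
  target. On a common second frequency this is symmetric in \<open>i\<close> and \<open>j\<close>,
  as \<open>skew_l2\<close> requires; the exponent is \<open>- 1 / 4\<close> because
  \<open>jap\<close> is the squared bracket.\<close>

definition dd :: "bool \<times> int \<times> int \<Rightarrow> bool \<times> int \<times> int \<Rightarrow> real" where
  "dd i j = real_of_int (snd (snd i)) * jap i powr (- 1 / 4) * jap j powr (- 1 / 4)"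

definition rho :: "real \<Rightarrow> nat \<Rightarrow> bool \<times> int \<times> int \<Rightarrow> bool \<times> int \<times> int \<Rightarrow> real" where
  "rho s k i j = wt (amp k) s i / wt (amp k) s j * symb k j * jap i powr (1 / 4) * jap j powr (1 / 4) / amp k"

definition ent :: "real \<Rightarrow> nat \<Rightarrow> bool \<times> int \<times> int \<Rightarrow> bool \<times> int \<times> int \<Rightarrow> complex" where
  "ent s k i j = - \<i> * of_real (k * amp k / 2) * of_real (dd i j * rho s k i j)"

lemma ent_eq:
  "ent s k i j = - (\<i> * of_nat k * of_int (snd (snd i)) / 2)
     * of_real (wt (amp k) s i * symb k j / wt (amp k) s j)"
proof -
  have c: "jap i powr (- 1 / 4) * jap i powr (1 / 4) = 1" for i
    by (simp add: powr_add[symmetric])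
  have "dd i j * rho s k i j = real_of_int (snd (snd i)) * (jap i powr (- 1 / 4) * jap i powr (1 / 4))
      * (jap j powr (- 1 / 4) * jap j powr (1 / 4)) * (wt (amp k) s i * symb k j / wt (amp k) s j) / amp k"
    by (simp add: dd_def rho_def)
  also have "\<dots> = real_of_int (snd (snd i)) * (wt (amp k) s i * symb k j / wt (amp k) s j) / amp k"
    unfolding c by simp
  finally show ?thesis
    unfolding ent_def by simp
qed

lemma emb_L_op:
  "emb (amp k) s (L_op k u) i = ent s k i (\<tau> k i) * emb (amp k) s u (\<tau> k i)
     + ent s k i (\<tau>' k i) * emb (amp k) s u (\<tau>' k i)"
proof -
  have "wt (amp k) s j \<noteq> 0" for j using wt_pos[of "amp k" s j] by simp
  then show ?thesis
    unfolding ent_eq emb_def coef_L_op by (simp add: field_simps)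
qed

text \<open>Each half of \<open>dd\<close> satisfies
  \<open>sqrt \<bar>n2\<bar> * jap powr (- 1 / 4) \<le> 1\<close>, because
  \<open>n2\<^sup>2 \<le> jap\<close> at both ends.\<close>

lemma
  shows dd_\<tau>_le: "\<bar>dd i (\<tau> k i)\<bar> \<le> 1" and dd_\<tau>'_le: "\<bar>dd i (\<tau>' k i)\<bar> \<le> 1"
    and dd_\<tau>': "dd i (\<tau>' k i) = dd (\<tau>' k i) i"
proof -
  have "\<bar>dd i j\<bar> \<le> 1" if "snd (snd j) = snd (snd i)" for j
  proof -
    let ?m = "real_of_int (snd (snd i))"
    have m: "?m\<^sup>2 \<le> jap i" "?m\<^sup>2 \<le> jap j" using that by (simp_all add: jap_def freq_sq_def)
    have p: "sqrt \<bar>?m\<bar> * J powr (- 1 / 4) \<le> 1" if "?m\<^sup>2 \<le> J" "0 < J" for J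
    proof -
      have "sqrt \<bar>?m\<bar> = (\<bar>?m\<bar> powr 2) powr (1 / 4)" by (simp only: powr_powr) (simp add: powr_half_sqrt)
      also have "\<bar>?m\<bar> powr 2 = ?m\<^sup>2" by simp
      also have "(?m\<^sup>2) powr (1 / 4) \<le> J powr (1 / 4)" using that by (intro powr_mono2) auto
      finally have "sqrt \<bar>?m\<bar> * J powr (- 1 / 4) \<le> J powr (1 / 4) * J powr (- 1 / 4)"
        by (rule mult_right_mono) simp
      also have "\<dots> = 1" using that(2) by (simp add: powr_add[symmetric])
      finally show ?thesis .
    qed
    have "\<bar>dd i j\<bar> = (sqrt \<bar>?m\<bar> * jap i powr (- 1 / 4)) * (sqrt \<bar>?m\<bar> * jap j powr (- 1 / 4))"
      by (simp add: dd_def abs_mult)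
    also have "\<dots> \<le> 1 * 1" by (intro mult_mono p m) auto
    finally show ?thesis by simp
  qed
  then show "\<bar>dd i (\<tau> k i)\<bar> \<le> 1" "\<bar>dd i (\<tau>' k i)\<bar> \<le> 1" by simp_all
  show "dd i (\<tau>' k i) = dd (\<tau>' k i) i" by (simp add: dd_def)
qed

text \<open>All dependence on \<open>s\<close> is collected in a power of the ratio of two
  neighbouring brackets, which tends to 1. This is why the model is the same for every
  \<open>s\<close>.\<close>

lemma rho_eq:
  assumes "fst j \<longleftrightarrow> \<not> fst i"
  shows "rho s k i j = (jap i / jap j) powr (if fst i then s / 2 - 1 / 4 else s / 2 + 1 / 4)
    * (if fst j then jap j * symb k j / (amp k)\<^sup>2 else symb k j)"
proof -
  have q: "(jap i / jap j) powr e = jap i powr e * jap j powr (- e)" for e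
    by (simp add: powr_divide powr_minus_divide)
  show ?thesis
  proof (cases "fst i")
    case True
    have "rho s k i j = (jap i powr ((s - 1) / 2) * jap i powr (1 / 4))
        * (jap j powr (1 / 4) / jap j powr (s / 2)) * symb k j"
      using True assms by (simp add: rho_def wt_def)
    also have "\<dots> = jap i powr (s / 2 - 1 / 4) * jap j powr (- (s / 2 - 1 / 4)) * symb k j"
    proof -
      have e: "(s - 1) / 2 + 1 / 4 = s / 2 - 1 / 4" "1 / 4 - s / 2 = - (s / 2 - 1 / 4)"
        by (simp_all add: field_simps)
      show ?thesis by (simp only: powr_add[symmetric] powr_diff[symmetric] e)
    qed
    finally show ?thesis
      unfolding q using True assms by simp
  next
    case False
    have "rho s k i j = (jap i powr (s / 2) * jap i powr (1 / 4))
        * (jap j powr (1 / 4) / jap j powr ((s - 1) / 2)) * symb k j / (amp k)\<^sup>2"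
      using False assms by (simp add: rho_def wt_def power2_eq_square mult_ac)
    also have "\<dots> = jap i powr (s / 2 + 1 / 4) * (jap j powr (- (s / 2 + 1 / 4)) * jap j powr 1)
        * symb k j / (amp k)\<^sup>2"
    proof -
      have e: "1 / 4 - (s - 1) / 2 = - (s / 2 + 1 / 4) + 1" by (simp add: field_simps)
      show ?thesis by (simp only: powr_add[symmetric] powr_diff[symmetric] e)
    qed
    finally show ?thesis
      unfolding q using False assms by simp
  qed
qed

text \<open>\<open>A_op\<close> differs from the identity by order minus two, and
  \<open>B_op\<close> is \<open>(amp k)\<^sup>2 / jap\<close> to leading order; the scaling removes
  these leading parts.\<close>

lemma symb_tendsto: "((\<lambda>j. if fst j then jap j * symb k j / (amp k)\<^sup>2 else symb k j) \<longlongrightarrow> 1) cofinite"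
proof -
  have a: "1 + (real k)\<^sup>2 \<noteq> 0" by (smt (verit) zero_le_power2)
  have inv: "((\<lambda>j. 1 / jap j) \<longlongrightarrow> 0) cofinite"
    by (rule tendsto_divide_0[OF tendsto_const filterlim_at_top_imp_at_infinity[OF filterlim_jap]])
  have "((\<lambda>j. 1 / (1 - 1 / jap j)) \<longlongrightarrow> 1 / (1 - 0)) cofinite"
    by (intro tendsto_intros inv) simp
  then have 1: "((\<lambda>j. 1 / (1 - 1 / jap j)) \<longlongrightarrow> 1) cofinite" by simp
  have "((\<lambda>j. 1 - (1 + (real k)\<^sup>2) * (1 / jap j)) \<longlongrightarrow> 1 - (1 + (real k)\<^sup>2) * 0) cofinite"
    by (intro tendsto_intros inv)
  then have 2: "((\<lambda>j. 1 - (1 + (real k)\<^sup>2) * (1 / jap j)) \<longlongrightarrow> 1) cofinite" by simp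
  have "\<forall>\<^sub>F j in cofinite. 2 \<le> jap j" using filterlim_jap by (simp add: filterlim_at_top)
  then have "\<forall>\<^sub>F j in cofinite. (if fst j then 1 / (1 - 1 / jap j) else 1 - (1 + (real k)\<^sup>2) * (1 / jap j))
      = (if fst j then jap j * symb k j / (amp k)\<^sup>2 else symb k j)"
  proof eventually_elim
    case (elim j)
    have f: "freq_sq (snd j) = jap j - 1" by (simp add: jap_def)
    have "snd j \<noteq> (0, 0)" using elim by (auto simp: jap_def freq_sq_def)
    then show ?case using elim a by (simp add: symb_def f amp_square divide_simps)
  qed
  with tendsto_if_both[OF 1 2] show ?thesis by (rule Lim_transform_eventually)
qed

lemma rho_tendsto:
  assumes t: "inj t" "\<And>i. fst (t i) \<longleftrightarrow> \<not> fst i" and r: "((\<lambda>i. jap (t i) / jap i) \<longlongrightarrow> 1) cofinite"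
  shows "((\<lambda>i. rho s k i (t i)) \<longlongrightarrow> 1) cofinite"
proof -
  have "((\<lambda>i. inverse (jap (t i) / jap i)) \<longlongrightarrow> inverse 1) cofinite" by (intro tendsto_intros r) simp
  then have r': "((\<lambda>i. jap i / jap (t i)) \<longlongrightarrow> 1) cofinite" by simp
  have p: "((\<lambda>i. (jap i / jap (t i)) powr e) \<longlongrightarrow> 1 powr e) cofinite" for e
    by (intro tendsto_powr r' tendsto_const) simp
  have "((\<lambda>i. if fst i then (jap i / jap (t i)) powr (s / 2 - 1 / 4) else (jap i / jap (t i)) powr (s / 2 + 1 / 4))
      \<longlongrightarrow> 1) cofinite"
    by (rule tendsto_if_both) (use p in simp_all)
  moreover have "(\<lambda>i. if fst i then (jap i / jap (t i)) powr (s / 2 - 1 / 4) else (jap i / jap (t i)) powr (s / 2 + 1 / 4))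
      = (\<lambda>i. (jap i / jap (t i)) powr (if fst i then s / 2 - 1 / 4 else s / 2 + 1 / 4))"
    by (rule ext) simp
  ultimately have "((\<lambda>i. (jap i / jap (t i)) powr (if fst i then s / 2 - 1 / 4 else s / 2 + 1 / 4)) \<longlongrightarrow> 1) cofinite"
    by simp
  from tendsto_mult[OF this filterlim_compose[OF symb_tendsto filterlim_inj_cofinite[OF t(1)], of k]]
  show ?thesis by (simp add: rho_eq t(2) cong: if_cong)
qed

lemma rho_\<tau>_tendsto:
  "((\<lambda>i. rho s k i (\<tau> k i)) \<longlongrightarrow> 1) cofinite" "((\<lambda>i. rho s k i (\<tau>' k i)) \<longlongrightarrow> 1) cofinite"
  using bij_\<tau>[of k] by (auto intro!: rho_tendsto jap_\<tau>_tendsto simp: bij_is_inj)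

lemma cmod_ent:
  assumes "\<bar>dd i j\<bar> \<le> 1"
  shows "cmod (ent s k i j) \<le> k * amp k / 2 * \<bar>rho s k i j\<bar>"
proof -
  have "cmod (ent s k i j) = k * amp k / 2 * (\<bar>dd i j\<bar> * \<bar>rho s k i j\<bar>)"
    unfolding ent_def norm_mult norm_of_real by (simp add: abs_mult less_imp_le)
  also have "\<dots> \<le> k * amp k / 2 * (1 * \<bar>rho s k i j\<bar>)"
    using assms amp_pos[of k] by (intro mult_left_mono mult_right_mono) (auto simp: less_imp_le)
  finally show ?thesis by simp
qed

section \<open>Boundedness, the high-frequency bound and smoothing on fibres\<close>

abbreviation V_norm :: "nat \<Rightarrow> real \<Rightarrow> state \<Rightarrow> real" where
  "V_norm k s u \<equiv> l2norm (emb (amp k) s u)"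

lemma V_norm_states: "normed_banach_states (X_space s) (V_norm k s) (pairings (amp k) s)"
  by (rule normed_banach_states_X) simp_all

lemma ent_bounded:
  obtains B where "0 \<le> B" "\<And>i. cmod (ent s k i (\<tau> k i)) \<le> B" "\<And>i. cmod (ent s k i (\<tau>' k i)) \<le> B"
proof -
  obtain B1 where B1: "0 < B1" "\<And>i. \<bar>rho s k i (\<tau> k i)\<bar> \<le> B1"
    using cofinite_tendsto_bounded[OF rho_\<tau>_tendsto(1)] by blast
  obtain B2 where B2: "0 < B2" "\<And>i. \<bar>rho s k i (\<tau>' k i)\<bar> \<le> B2"
    using cofinite_tendsto_bounded[OF rho_\<tau>_tendsto(2)] by blast
  let ?c = "k * amp k / 2"
  have c: "0 \<le> ?c" using amp_pos[of k] by simp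
  show ?thesis
  proof
    show "0 \<le> ?c * (B1 + B2)" using c B1(1) B2(1) by simp
    show "cmod (ent s k i (\<tau> k i)) \<le> ?c * (B1 + B2)" for i
      by (rule order_trans[OF cmod_ent[OF dd_\<tau>_le]], rule mult_left_mono[OF _ c])
        (use B1(2)[of i] B2(1) in linarith)
    show "cmod (ent s k i (\<tau>' k i)) \<le> ?c * (B1 + B2)" for i
      by (rule order_trans[OF cmod_ent[OF dd_\<tau>'_le]], rule mult_left_mono[OF _ c])
        (use B2(2)[of i] B1(1) in linarith)
  qed
qed

lemma L_op_bounded: "bounded_op (X_space s) (V_norm k s) (L_op k)"
proof -
  interpret normed_banach_states "X_space s" "V_norm k s" "pairings (amp k) s" by (rule V_norm_states)
  obtain B where B: "0 \<le> B" "\<And>i. cmod (ent s k i (\<tau> k i)) \<le> B" "\<And>i. cmod (ent s k i (\<tau>' k i)) \<le> B"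
    using ent_bounded[of s k] by blast
  have *: "L_op k u \<in> X_space s \<and> V_norm k s (L_op k u) \<le> (B + B) * V_norm k s u"
    if u: "u \<in> X_space s" for u
  proof -
    let ?x = "emb (amp k) s u"
    have x: "?x \<in> l2" using u X_space_iff[of "amp k"] by simp
    let ?y1 = "\<lambda>i. ent s k i (\<tau> k i) * ?x (\<tau> k i)" and ?y2 = "\<lambda>i. ent s k i (\<tau>' k i) * ?x (\<tau>' k i)"
    have eq: "emb (amp k) s (L_op k u) = (\<lambda>i. ?y1 i + ?y2 i)" by (rule ext) (rule emb_L_op)
    have y: "?y1 \<in> l2" "?y2 \<in> l2" "l2norm ?y1 \<le> B * l2norm ?x" "l2norm ?y2 \<le> B * l2norm ?x"
      using shift_l2[where h = "\<tau> k" and e = "\<lambda>i. ent s k i (\<tau> k i)", OF bij_\<tau>(1) x B(1) B(2)] shift_l2[where h = "\<tau>' k" and e = "\<lambda>i. ent s k i (\<tau>' k i)", OF bij_\<tau>(2) x B(1) B(3)]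
        shift_l2norm[where h = "\<tau> k" and e = "\<lambda>i. ent s k i (\<tau> k i)", OF bij_\<tau>(1) x B(1) B(2)] shift_l2norm[where h = "\<tau>' k" and e = "\<lambda>i. ent s k i (\<tau>' k i)", OF bij_\<tau>(2) x B(1) B(3)] by blast+
    have "coef (L_op k u) (True, 0, 0) = 0" by (simp add: coef_L_op)
    with l2_add[OF y(1,2)] have "L_op k u \<in> X_space s"
      using X_space_iff[of "amp k" "L_op k u" s] by (simp add: eq)
    with l2norm_add[OF y(1,2)] y(3,4) show ?thesis by (simp add: eq distrib_right)
  qed
  show ?thesis
    by (rule bounded_opI[where C = "B + B"]) (use * in \<open>simp_all add: L_op_linear\<close>)
qed

text \<open>For \<open>u\<close> vanishing on \<open>G\<close> the operator is the skew-adjoint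
  model plus two weighted shifts with coefficients at most \<open>\<epsilon> / 2\<close>, so
  \<open>skew_l2norm\<close> applies up to the loss \<open>\<epsilon>\<close>.\<close>

lemma high_frequency_bound:
  fixes b :: real
  assumes \<epsilon>: "0 < \<epsilon>"
  obtains G where "finite G"
    "\<And>u. u \<in> X_space s \<Longrightarrow> (\<And>i. i \<in> G \<Longrightarrow> coef u i = 0) \<Longrightarrow>
      V_norm k s (L_op k u + cscale (of_real b) u) \<le> (sqrt ((k * amp k)\<^sup>2 + b\<^sup>2) + \<epsilon>) * V_norm k s u"
proof -
  define \<kappa> where "\<kappa> = - (k * amp k) / 2"
  define \<delta> where "\<delta> = \<epsilon> / (2 * (\<bar>\<kappa>\<bar> + 1))"
  have \<delta>: "0 < \<delta>" "\<bar>\<kappa>\<bar> * \<delta> \<le> \<epsilon> / 2" using \<epsilon> by (auto simp: \<delta>_def field_simps add_pos_nonneg)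
  \<comment> \<open>The bad entries are indexed by the row \<open>i\<close>, but they multiply the
    coordinate at \<open>\<tau> k i\<close>; hence the image under the shift.\<close>
  define G1 where "G1 = \<tau> k ` {i. \<not> dist (rho s k i (\<tau> k i)) 1 < \<delta>}"
  define G2 where "G2 = \<tau>' k ` {i. \<not> dist (rho s k i (\<tau>' k i)) 1 < \<delta>}"
  have "finite G1" "finite G2"
    using tendstoD[OF rho_\<tau>_tendsto(1) \<delta>(1)] tendstoD[OF rho_\<tau>_tendsto(2) \<delta>(1)]
    by (simp_all add: G1_def G2_def eventually_cofinite)
  then have fin: "finite (G1 \<union> G2)" by simp
  show ?thesis
  proof (rule that[OF fin])
    fix u assume u: "u \<in> X_space s" "\<And>i. i \<in> G1 \<union> G2 \<Longrightarrow> coef u i = 0"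
    let ?x = "emb (amp k) s u"
    have x: "?x \<in> l2" using u X_space_iff[of "amp k"] by simp
    define e where "e j i = \<i> * of_real \<kappa> * of_real (dd i j * (rho s k i j - 1))" for i j
    define y0 where "y0 i = of_real b * ?x i + \<i> * of_real \<kappa> * (dd i (\<tau> k i) * ?x (\<tau> k i)
      + dd (\<tau>' k i) (\<tau> k (\<tau>' k i)) * ?x (\<tau>' k i))" for i
    have y0: "y0 \<in> l2" "l2norm y0 \<le> sqrt (4 * \<kappa>\<^sup>2 + b\<^sup>2) * l2norm ?x"
      using skew_l2[of "\<tau>' k" "\<tau> k" "\<lambda>i. dd i (\<tau> k i)", OF _ _ dd_\<tau>_le x, of b \<kappa>]
        skew_l2norm[of "\<tau>' k" "\<tau> k" "\<lambda>i. dd i (\<tau> k i)", OF _ _ dd_\<tau>_le x, of b \<kappa>]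
      by (simp_all add: y0_def[abs_def])
    have e: "cmod (e j i) \<le> \<epsilon> / 2" if "\<bar>dd i j\<bar> \<le> 1" "dist (rho s k i j) 1 < \<delta>" for i j
    proof -
      have "cmod (e j i) = \<bar>\<kappa>\<bar> * (\<bar>dd i j\<bar> * \<bar>rho s k i j - 1\<bar>)"
        unfolding e_def norm_mult norm_of_real by (simp add: abs_mult)
      also have "\<dots> \<le> \<bar>\<kappa>\<bar> * (1 * \<delta>)"
        using that by (intro mult_left_mono mult_mono) (auto simp: dist_real_def)
      finally show ?thesis using \<delta>(2) by simp
    qed
    let ?y1 = "\<lambda>i. e (\<tau> k i) i * ?x (\<tau> k i)" and ?y2 = "\<lambda>i. e (\<tau>' k i) i * ?x (\<tau>' k i)"
    have e1: "cmod (e (\<tau> k i) i) \<le> \<epsilon> / 2" if "?x (\<tau> k i) \<noteq> 0" for i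
    proof (rule e[OF dd_\<tau>_le], rule ccontr)
      assume "\<not> dist (rho s k i (\<tau> k i)) 1 < \<delta>"
      then have "\<tau> k i \<in> G1 \<union> G2" by (simp add: G1_def)
      with u(2) that show False by (simp add: emb_def)
    qed
    have e2: "cmod (e (\<tau>' k i) i) \<le> \<epsilon> / 2" if "?x (\<tau>' k i) \<noteq> 0" for i
    proof (rule e[OF dd_\<tau>'_le], rule ccontr)
      assume "\<not> dist (rho s k i (\<tau>' k i)) 1 < \<delta>"
      then have "\<tau>' k i \<in> G1 \<union> G2" by (simp add: G2_def)
      with u(2) that show False by (simp add: emb_def)
    qed
    have \<epsilon>2: "0 \<le> \<epsilon> / 2" using \<epsilon> by simp
    have y: "?y1 \<in> l2" "?y2 \<in> l2" "l2norm ?y1 \<le> \<epsilon> / 2 * l2norm ?x" "l2norm ?y2 \<le> \<epsilon> / 2 * l2norm ?x"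
      using shift_l2[where h = "\<tau> k" and e = "\<lambda>i. e (\<tau> k i) i", OF bij_\<tau>(1) x \<epsilon>2 e1] shift_l2[where h = "\<tau>' k" and e = "\<lambda>i. e (\<tau>' k i) i", OF bij_\<tau>(2) x \<epsilon>2 e2]
        shift_l2norm[where h = "\<tau> k" and e = "\<lambda>i. e (\<tau> k i) i", OF bij_\<tau>(1) x \<epsilon>2 e1] shift_l2norm[where h = "\<tau>' k" and e = "\<lambda>i. e (\<tau>' k i) i", OF bij_\<tau>(2) x \<epsilon>2 e2] by blast+
    have "emb (amp k) s (L_op k u + cscale (of_real b) u) = (\<lambda>i. y0 i + (?y1 i + ?y2 i))"
    proof
      fix i
      have "ent s k i j = \<i> * of_real \<kappa> * of_real (dd i j) + e j i" for j
        by (simp add: ent_def e_def \<kappa>_def algebra_simps)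
      then show "emb (amp k) s (L_op k u + cscale (of_real b) u) i = y0 i + (?y1 i + ?y2 i)"
        unfolding emb_simps emb_L_op y0_def by (simp add: dd_\<tau>' algebra_simps)
    qed
    then have "V_norm k s (L_op k u + cscale (of_real b) u) \<le> l2norm y0 + (l2norm ?y1 + l2norm ?y2)"
      using l2norm_add[OF y0(1) l2_add[OF y(1,2)]] l2norm_add[OF y(1,2)] by simp
    also have "\<dots> \<le> sqrt (4 * \<kappa>\<^sup>2 + b\<^sup>2) * l2norm ?x + (\<epsilon> / 2 * l2norm ?x + \<epsilon> / 2 * l2norm ?x)"
      by (intro add_mono y0 y)
    also have "\<dots> = (sqrt (4 * \<kappa>\<^sup>2 + b\<^sup>2) + \<epsilon>) * l2norm ?x" by (simp add: algebra_simps)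
    also have "4 * \<kappa>\<^sup>2 = (k * amp k)\<^sup>2" by (simp add: \<kappa>_def power2_eq_square)
    finally show "V_norm k s (L_op k u + cscale (of_real b) u)
      \<le> (sqrt ((k * amp k)\<^sup>2 + b\<^sup>2) + \<epsilon>) * V_norm k s u" .
  qed
qed

text \<open>With the second frequency frozen at \<open>m\<close> the derivative in \<open>x2\<close>
  is a bounded factor. The weight \<open>jap powr (1 / 2)\<close> of one more derivative is then
  compensated by the bracket powers in \<open>dd\<close>.\<close>

lemma L_op_gains_on_fibre:
  assumes u: "u \<in> X_space s" and m: "\<And>i. snd (snd i) \<noteq> m \<Longrightarrow> coef u i = 0"
  shows "L_op k u \<in> X_space (s + 1)"
proof -
  let ?x = "emb (amp k) s u"
  have x: "?x \<in> l2" using u X_space_iff[of "amp k"] by simp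
  have wt: "wt (amp k) (s + 1) i = jap i powr (1 / 2) * wt (amp k) s i" for i
    by (simp add: wt_def powr_add[symmetric] add_divide_distrib diff_divide_distrib add.commute)
  define e where "e j i = of_real (jap i powr (1 / 2)) * ent s k i j" for i j
  have e: "emb (amp k) (s + 1) (L_op k u) i = e (\<tau> k i) i * ?x (\<tau> k i) + e (\<tau>' k i) i * ?x (\<tau>' k i)" for i
  proof -
    have "emb (amp k) (s + 1) (L_op k u) i = of_real (jap i powr (1 / 2)) * emb (amp k) s (L_op k u) i"
      by (simp add: emb_def wt)
    then show ?thesis by (simp add: emb_L_op e_def algebra_simps)
  qed
  have *: "(\<lambda>i. e (t i) i * ?x (t i)) \<in> l2"
    if t: "bij t" "\<And>i. snd (snd (t i)) = snd (snd i)"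
      and r: "((\<lambda>i. jap (t i) / jap i) \<longlongrightarrow> 1) cofinite" and \<rho>: "((\<lambda>i. rho s k i (t i)) \<longlongrightarrow> 1) cofinite" for t
  proof -
    have "((\<lambda>i. inverse (jap (t i) / jap i)) \<longlongrightarrow> inverse 1) cofinite" by (intro tendsto_intros r) simp
    then have "((\<lambda>i. jap i / jap (t i)) \<longlongrightarrow> 1) cofinite" by simp
    then have "((\<lambda>i. (jap i / jap (t i)) powr (1 / 4) * rho s k i (t i)) \<longlongrightarrow> 1 powr (1 / 4) * 1) cofinite"
      by (intro tendsto_mult tendsto_powr \<rho> tendsto_const) simp_all
    then obtain B where B: "0 < B" "\<And>i. \<bar>(jap i / jap (t i)) powr (1 / 4) * rho s k i (t i)\<bar> \<le> B"
      using cofinite_tendsto_bounded by blast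
    show ?thesis
    proof (rule shift_l2[OF t(1) x])
      show "0 \<le> k * amp k / 2 * \<bar>m\<bar> * B" using B(1) amp_pos[of k] by simp
      fix i assume "?x (t i) \<noteq> 0"
      then have mi: "snd (snd i) = m" using m[of "t i"] t(2)[of i] by (auto simp: emb_def)
      have q: "jap i powr (1 / 2) * jap i powr (- 1 / 4) = jap i powr (1 / 4)"
        by (simp add: powr_add[symmetric])
      have "jap i powr (1 / 2) * (dd i (t i) * rho s k i (t i))
          = m * ((jap i powr (1 / 2) * jap i powr (- 1 / 4)) * jap (t i) powr (- 1 / 4) * rho s k i (t i))"
        by (simp add: dd_def mi mult_ac)
      also have "\<dots> = m * ((jap i / jap (t i)) powr (1 / 4) * rho s k i (t i))"
        unfolding q by (simp add: powr_divide less_imp_le powr_minus_divide)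
      finally have eq: "jap i powr (1 / 2) * (dd i (t i) * rho s k i (t i))
        = m * ((jap i / jap (t i)) powr (1 / 4) * rho s k i (t i))" .
      have ei: "e (t i) i = - \<i> * of_real (k * amp k / 2) * of_real (jap i powr (1 / 2) * (dd i (t i) * rho s k i (t i)))"
        by (simp add: e_def ent_def)
      have "cmod (e (t i) i) = k * amp k / 2 * (\<bar>m\<bar> * \<bar>(jap i / jap (t i)) powr (1 / 4) * rho s k i (t i)\<bar>)"
        unfolding ei eq norm_mult norm_of_real by (simp add: abs_mult)
      also have "\<dots> \<le> k * amp k / 2 * (\<bar>m\<bar> * B)"
        using B amp_pos[of k] by (intro mult_left_mono) (auto simp: less_imp_le)
      finally show "cmod (e (t i) i) \<le> k * amp k / 2 * \<bar>m\<bar> * B" by simp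
    qed
  qed
  have "(\<lambda>i. e (\<tau> k i) i * ?x (\<tau> k i) + e (\<tau>' k i) i * ?x (\<tau>' k i)) \<in> l2"
    by (intro l2_add * bij_\<tau> jap_\<tau>_tendsto rho_\<tau>_tendsto) simp_all
  moreover have "emb (amp k) (s + 1) (L_op k u)
      = (\<lambda>i. e (\<tau> k i) i * ?x (\<tau> k i) + e (\<tau>' k i) i * ?x (\<tau>' k i))" by (rule ext) (rule e)
  moreover have "coef (L_op k u) (True, 0, 0) = 0" by (simp add: coef_L_op)
  ultimately show ?thesis using X_space_iff[of "amp k" "L_op k u" "s + 1"] by simp
qed

section \<open>Equivalent norms\<close>

text \<open>Estimates are made in \<open>V_norm\<close> and results are stated in
  \<open>X_norm\<close>; the Fredholm property and the resolvent set depend only on the equivalence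
  class of the norm.\<close>

definition equivalent_norms :: "state set \<Rightarrow> (state \<Rightarrow> real) \<Rightarrow> (state \<Rightarrow> real) \<Rightarrow> bool" where
  "equivalent_norms V N N' \<longleftrightarrow> state.subspace V \<and> (\<forall>u\<in>V. 0 \<le> N u \<and> 0 \<le> N' u) \<and>
     (\<exists>A\<ge>0. \<forall>u\<in>V. N u \<le> A * N' u \<and> N' u \<le> A * N u)"

lemma equivalent_norms_sym: "equivalent_norms V N N' \<Longrightarrow> equivalent_norms V N' N"
  unfolding equivalent_norms_def by blast

lemma bounded_op_equivalent_norms:
  assumes "equivalent_norms V N N'" "bounded_op V N T"
  shows "bounded_op V N' T"
proof -
  obtain A where A: "0 \<le> A" "\<And>u. u \<in> V \<Longrightarrow> N u \<le> A * N' u" "\<And>u. u \<in> V \<Longrightarrow> N' u \<le> A * N u"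
    and pos: "\<And>u. u \<in> V \<Longrightarrow> 0 \<le> N u" "\<And>u. u \<in> V \<Longrightarrow> 0 \<le> N' u"
    using assms(1) unfolding equivalent_norms_def by blast
  have T: "T ` V \<subseteq> V" "linear_on V T" using assms(2) by (simp_all add: bounded_op_def)
  obtain C where C: "\<And>u. u \<in> V \<Longrightarrow> N (T u) \<le> C * N u" using assms(2) unfolding bounded_op_def by blast
  have "N' (T u) \<le> (A * \<bar>C\<bar> * A) * N' u" if u: "u \<in> V" for u
  proof -
    have Tu: "T u \<in> V" using T(1) u by blast
    have "N' (T u) \<le> A * N (T u)" by (rule A(3)[OF Tu])
    also have "\<dots> \<le> A * (\<bar>C\<bar> * N u)"
      using C[OF u] mult_right_mono[OF abs_ge_self pos(1)[OF u], of C] A(1)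
      by (intro mult_left_mono) linarith+
    also have "\<dots> \<le> A * (\<bar>C\<bar> * (A * N' u))" by (intro mult_left_mono A u) auto
    finally show ?thesis by (simp add: mult.assoc)
  qed
  with T show ?thesis unfolding bounded_op_def by blast
qed

lemma closed_subspace_equivalent_norms:
  assumes eq: "equivalent_norms V N N'" and W: "closed_subspace V N W"
  shows "closed_subspace V N' W"
proof -
  obtain A where A: "0 \<le> A" "\<And>u. u \<in> V \<Longrightarrow> N u \<le> A * N' u"
    and pos: "\<And>u. u \<in> V \<Longrightarrow> 0 \<le> N u" and sub: "state.subspace V"
    using eq unfolding equivalent_norms_def by blast
  have WV: "W \<subseteq> V" using W by (simp add: closed_subspace_def)
  have "l \<in> W" if x: "\<forall>i. x i \<in> W" and l: "l \<in> V" "(\<lambda>i::nat. N' (x i - l)) \<longlonglongrightarrow> 0" for x l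
  proof -
    have d: "x i - l \<in> V" for i using x WV l(1) by (intro state.subspace_diff[OF sub]) blast+
    have "(\<lambda>i. N (x i - l)) \<longlonglongrightarrow> 0"
    proof (rule tendsto_sandwich[OF _ _ tendsto_const])
      show "\<forall>\<^sub>F i in sequentially. 0 \<le> N (x i - l)" using pos d by simp
      show "\<forall>\<^sub>F i in sequentially. N (x i - l) \<le> A * N' (x i - l)" using A(2) d by simp
      show "(\<lambda>i. A * N' (x i - l)) \<longlonglongrightarrow> 0" by (rule tendsto_mult_right_zero[OF l(2)])
    qed
    then show ?thesis using W x l(1) unfolding closed_subspace_def by blast
  qed
  then show ?thesis using W unfolding closed_subspace_def by blast
qed

lemma fredholm_equivalent_norms:
  assumes "equivalent_norms V N N'" "fredholm V N T"
  shows "fredholm V N' T"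
  using assms(2) bounded_op_equivalent_norms[OF assms(1)] closed_subspace_equivalent_norms[OF assms(1)]
  unfolding fredholm_def by blast

lemma resolvent_set_equivalent_norms:
  assumes "equivalent_norms V N N'"
  shows "resolvent_set V N T = resolvent_set V N' T"
proof -
  have "bounded_op V N S \<longleftrightarrow> bounded_op V N' S" for S
    using bounded_op_equivalent_norms assms equivalent_norms_sym by blast
  then show ?thesis by (simp add: resolvent_set_def)
qed

lemma amp_ge_1: "1 \<le> amp k"
  by (simp add: amp_def)

lemma X_norm_equivalent: "equivalent_norms (X_space s) (X_norm s) (V_norm k s)"
  unfolding equivalent_norms_def
proof (intro conjI ballI exI[of _ "amp k"])
  interpret normed_banach_states "X_space s" "V_norm k s" "pairings (amp k) s" by (rule V_norm_states)
  show "state.subspace (X_space s)" by (rule V_subspace)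
  fix u assume u: "u \<in> X_space s"
  let ?x = "(sobolev_norm (s - 1) (fst u))\<^sup>2" and ?y = "(sobolev_norm s (snd u))\<^sup>2"
  have V: "(V_norm k s u)\<^sup>2 = (amp k)\<^sup>2 * ?x + ?y" using l2norm_emb[OF amp_pos u] .
  have X: "(X_norm s u)\<^sup>2 = ?x + ?y" by (simp add: X_norm_def)
  show "0 \<le> X_norm s u" "0 \<le> V_norm k s u" by (simp_all add: X_norm_def)
  have a: "1 \<le> (amp k)\<^sup>2" using amp_ge_1 by (simp add: one_le_power)
  have 1: "1 * ?x \<le> (amp k)\<^sup>2 * ?x" "1 * ?y \<le> (amp k)\<^sup>2 * ?y" using a by (intro mult_right_mono; simp)+
  have "(X_norm s u)\<^sup>2 \<le> (V_norm k s u)\<^sup>2" unfolding V X using 1 by simp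
  then have "X_norm s u \<le> V_norm k s u" by (rule power2_le_imp_le) simp
  also have "\<dots> \<le> amp k * V_norm k s u" using mult_right_mono[OF amp_ge_1, of "V_norm k s u"] by simp
  finally show "X_norm s u \<le> amp k * V_norm k s u" .
  have "(V_norm k s u)\<^sup>2 \<le> (amp k * X_norm s u)\<^sup>2" unfolding power_mult_distrib V X using 1 by (simp add: distrib_left)
  then show "V_norm k s u \<le> amp k * X_norm s u" by (rule power2_le_imp_le) (simp add: X_norm_def)
qed simp

section \<open>The resolvent off the segment\<close>

definition seg :: "nat \<Rightarrow> complex set" where
  "seg k = (\<lambda>y. \<i> * complex_of_real y) ` {- (k * amp k) .. k * amp k}"

text \<open>The inequality amounts to
  \<open>(k * amp k)\<^sup>2 < 2 b Re z + (cmod z)\<^sup>2\<close>. If \<open>Re z\<close> is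
  nonzero, a \<open>b\<close> of its sign makes the right side large; if it is zero,
  \<open>b = 0\<close> works because \<open>z\<close> lies beyond an endpoint.\<close>

lemma off_seg_shift:
  assumes "z \<notin> seg k"
  obtains b :: real where "sqrt ((k * amp k)\<^sup>2 + b\<^sup>2) < cmod (z + of_real b)"
proof -
  let ?c = "k * amp k"
  have c: "0 \<le> ?c" by simp
  have *: "sqrt (?c\<^sup>2 + b\<^sup>2) < cmod (z + of_real b)" if "?c\<^sup>2 < 2 * b * Re z + (cmod z)\<^sup>2" for b
  proof -
    have "(cmod (z + of_real b))\<^sup>2 = b\<^sup>2 + (2 * b * Re z + (cmod z)\<^sup>2)"
      unfolding cmod_power2 by (simp add: power2_eq_square algebra_simps)
    then have "?c\<^sup>2 + b\<^sup>2 < (cmod (z + of_real b))\<^sup>2" using that by simp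
    then show ?thesis by (intro real_less_lsqrt) auto
  qed
  have "\<exists>b. sqrt (?c\<^sup>2 + b\<^sup>2) < cmod (z + of_real b)"
  proof (cases "Re z = 0")
    case True
    have "\<not> \<bar>Im z\<bar> \<le> ?c"
    proof
      assume "\<bar>Im z\<bar> \<le> ?c"
      then have "Im z \<in> {- ?c .. ?c}" by (simp add: abs_le_iff)
      moreover have "z = \<i> * of_real (Im z)" using True by (simp add: complex_eq_iff)
      ultimately show False using assms unfolding seg_def by blast
    qed
    then have "?c\<^sup>2 < \<bar>Im z\<bar>\<^sup>2" using c by (intro power_strict_mono) auto
    then show ?thesis using True by (intro exI[of _ 0] *) (simp add: cmod_power2)
  next
    case False
    have "0 \<le> (cmod z)\<^sup>2" by simp
    moreover have "2 * ((?c\<^sup>2 + 1) / (2 * Re z)) * Re z = ?c\<^sup>2 + 1" using False by simp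
    ultimately show ?thesis by (intro exI[of _ "(?c\<^sup>2 + 1) / (2 * Re z)"] *) linarith
  qed
  then show thesis using that by blast
qed

lemma
  assumes u: "u \<in> X_space s" and le: "\<And>i. cmod (coef v i) \<le> cmod (coef u i)"
  shows X_space_dominated: "v \<in> X_space s" and V_norm_dominated: "V_norm k s v \<le> V_norm k s u"
proof -
  have u': "emb (amp k) s u \<in> l2" for k using u X_space_iff[of "amp k"] by simp
  have le': "cmod (emb (amp k) s v i) \<le> 1 * cmod (emb (amp k) s u i)" for k i
    using le[of i] by (simp add: emb_def norm_mult mult_left_mono)
  have "emb (amp k) s v \<in> l2" for k by (rule l2_dominated[OF u' _ le']) simp
  moreover have "coef v (True, 0, 0) = 0" using le[of "(True, 0, 0)"] X_space_coef_0[OF u] by simp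
  ultimately show "v \<in> X_space s" using X_space_iff[of "amp 0"] by simp
  show "V_norm k s v \<le> V_norm k s u" using l2norm_dominated[OF u' _ le', of k] by simp
qed

lemma X_space_finite_support:
  assumes "finite {i. coef v i \<noteq> 0}" "coef v (True, 0, 0) = 0"
  shows "v \<in> X_space s"
proof -
  have "finite {i. emb 1 s v i \<noteq> 0}"
    by (rule finite_subset[OF _ assms(1)]) (auto simp: emb_def)
  then have "emb 1 s v \<in> l2" by (rule l2_finite_support)
  with assms(2) show ?thesis using X_space_iff[of 1] by simp
qed

lemma coef_le_V_norm:
  assumes "u \<in> X_space s"
  shows "cmod (coef u i) \<le> 1 / wt (amp k) s i * V_norm k s u"
proof -
  have "cmod (emb (amp k) s u i) \<le> V_norm k s u"
    using assms X_space_iff[of "amp k"] by (intro cmod_le_l2norm) simp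
  then show ?thesis using wt_pos[OF amp_pos, of k s i] by (simp add: emb_def norm_mult field_simps)
qed

text \<open>Write \<open>z - L\<close> as \<open>(z + b) - (L + b)\<close> and let
  \<open>L + b\<close> act on the coordinates outside \<open>G\<close> only. This part has norm at
  most \<open>q < cmod (z + b)\<close>, so the Neumann series inverts \<open>Q\<close>, and the
  action on the coordinates in \<open>G\<close> has finite rank.\<close>

lemma off_seg:
  assumes z: "z \<notin> seg k"
  shows off_seg_fredholm: "fredholm (X_space s) (V_norm k s) (shifted z (L_op k))"
    and off_seg_resolvent: "(\<And>u. u \<in> X_space s \<Longrightarrow> L_op k u = cscale z u \<Longrightarrow> u = 0) \<Longrightarrow>
      z \<in> resolvent_set (X_space s) (V_norm k s) (L_op k)"
proof -
  interpret normed_banach_states "X_space s" "V_norm k s" "pairings (amp k) s" by (rule V_norm_states)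
  note L = bounded_opD[OF L_op_bounded[of s k]]
  obtain b where b: "sqrt ((k * amp k)\<^sup>2 + b\<^sup>2) < cmod (z + of_real b)" using off_seg_shift[OF z] .
  define \<epsilon> where "\<epsilon> = (cmod (z + of_real b) - sqrt ((k * amp k)\<^sup>2 + b\<^sup>2)) / 2"
  define q where "q = sqrt ((k * amp k)\<^sup>2 + b\<^sup>2) + \<epsilon>"
  have \<epsilon>: "0 < \<epsilon>" and q: "q < cmod (z + of_real b)" "0 \<le> q" using b by (auto simp: \<epsilon>_def q_def field_simps)
  obtain G0 where G0: "finite G0" "\<And>u. u \<in> X_space s \<Longrightarrow> (\<And>i. i \<in> G0 \<Longrightarrow> coef u i = 0) \<Longrightarrow>
      V_norm k s (L_op k u + cscale (of_real b) u) \<le> q * V_norm k s u"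
    using high_frequency_bound[OF \<epsilon>, of s k b] unfolding q_def by blast
  \<comment> \<open>The mean mode of \<omega> is removed because the unit vectors \<open>e g\<close>
    must lie in the space; the coordinate vanishes there anyway.\<close>
  define G where "G = G0 - {(True, 0, 0)}"
  have G: "finite G" using G0(1) by (simp add: G_def)
  define p where "p u = of_coef (\<lambda>i. if i \<in> G then 0 else coef u i)" for u
  define e where "e g = of_coef (\<lambda>i. if i = g then 1 else 0)" for g :: "bool \<times> int \<times> int"
  define Lb where "Lb u = L_op k u + cscale (of_real b) u" for u
  define W where "W u = Lb (p u)" for u
  have pV: "p u \<in> X_space s" and p_le: "V_norm k s (p u) \<le> V_norm k s u" if "u \<in> X_space s" for u
    using X_space_dominated[OF that, of "p u"] V_norm_dominated[OF that, of "p u" k] by (simp_all add: p_def)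
  have eV: "e g \<in> X_space s" if "g \<in> G" for g
    using that by (intro X_space_finite_support) (auto simp: e_def G_def)
  have Lb_V: "Lb u \<in> X_space s" if "u \<in> X_space s" for u
    unfolding Lb_def by (intro V_add V_scale L that)
  have Lb_lin: "Lb (u + v) = Lb u + Lb v" "Lb (cscale c u) = cscale c (Lb u)" for u v c
    by (simp_all add: Lb_def L_op_linear cscale_distrib mult.commute)
  have Lb_0: "Lb 0 = 0" by (simp add: Lb_def L_op_linear)
  have Lb_sum: "Lb (sum f A) = (\<Sum>a\<in>A. Lb (f a))" for f :: "bool \<times> int \<times> int \<Rightarrow> state" and A
    by (induction A rule: infinite_finite_induct) (simp_all add: Lb_lin Lb_0)
  have p_lin: "p (u + v) = p u + p v" "p (cscale c u) = cscale c (p u)" for u v c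
    by (rule state_eqI; simp add: p_def)+
  have W_le: "V_norm k s (W u) \<le> q * V_norm k s u" if u: "u \<in> X_space s" for u
  proof -
    have "V_norm k s (W u) \<le> q * V_norm k s (p u)"
      unfolding W_def Lb_def
    proof (rule G0(2)[OF pV[OF u]])
      show "coef (p u) i = 0" if "i \<in> G0" for i
        using that X_space_coef_0[OF u] by (auto simp: p_def G_def)
    qed
    also have "\<dots> \<le> q * V_norm k s u" by (intro mult_left_mono p_le u q)
    finally show ?thesis .
  qed
  have W: "bounded_op (X_space s) (V_norm k s) W"
    by (rule bounded_opI[OF _ _ _ W_le]) (simp_all add: W_def Lb_V pV Lb_lin p_lin)
  define Q where "Q u = cscale (z + of_real b) u - W u" for u
  have Q: "bounded_op (X_space s) (V_norm k s) Q"
    unfolding Q_def by (rule bounded_op_scale_minus[OF W])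
  have "inv_op Q" unfolding Q_def by (rule neumann[OF W W_le q])
  then obtain R where R: "bounded_op (X_space s) (V_norm k s) R"
    "\<And>u. u \<in> X_space s \<Longrightarrow> R (Q u) = u" "\<And>u. u \<in> X_space s \<Longrightarrow> Q (R u) = u"
    unfolding inv_op_def by blast
  interpret F: finite_rank_perturbation "X_space s" "V_norm k s" Q R "shifted z (L_op k)" G
    "\<lambda>g u. coef u g" "\<lambda>g. Lb (e g)" e "\<lambda>g. 1 / wt (amp k) s g"
  proof
    show "shifted z (L_op k) u = Q u - (\<Sum>g\<in>G. cscale (coef u g) (Lb (e g)))" for u
    proof -
      have "u = p u + (\<Sum>g\<in>G. cscale (coef u g) (e g))"
      proof (rule state_eqI)
        fix i
        have "(\<Sum>g\<in>G. coef u g * coef (e g) i) = (\<Sum>g\<in>G. if g = i then coef u i else 0)"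
          by (intro sum.cong refl) (auto simp: e_def)
        then show "coef u i = coef (p u + (\<Sum>g\<in>G. cscale (coef u g) (e g))) i"
          using G by (simp add: coef_sum p_def)
      qed
      moreover have "Lb (p u + (\<Sum>g\<in>G. cscale (coef u g) (e g))) = Lb (p u) + (\<Sum>g\<in>G. cscale (coef u g) (Lb (e g)))"
        by (simp only: Lb_lin Lb_sum)
      ultimately have "Lb u = W u + (\<Sum>g\<in>G. cscale (coef u g) (Lb (e g)))"
        unfolding W_def by simp
      then show ?thesis
        by (simp add: shifted_def Q_def Lb_def cscale_distrib algebra_simps)
    qed
    show "coef (e g') g = (if g = g' then 1 else 0)" for g g' by (simp add: e_def)
  qed (use Q R G Lb_V eV coef_le_V_norm in simp_all)
  show "fredholm (X_space s) (V_norm k s) (shifted z (L_op k))" by (rule F.fredholm_T)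
  show "z \<in> resolvent_set (X_space s) (V_norm k s) (L_op k)"
    if "\<And>u. u \<in> X_space s \<Longrightarrow> L_op k u = cscale z u \<Longrightarrow> u = 0"
    unfolding resolvent_set_iff
    by (rule F.inv_op_T_if_injective, rule that) (simp_all add: shifted_def)
qed

section \<open>Eigenvectors\<close>

definition fibre :: "int \<Rightarrow> state \<Rightarrow> state" where
  "fibre m u = of_coef (\<lambda>i. if snd (snd i) = m then coef u i else 0)"

lemma coef_fibre: "coef (fibre m u) i = (if snd (snd i) = m then coef u i else 0)"
  by (simp add: fibre_def)

lemma
  assumes "u \<in> X_space s"
  shows fibre_in_X: "fibre m u \<in> X_space s"
  by (rule X_space_dominated[OF assms]) (simp add: coef_fibre)

text \<open>\<open>cos (k x1)\<close> does not involve \<open>x2\<close>, so the operator preserves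
  each second frequency.\<close>

lemma L_op_fibre: "L_op k (fibre m u) = fibre m (L_op k u)"
  by (rule state_eqI) (simp add: coef_L_op coef_fibre)

lemma X_space_mono:
  assumes "s' \<le> s" "u \<in> X_space s"
  shows "u \<in> X_space s'"
proof -
  have u: "coef u (True, 0, 0) = 0" "emb 1 s u \<in> l2" using assms(2) X_space_iff[of 1] by simp_all
  have "emb 1 s' u \<in> l2"
  proof (rule l2_dominated[OF u(2)])
    fix i
    have "wt 1 s' i \<le> wt 1 s i" using assms(1) jap_ge_1[of i] by (simp add: wt_def powr_mono)
    then have "\<bar>wt 1 s' i\<bar> \<le> \<bar>wt 1 s i\<bar>" using wt_pos[of 1 s' i] by simp
    then show "cmod (emb 1 s' u i) \<le> 1 * cmod (emb 1 s u i)"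
      by (simp add: emb_def norm_mult mult_right_mono)
  qed simp
  with u(1) show ?thesis using X_space_iff[of 1] by simp
qed

text \<open>Bootstrap: \<open>u = (1 / z) L u\<close>, and each application of \<open>L\<close> on
  the fibre gains one derivative.\<close>

lemma eigenvector_smooth:
  assumes u: "u \<in> X_space s" and m: "\<And>i. snd (snd i) \<noteq> m \<Longrightarrow> coef u i = 0"
    and z: "z \<noteq> 0" "L_op k u = cscale z u"
  shows "u \<in> X_space s'"
proof -
  interpret X: normed_banach_states "X_space t" "V_norm k t" "pairings (amp k) t" for t by (rule V_norm_states)
  have eq: "u = cscale (1 / z) (L_op k u)" using z by simp
  have "u \<in> X_space (s + real n)" for n
  proof (induction n)
    case (Suc n)
    have "cscale (1 / z) (L_op k u) \<in> X_space (s + real n + 1)"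
      by (intro X.V_scale L_op_gains_on_fibre[OF Suc m])
    then show ?case using eq by (simp add: add_ac)
  qed (use u in simp)
  from X_space_mono[OF _ this[of "nat \<lceil>s' - s\<rceil>"]] show ?thesis
    by (smt (verit) of_nat_nat le_of_int_ceiling of_nat_0_le_iff real_nat_ceiling_ge)
qed

text \<open>Some fibre of an eigenvector is nonzero and is again an eigenvector for the same
  \<open>z\<close>. It has one second frequency, so the bootstrap places it in every
  \<open>X_space s'\<close>.\<close>

lemma eigenvalue_independent:
  assumes z: "z \<noteq> 0" and u: "u \<in> X_space s" "u \<noteq> 0" "L_op k u = cscale z u"
  obtains v where "v \<in> X_space s'" "v \<noteq> 0" "L_op k v = cscale z v"
proof -
  obtain i where i: "coef u i \<noteq> 0" using u(2) state_eqI[of u 0] by auto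
  define v where "v = fibre (snd (snd i)) u"
  have Lv: "L_op k v = cscale z v"
    unfolding v_def L_op_fibre u(3) by (rule state_eqI) (simp add: coef_fibre)
  moreover have "v \<noteq> 0"
  proof
    assume "v = 0"
    then have "coef v i = 0" by simp
    with i show False by (simp add: v_def coef_fibre)
  qed
  moreover have "v \<in> X_space s'"
    by (rule eigenvector_smooth[OF _ _ z Lv, of s "snd (snd i)"])
      (use fibre_in_X[OF u(1)] in \<open>simp_all add: v_def coef_fibre\<close>)
  ultimately show ?thesis using that[of v] by simp
qed

section \<open>The segment belongs to the essential spectrum\<close>

lemma dd_limit:
  fixes p q :: real
  shows "(\<lambda>n. real n * (1 + (p\<^sup>2 + (real n)\<^sup>2)) powr (- 1 / 4) * (1 + (q\<^sup>2 + (real n)\<^sup>2)) powr (- 1 / 4))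
    \<longlonglongrightarrow> 1"
  by real_asymp

text \<open>For a fixed first frequency and growing second one, both \<open>dd\<close> and
  \<open>rho\<close> tend to 1: the operator becomes translation invariant in the first frequency,
  with plane waves as generalised eigenvectors.\<close>

lemma ent_limit:
  assumes \<rho>: "((\<lambda>i. rho s k i (t i)) \<longlongrightarrow> 1) cofinite"
    and c: "\<And>n2. t (b, n1, n2) = (\<not> b, n1', n2)"
  shows "(\<lambda>n. ent s k (b, n1, int n) (t (b, n1, int n))) \<longlonglongrightarrow> - \<i> * of_real (k * amp k / 2)"
proof -
  have "filterlim (\<lambda>n. (b, n1, int n)) cofinite sequentially"
    unfolding cofinite_eq_sequentially[symmetric]
    by (rule filterlim_inj_cofinite) (auto intro: injI)
  from filterlim_compose[OF \<rho> this] have r: "(\<lambda>n. rho s k (b, n1, int n) (t (b, n1, int n))) \<longlonglongrightarrow> 1" .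
  have d: "(\<lambda>n. dd (b, n1, int n) (t (b, n1, int n))) \<longlonglongrightarrow> 1"
    using dd_limit[of "real_of_int n1" "real_of_int n1'"] by (simp add: c dd_def jap_def freq_sq_def)
  have "(\<lambda>n. - \<i> * of_real (k * amp k / 2)
      * of_real (dd (b, n1, int n) (t (b, n1, int n)) * rho s k (b, n1, int n) (t (b, n1, int n))))
    \<longlonglongrightarrow> - \<i> * of_real (k * amp k / 2) * of_real (1 * 1)"
    by (intro tendsto_intros r d)
  then show ?thesis unfolding ent_def by simp
qed

text \<open>Truncated plane waves \<open>e\<^sup>i\<^sup>\<theta>\<^sup>j\<close> at the frequencies \<open>(k j, m)\<close>, \<open>0 \<le> j < J\<close>, with
  \<open>z = - \<i> k (amp k) cos \<theta>\<close>: the truncation costs \<open>O(1)\<close> against a norm of order \<open>\<surd>J\<close>, and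
  the deviation from the constant-coefficient model vanishes as \<open>m \<rightarrow> \<infinity>\<close> with \<open>J\<close> fixed.\<close>

lemma quasimode:
  assumes k: "k \<ge> 1" and z: "z \<in> seg k" and \<epsilon>: "0 < \<epsilon>"
  obtains m u where "m0 < m" "u \<in> X_space s" "\<And>i. snd (snd i) \<noteq> m \<Longrightarrow> coef u i = 0"
    "V_norm k s u = 1" "V_norm k s (shifted z (L_op k) u) \<le> \<epsilon>"
proof -
  define \<kappa> where "\<kappa> = k * amp k / 2"
  have \<kappa>: "0 < \<kappa>" using k by (simp add: \<kappa>_def)
  obtain y where y: "- (2 * \<kappa>) \<le> y" "y \<le> 2 * \<kappa>" "z = \<i> * of_real y"
    using z by (auto simp: seg_def \<kappa>_def)
  \<comment> \<open>The constant-coefficient limit has symbol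
    \<open>- 2 \<i> \<kappa> cos \<theta>\<close>, whose values fill the segment;
    \<open>\<theta>\<close> is the phase that produces \<open>z\<close>.\<close>
  define \<theta> where "\<theta> = arccos (- y / (2 * \<kappa>))"
  have "cos \<theta> = - y / (2 * \<kappa>)" unfolding \<theta>_def using y \<kappa> by (intro cos_arccos) (auto simp: field_simps)
  then have yc: "y = - (2 * \<kappa> * cos \<theta>)" using \<kappa> by (simp add: field_simps)
  have wave: "z * cis (\<theta> * of_int j) + \<i> * of_real \<kappa> * (cis (\<theta> * of_int (j + 1)) + cis (\<theta> * of_int (j - 1))) = 0" for j
  proof -
    have "cis (\<theta> * of_int (j + 1)) = cis (\<theta> * of_int j) * cis \<theta>"
      "cis (\<theta> * of_int (j - 1)) = cis (\<theta> * of_int j) * cis (- \<theta>)"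
      unfolding cis_mult by (simp_all add: algebra_simps)
    then have "cis (\<theta> * of_int (j + 1)) + cis (\<theta> * of_int (j - 1)) = cis (\<theta> * of_int j) * (cis \<theta> + cis (- \<theta>))"
      by (simp add: algebra_simps)
    also have "cis \<theta> + cis (- \<theta>) = of_real (2 * cos \<theta>)" by (simp add: complex_eq_iff)
    finally show ?thesis unfolding y(3) yc by (simp add: algebra_simps)
  qed
  define \<delta> where "\<delta> = \<epsilon> / 4"
  have \<delta>: "0 < \<delta>" using \<epsilon> by (simp add: \<delta>_def)
  \<comment> \<open>Large enough that the truncation error \<open>sqrt 8 * (4 * \<kappa>)\<close> is
    at most \<open>\<epsilon> / 2\<close> times the norm \<open>sqrt (2 J)\<close> of the truncated
    wave. The remaining \<open>\<epsilon> / 2\<close> is shared by the two shift errors, each with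
    \<open>\<delta> = \<epsilon> / 4\<close>.\<close>
  obtain J :: nat where J: "(sqrt 8 * (4 * \<kappa>) * 2 / \<epsilon>)\<^sup>2 < real J" using reals_Archimedean2 by blast
  then have J0: "0 < J" by (metis of_nat_0 zero_le_power2 not_less gr0I)
  \<comment> \<open>The range reaches one step beyond the truncation at either end, because the
    operator spreads the wave to its neighbours.\<close>
  let ?I = "UNIV \<times> (\<lambda>j. int k * j) ` {- 1..int J} :: (bool \<times> int) set"
  have fin: "finite ?I" by simp
  have ev: "\<forall>\<^sub>F n in sequentially. \<forall>p\<in>?I.
      dist (ent s k (fst p, snd p, int n) (\<tau> k (fst p, snd p, int n))) (- \<i> * of_real \<kappa>) < \<delta> \<and>
      dist (ent s k (fst p, snd p, int n) (\<tau>' k (fst p, snd p, int n))) (- \<i> * of_real \<kappa>) < \<delta>"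
    unfolding \<kappa>_def
    by (intro eventually_ball_finite[OF fin] ballI eventually_conj tendstoD[OF ent_limit] \<delta> rho_\<tau>_tendsto) (simp_all add: \<tau>_def \<tau>'_def)
  have "\<forall>\<^sub>F n in sequentially. nat (max 0 m0) + 1 \<le> n" by (rule eventually_ge_at_top)
  from eventually_happens'[OF sequentially_bot eventually_conj[OF ev this]] obtain n where
    n: "nat (max 0 m0) + 1 \<le> n" and close: "\<And>p. p \<in> ?I \<Longrightarrow>
      dist (ent s k (fst p, snd p, int n) (\<tau> k (fst p, snd p, int n))) (- \<i> * of_real \<kappa>) < \<delta> \<and>
      dist (ent s k (fst p, snd p, int n) (\<tau>' k (fst p, snd p, int n))) (- \<i> * of_real \<kappa>) < \<delta>"
    by blast
  define m where "m = int n"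
  have m: "m0 < m" "0 < m" using n by (auto simp: m_def)
  define \<phi> where "\<phi> j = (if 0 \<le> j \<and> j < int J then cis (\<theta> * of_int j) else 0)" for j :: int
  define x where "x i = (if snd (snd i) = m \<and> int k dvd fst (snd i) then \<phi> (fst (snd i) div int k) else 0)"
    for i :: "bool \<times> int \<times> int"
  have kpos: "0 < int k" using k by simp
  have x_at: "x (b, int k * j, m) = \<phi> j" for b j using kpos by (simp add: x_def)
  have x_nz: "\<exists>b j. i = (b, int k * j, m) \<and> 0 \<le> j \<and> j < int J" if "x i \<noteq> 0" for i
  proof -
    obtain b n1 n2 where i: "i = (b, n1, n2)" by (cases i)
    have "n2 = m" "int k dvd n1" "\<phi> (n1 div int k) \<noteq> 0" using that by (auto simp: x_def i split: if_splits)
    moreover from this obtain j where "n1 = int k * j" by (blast elim: dvdE)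
    ultimately show ?thesis unfolding i using kpos by (auto simp: \<phi>_def split: if_splits)
  qed
  let ?S = "(\<lambda>(b, j). (b, int k * j, m)) ` ((UNIV :: bool set) \<times> {0..<int J})"
  have supp: "{i. x i \<noteq> 0} = ?S"
  proof (intro equalityI subsetI)
    fix i assume "i \<in> {i. x i \<noteq> 0}"
    then obtain b j where "i = (b, int k * j, m)" "0 \<le> j" "j < int J" using x_nz by blast
    then show "i \<in> ?S" by (intro image_eqI[of _ _ "(b, j)"]) auto
  qed (auto simp: x_at \<phi>_def)
  have inj: "inj_on (\<lambda>(b, j). (b, int k * j, m)) A" for A :: "(bool \<times> int) set"
    using kpos by (auto intro!: inj_onI)
  have finS: "finite {i. x i \<noteq> 0}" unfolding supp by simp
  have xl2: "x \<in> l2" by (rule l2_finite_support[OF finS])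
  have "(l2norm x)\<^sup>2 = (\<Sum>i\<in>?S. (cmod (x i))\<^sup>2)"
    using l2norm_finite_support[OF finS] unfolding supp .
  also have "\<dots> = (\<Sum>p\<in>(UNIV :: bool set) \<times> {0..<int J}. (1::real))"
    unfolding sum.reindex[OF inj] by (rule sum.cong) (auto simp: x_at \<phi>_def)
  also have "\<dots> = 2 * real J"
    unfolding sum_constant card_cartesian_product card_UNIV_bool card_atLeastLessThan_int by simp
  finally have xn: "(l2norm x)\<^sup>2 = 2 * real J" .
  then have "l2norm x \<noteq> 0" using J0 by auto
  then have xpos: "0 < l2norm x" by (simp add: order_less_le)
  define u0 where "u0 = of_coef (\<lambda>i. x i / of_real (wt (amp k) s i))"
  have wtnz: "wt (amp k) s i \<noteq> 0" for i using wt_pos[OF amp_pos, of k s i] by simp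
  have emb_u0: "emb (amp k) s u0 = x" by (rule ext) (simp add: emb_def u0_def wtnz)
  have u0m: "coef u0 i = 0" if "snd (snd i) \<noteq> m" for i using that by (simp add: u0_def x_def)
  have u0X: "u0 \<in> X_space s" using X_space_iff[of "amp k" u0 s] u0m[of "(True, 0, 0)"] m xl2 by (simp add: emb_u0)
  \<comment> \<open>\<open>r\<close> is the residual of the constant-coefficient model and
    \<open>e\<close> the deviation of the true entries from it. Setting \<open>e\<close> to zero
    away from the support is harmless, as the values of \<open>x\<close> it multiplies vanish
    there.\<close>
  define r where "r i = z * x i + \<i> * of_real \<kappa> * (x (\<tau> k i) + x (\<tau>' k i))" for i
  define e where "e t i = (if i \<in> (\<lambda>p. (fst p, snd p, m)) ` ?I then - (ent s k i (t i) + \<i> * of_real \<kappa>) else 0)"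
    for t i
  have near: "i \<in> (\<lambda>p. (fst p, snd p, m)) ` ?I" if "x (\<tau> k i) \<noteq> 0 \<or> x (\<tau>' k i) \<noteq> 0" for i
  proof -
    obtain b n1 n2 where i: "i = (b, n1, n2)" by (cases i)
    have "\<exists>j. n1 = int k * j \<and> n2 = m \<and> - 1 \<le> j \<and> j \<le> int J"
      using that
    proof
      assume "x (\<tau> k i) \<noteq> 0"
      then obtain b' j where "\<tau> k i = (b', int k * j, m)" "0 \<le> j" "j < int J" using x_nz by blast
      then show ?thesis by (intro exI[of _ "j - 1"]) (auto simp: i \<tau>_def algebra_simps)
    next
      assume "x (\<tau>' k i) \<noteq> 0"
      then obtain b' j where "\<tau>' k i = (b', int k * j, m)" "0 \<le> j" "j < int J" using x_nz by blast
      then show ?thesis by (intro exI[of _ "j + 1"]) (auto simp: i \<tau>'_def algebra_simps)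
    qed
    then show ?thesis unfolding i by (intro image_eqI[of _ _ "(b, n1)"]) auto
  qed
  have emb_T: "emb (amp k) s (shifted z (L_op k) u0) = (\<lambda>i. r i + (e (\<tau> k) i * x (\<tau> k i) + e (\<tau>' k) i * x (\<tau>' k i)))"
  proof
    fix i
    have "emb (amp k) s (shifted z (L_op k) u0) i
        = z * x i - (ent s k i (\<tau> k i) * x (\<tau> k i) + ent s k i (\<tau>' k i) * x (\<tau>' k i))"
      unfolding shifted_def emb_simps emb_L_op emb_u0 ..
    also have "\<dots> = r i + (e (\<tau> k) i * x (\<tau> k i) + e (\<tau>' k) i * x (\<tau>' k i))"
    proof (cases "x (\<tau> k i) \<noteq> 0 \<or> x (\<tau>' k i) \<noteq> 0")
      case True
      from near[OF this] show ?thesis by (simp add: r_def e_def algebra_simps)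
    next
      case False
      then show ?thesis by (simp add: r_def)
    qed
    finally show "emb (amp k) s (shifted z (L_op k) u0) i = r i + (e (\<tau> k) i * x (\<tau> k i) + e (\<tau>' k) i * x (\<tau>' k i))" .
  qed
  have e_le: "cmod (e (\<tau> k) i) \<le> \<delta>" "cmod (e (\<tau>' k) i) \<le> \<delta>" for i
  proof -
    have "cmod (e (\<tau> k) i) \<le> \<delta> \<and> cmod (e (\<tau>' k) i) \<le> \<delta>"
    proof (cases "i \<in> (\<lambda>p. (fst p, snd p, m)) ` ?I")
      case True
      then obtain p where p: "p \<in> ?I" "i = (fst p, snd p, m)" by blast
      have e: "e t i = - (ent s k i (t i) - (- \<i> * of_real \<kappa>))" for t
        using True unfolding e_def by simp
      have "dist (ent s k i (\<tau> k i)) (- \<i> * of_real \<kappa>) < \<delta> \<and> dist (ent s k i (\<tau>' k i)) (- \<i> * of_real \<kappa>) < \<delta>"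
        using close[OF p(1)] unfolding p(2) m_def .
      then show ?thesis
        unfolding e norm_minus_cancel dist_norm by (simp only: less_imp_le)
    next
      case False
      then show ?thesis using \<delta> unfolding e_def by simp
    qed
    then show "cmod (e (\<tau> k) i) \<le> \<delta>" "cmod (e (\<tau>' k) i) \<le> \<delta>" by auto
  qed
  have \<delta>0: "0 \<le> \<delta>" using \<delta> by simp
  note e1 = shift_l2[where h = "\<tau> k" and e = "e (\<tau> k)", OF bij_\<tau>(1) xl2 \<delta>0 e_le(1)]
    shift_l2norm[where h = "\<tau> k" and e = "e (\<tau> k)", OF bij_\<tau>(1) xl2 \<delta>0 e_le(1)]
  note e2 = shift_l2[where h = "\<tau>' k" and e = "e (\<tau>' k)", OF bij_\<tau>(2) xl2 \<delta>0 e_le(2)]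
    shift_l2norm[where h = "\<tau>' k" and e = "e (\<tau>' k)", OF bij_\<tau>(2) xl2 \<delta>0 e_le(2)]
  have x\<tau>: "x (\<tau> k (b, int k * j, m)) = \<phi> (j + 1)" "x (\<tau>' k (b, int k * j, m)) = \<phi> (j - 1)" for b j
    using x_at[of _ "j + 1"] x_at[of _ "j - 1"] by (simp_all add: \<tau>_def \<tau>'_def algebra_simps)
  \<comment> \<open>The wave relation cancels \<open>r\<close> in the interior, so \<open>r\<close>
    survives only at the cut: four positions in each of two components, whence the 8.\<close>
  let ?E = "(\<lambda>(b, j). (b, int k * j, m)) ` ((UNIV :: bool set) \<times> {- 1, 0, int J - 1, int J})"
  have r_nz: "i \<in> ?E" if "r i \<noteq> 0" for i
  proof -
    have "x i \<noteq> 0 \<or> (x (\<tau> k i) \<noteq> 0 \<or> x (\<tau>' k i) \<noteq> 0)" using that by (auto simp: r_def)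
    then have "\<exists>b j. i = (b, int k * j, m)"
    proof
      assume "x i \<noteq> 0"
      then show ?thesis using x_nz[of i] by blast
    next
      assume "x (\<tau> k i) \<noteq> 0 \<or> x (\<tau>' k i) \<noteq> 0"
      from near[OF this] obtain p where p: "p \<in> ?I" "i = (fst p, snd p, m)" by blast
      from p(1) obtain j where "snd p = int k * j" by (cases p) auto
      with p(2) show ?thesis by simp
    qed
    then obtain b j where i: "i = (b, int k * j, m)" by blast
    have "j \<in> {- 1, 0, int J - 1, int J}"
    proof (rule ccontr)
      assume j: "j \<notin> {- 1, 0, int J - 1, int J}"
      show False
      proof (cases "1 \<le> j \<and> j \<le> int J - 2")
        case True
        then have "r i = z * cis (\<theta> * of_int j) + \<i> * of_real \<kappa> * (cis (\<theta> * of_int (j + 1)) + cis (\<theta> * of_int (j - 1)))"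
          unfolding r_def i x_at x\<tau> by (simp add: \<phi>_def)
        with wave[of j] that show False by simp
      next
        case False
        then have "\<phi> j = 0" "\<phi> (j + 1) = 0" "\<phi> (j - 1) = 0" using j by (auto simp: \<phi>_def)
        then show False using that unfolding r_def i x_at x\<tau> by simp
      qed
    qed
    then show ?thesis unfolding i by (intro image_eqI[of _ _ "(b, j)"]) auto
  qed
  have fr: "finite {i. r i \<noteq> 0}" by (rule finite_subset[of _ ?E]) (use r_nz in auto)
  have r_le: "cmod (r i) \<le> 4 * \<kappa>" for i
  proof -
    have x1: "cmod (x i) \<le> 1" for i by (simp add: x_def \<phi>_def)
    have "cmod (r i) \<le> cmod z * cmod (x i) + \<kappa> * cmod (x (\<tau> k i) + x (\<tau>' k i))"
      unfolding r_def using \<kappa> by (intro order_trans[OF norm_triangle_ineq]) (simp add: norm_mult)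
    also have "\<dots> \<le> 2 * \<kappa> * 1 + \<kappa> * (1 + 1)"
      using y \<kappa> norm_triangle_ineq[of "x (\<tau> k i)" "x (\<tau>' k i)"] x1[of i] x1[of "\<tau> k i"] x1[of "\<tau>' k i"]
      by (intro add_mono mult_mono) (auto simp: norm_mult)
    finally show ?thesis by simp
  qed
  have "(l2norm r)\<^sup>2 = (\<Sum>i\<in>{i. r i \<noteq> 0}. (cmod (r i))\<^sup>2)" by (rule l2norm_finite_support[OF fr])
  also have "\<dots> \<le> (\<Sum>i\<in>?E. (cmod (r i))\<^sup>2)" using r_nz by (intro sum_mono2) auto
  also have "\<dots> \<le> (\<Sum>i\<in>?E. (4 * \<kappa>)\<^sup>2)" by (intro sum_mono power_mono r_le) simp
  also have "\<dots> = real (card ?E) * (4 * \<kappa>)\<^sup>2" by simp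
  also have "\<dots> \<le> 8 * (4 * \<kappa>)\<^sup>2"
  proof (rule mult_right_mono)
    have "card ?E \<le> card (UNIV \<times> {- 1, 0, int J - 1, int J} :: (bool \<times> int) set)"
      by (rule card_image_le) simp
    also have "\<dots> \<le> 2 * 4" unfolding card_cartesian_product
      by (intro mult_mono) (auto simp: card_insert_if)
    finally show "real (card ?E) \<le> 8" by simp
  qed simp
  also have "\<dots> = (sqrt 8 * (4 * \<kappa>))\<^sup>2" by (simp add: power_mult_distrib)
  finally have rn: "l2norm r \<le> sqrt 8 * (4 * \<kappa>)" by (rule power2_le_imp_le) (use \<kappa> in simp)
  have "(sqrt 8 * (4 * \<kappa>) * 2 / \<epsilon>)\<^sup>2 \<le> (l2norm x)\<^sup>2" unfolding xn using J by simp
  then have "sqrt 8 * (4 * \<kappa>) * 2 / \<epsilon> \<le> l2norm x" by (rule power2_le_imp_le) simp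
  then have rx: "sqrt 8 * (4 * \<kappa>) \<le> \<epsilon> / 2 * l2norm x" using \<epsilon> by (simp add: field_simps)
  have "V_norm k s (shifted z (L_op k) u0) \<le> l2norm r + (l2norm (\<lambda>i. e (\<tau> k) i * x (\<tau> k i)) + l2norm (\<lambda>i. e (\<tau>' k) i * x (\<tau>' k i)))"
    unfolding emb_T
    using l2norm_add[OF l2_finite_support[OF fr] l2_add[OF e1(1) e2(1)]] l2norm_add[OF e1(1) e2(1)] by linarith
  also have "\<dots> \<le> \<epsilon> / 2 * l2norm x + (\<delta> * l2norm x + \<delta> * l2norm x)"
    using rn rx e1(2) e2(2) by (intro add_mono) linarith+
  also have "\<dots> = \<epsilon> * l2norm x" by (simp add: \<delta>_def field_simps)
  finally have T_le: "V_norm k s (shifted z (L_op k) u0) \<le> \<epsilon> * l2norm x" .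
  interpret normed_banach_states "X_space s" "V_norm k s" "pairings (amp k) s" by (rule V_norm_states)
  note T = bounded_opD[OF shifted_bounded_op[OF L_op_bounded[of s k], of z]]
  define u where "u = cscale (of_real (1 / l2norm x)) u0"
  show ?thesis
  proof (rule that[OF m(1)])
    show "u \<in> X_space s" unfolding u_def by (intro V_scale u0X)
    show "coef u i = 0" if "snd (snd i) \<noteq> m" for i using u0m[OF that] by (simp add: u_def)
    show "V_norm k s u = 1"
      unfolding u_def N_scale[OF u0X] emb_u0 norm_of_real using xpos by simp
    have "V_norm k s (shifted z (L_op k) u) = 1 / l2norm x * V_norm k s (shifted z (L_op k) u0)"
      unfolding u_def T(4)[OF u0X] N_scale[OF T(1)[OF u0X]] norm_of_real using xpos by simp
    also have "\<dots> \<le> \<epsilon>" using T_le xpos by (simp add: field_simps)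
    finally show "V_norm k s (shifted z (L_op k) u) \<le> \<epsilon>" .
  qed
qed

section \<open>Independence across fibres and failure of the Fredholm property\<close>

text \<open>Dependence is stated for an indexed family since its members may coincide; a coincidence
  gives the relation with coefficients 1 and - 1, and otherwise dimension counting applies.\<close>

lemma span_family_dependent:
  fixes w :: "nat \<Rightarrow> state"
  assumes "finite B" "card B < d" "\<And>l. l < d \<Longrightarrow> w l \<in> state.span B"
  obtains c l0 where "l0 < d" "c l0 \<noteq> 0" "(\<Sum>l<d. cscale (c l) (w l)) = 0"
proof (cases "inj_on w {..<d}")
  case True
  have "\<not> state.independent (w ` {..<d})"
  proof
    assume "state.independent (w ` {..<d})"
    moreover have "w ` {..<d} \<subseteq> state.span B" using assms(3) by blast
    ultimately have "card (w ` {..<d}) \<le> card B" using state.independent_span_bound[OF assms(1)] by blast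
    then show False using assms(2) by (simp add: card_image[OF True])
  qed
  then obtain a where a: "\<exists>v\<in>w ` {..<d}. a v \<noteq> 0" "(\<Sum>v\<in>w ` {..<d}. cscale (a v) v) = 0"
    using state.dependent_finite[of "w ` {..<d}"] by blast
  from a(1) obtain l0 where "l0 < d" "a (w l0) \<noteq> 0" by blast
  moreover have "(\<Sum>l<d. cscale (a (w l)) (w l)) = 0" using a(2) by (simp add: sum.reindex[OF True])
  ultimately show ?thesis by (rule that)
next
  case False
  then obtain l1 l2 where l: "l1 < d" "l2 < d" "l1 \<noteq> l2" "w l1 = w l2" by (auto simp: inj_on_def)
  define c where "c l = (if l = l1 then 1 else if l = l2 then - 1 else 0 :: complex)" for l
  have "(\<Sum>l<d. cscale (c l) (w l)) = (\<Sum>l\<in>{l1, l2}. cscale (c l) (w l))"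
    by (rule sum.mono_neutral_right) (use l in \<open>auto simp: c_def\<close>)
  also have "\<dots> = 0" using l by (simp add: c_def cscale_distrib)
  finally show ?thesis using that[of l1 c] l(1) by (simp add: c_def)
qed

text \<open>Nonzero vectors on distinct fibres are linearly independent, because a coordinate on one
  fibre sees only one of them. A finite-dimensional space thus meets finitely many fibres in this
  way.\<close>

lemma infinite_fibres_independent:
  assumes v: "\<And>m. m \<in> M \<Longrightarrow> v m \<noteq> 0" "\<And>m i. m \<in> M \<Longrightarrow> snd (snd i) \<noteq> m \<Longrightarrow> coef (v m) i = 0"
    and B: "finite B" "v ` M \<subseteq> state.span B"
  shows "finite M"
proof -
  have nz: "\<exists>i. snd (snd i) = m \<and> coef (v m) i \<noteq> 0" if "m \<in> M" for m
  proof (rule ccontr)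
    assume "\<nexists>i. snd (snd i) = m \<and> coef (v m) i \<noteq> 0"
    then have "coef (v m) i = 0" for i using v(2)[OF that, of i] by blast
    then have "v m = 0" by (intro state_eqI) simp
    with v(1)[OF that] show False ..
  qed
  have inj: "inj_on v M"
  proof (rule inj_onI)
    fix m m' assume *: "m \<in> M" "m' \<in> M" "v m = v m'"
    obtain i where i: "snd (snd i) = m" "coef (v m) i \<noteq> 0" using nz[OF *(1)] by blast
    then show "m = m'" using v(2)[OF *(2), of i] *(3) by metis
  qed
  have "state.independent (v ` M)"
    unfolding state.independent_explicit_finite_subsets
  proof (intro allI impI ballI)
    fix A a w assume A: "A \<subseteq> v ` M" "finite A" "(\<Sum>v\<in>A. cscale (a v) v) = 0" and w: "w \<in> A"
    obtain m where m: "m \<in> M" "w = v m" using A(1) w by blast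
    obtain i where i: "snd (snd i) = m" "coef (v m) i \<noteq> 0" using nz[OF m(1)] by blast
    have other: "coef w' i = 0" if "w' \<in> A" "w' \<noteq> w" for w'
    proof -
      obtain m' where m': "m' \<in> M" "w' = v m'" using A(1) \<open>w' \<in> A\<close> by blast
      then have "m' \<noteq> m" using that(2) m(2) by blast
      then show ?thesis using v(2)[OF m'(1), of i] m'(2) i(1) by simp
    qed
    have "0 = (\<Sum>v\<in>A. a v * coef v i)" using arg_cong[OF A(3), of "\<lambda>u. coef u i"] by (simp add: coef_sum)
    also have "\<dots> = (\<Sum>v\<in>{w}. a v * coef v i)"
      by (rule sum.mono_neutral_right[OF A(2)]) (use w other in simp_all)
    finally show "a w = 0" using i m(2) by simp
  qed
  then have "finite (v ` M)" using state.independent_span_bound[OF B(1) _ B(2)] by blast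
  then show ?thesis using inj by (rule finite_imageD)
qed

text \<open>If \<open>z - L\<close> had finite-dimensional kernel and cokernel, it would be injective on all high
  fibres.  Distributing approximate eigenvectors \<open>u\<^sub>j\<close> of distinct fibres over more residue classes of
  \<open>j\<close> than the codimension of the range, some nontrivial combination of the sums of \<open>(z - L) u\<^sub>j\<close> over
  the classes lies in the range; its preimage agrees with a fixed multiple of \<open>u\<^sub>j\<close> on
  infinitely many fibres, so it cannot be square summable.\<close>

theorem seg_not_fredholm:
  assumes k: "k \<ge> 1" and z: "z \<in> seg k"
  shows "\<not> fredholm (X_space s) (V_norm k s) (shifted z (L_op k))"
proof
  let ?V = "X_space s" and ?N = "V_norm k s" and ?T = "shifted z (L_op k)"
  assume F: "fredholm ?V ?N ?T"
  interpret normed_banach_states ?V ?N "pairings (amp k) s" by (rule V_norm_states)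
  note Tb = shifted_bounded_op[OF L_op_bounded[of s k], of z]
  note T = bounded_opD[OF Tb]
  obtain B0 where B0: "finite B0" "{u \<in> ?V. ?T u = 0} \<subseteq> state.span B0"
    using F unfolding fredholm_def by blast
  obtain B where B: "finite B" "\<And>u. u \<in> ?V \<Longrightarrow> \<exists>v\<in>?V. \<exists>w\<in>state.span B. u = ?T v + w"
    using F unfolding fredholm_def by blast
  have T_fibre: "?T (fibre m u) = fibre m (?T u)" for m u
    by (rule state_eqI) (simp add: shifted_def L_op_fibre coef_fibre)
  \<comment> \<open>The fibres carrying a kernel vector. They are finitely many, so beyond
    \<open>m0\<close> the operator is injective on each fibre.\<close>
  define M where "M = {m. \<exists>u\<in>?V. u \<noteq> 0 \<and> (\<forall>i. snd (snd i) \<noteq> m \<longrightarrow> coef u i = 0) \<and> ?T u = 0}"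
  have "\<forall>m\<in>M. \<exists>u. u \<in> ?V \<and> u \<noteq> 0 \<and> (\<forall>i. snd (snd i) \<noteq> m \<longrightarrow> coef u i = 0) \<and> ?T u = 0"
    unfolding M_def by blast
  from bchoice[OF this] obtain v where v: "\<forall>m\<in>M. v m \<in> ?V \<and> v m \<noteq> 0 \<and>
      (\<forall>i. snd (snd i) \<noteq> m \<longrightarrow> coef (v m) i = 0) \<and> ?T (v m) = 0" by blast
  have "finite M"
  proof (rule infinite_fibres_independent[OF _ _ B0(1)])
    show "v ` M \<subseteq> state.span B0" using v B0(2) by blast
    show "coef (v m) i = 0" if "m \<in> M" "snd (snd i) \<noteq> m" for m i using v that by blast
  qed (use v in blast)
  then obtain m0 where m0: "\<And>m. m \<in> M \<Longrightarrow> m \<le> m0"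
    using bdd_above_finite[of M] unfolding bdd_above_def by blast
  have inj: "u = 0" if "m0 < m" "u \<in> ?V" "\<And>i. snd (snd i) \<noteq> m \<Longrightarrow> coef u i = 0" "?T u = 0" for m u
  proof (rule ccontr)
    assume "u \<noteq> 0"
    with that(2-4) have "m \<in> M" unfolding M_def by blast
    with m0 that(1) show False by fastforce
  qed
  define P where "P j p \<longleftrightarrow> m0 < fst p \<and> snd p \<in> ?V \<and> (\<forall>i. snd (snd i) \<noteq> fst p \<longrightarrow> coef (snd p) i = 0) \<and>
      ?N (snd p) = 1 \<and> ?N (?T (snd p)) \<le> (1 / 2) ^ j" for j :: nat and p :: "int \<times> state"
  have "\<exists>f. \<forall>j. P j (f j) \<and> fst (f j) < fst (f (Suc j))"
  proof (rule dependent_nat_choice)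
    have ex: "\<exists>p. P j p \<and> m1 < fst p" for j m1
    proof -
      have "0 < (1 / 2 :: real) ^ j" by simp
      from quasimode[OF k z this, of "max m0 m1" s] obtain m u where "max m0 m1 < m" "u \<in> ?V"
        "\<And>i. snd (snd i) \<noteq> m \<Longrightarrow> coef u i = 0" "?N u = 1" "?N (?T u) \<le> (1 / 2) ^ j" by blast
      then show ?thesis unfolding P_def by (intro exI[of _ "(m, u)"]) simp
    qed
    from ex[of 0 0] show "\<exists>p. P 0 p" by blast
    show "\<exists>y. P (Suc n) y \<and> fst x < fst y" for x :: "int \<times> state" and n using ex by blast
  qed
  then obtain f where f: "\<And>j. P j (f j)" "\<And>j. fst (f j) < fst (f (Suc j))" by blast
  define m where "m j = fst (f j)" for j
  define u where "u j = snd (f j)" for j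
  have m_mono: "strict_mono m" using f(2) unfolding m_def by (rule strict_monoI_Suc)
  have m: "m0 < m j" and uV: "u j \<in> ?V" and um: "\<And>i. snd (snd i) \<noteq> m j \<Longrightarrow> coef (u j) i = 0"
    and u1: "?N (u j) = 1" and Tu: "?N (?T (u j)) \<le> (1 / 2) ^ j" for j
    using f(1)[of j] unfolding P_def m_def u_def by blast+
  have Tum: "coef (?T (u j)) i = 0" if "snd (snd i) \<noteq> m j" for i j
    using um[of _ j] that by (simp add: shifted_def coef_L_op)
  \<comment> \<open>One residue class more than \<open>B\<close> has elements, which forces a linear
    relation among the \<open>d\<close> defects \<open>w l\<close> in its span.\<close>
  define d where "d = Suc (card B)"
  \<comment> \<open>Each class series converges since the images have norm at most
    \<open>(1 / 2) ^ j\<close>, whereas the formal preimage sums unit vectors on distinct fibres and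
    diverges.\<close>
  define a where "a l j = (if j mod d = l then ?T (u j) else 0)" for l j
  have aV: "a l j \<in> ?V" for l j unfolding a_def using T(1)[OF uV] by simp
  have "\<exists>v. v \<in> ?V \<and> (\<lambda>n. ?N ((\<Sum>j<n. a l j) - v)) \<longlonglongrightarrow> 0" for l
  proof -
    have "summable (\<lambda>j. ?N (a l j))"
    proof (rule summable_comparison_test')
      show "summable (\<lambda>j. (1 / 2 :: real) ^ j)" by (rule summable_geometric) simp
      show "norm (?N (a l j)) \<le> (1 / 2) ^ j" for j
        using Tu[of j] N_zero by (simp add: a_def)
    qed
    from series_converges[OF aV this] show ?thesis by metis
  qed
  then obtain v where v: "\<And>l. v l \<in> ?V" "\<And>l. (\<lambda>n. ?N ((\<Sum>j<n. a l j) - v l)) \<longlonglongrightarrow> 0" by metis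
  \<comment> \<open>The fibres \<open>m j\<close> are distinct, so at most one term of the series
    contributes on each of them.\<close>
  have coef_v: "coef (v l) i = coef (a l j) i" if i: "snd (snd i) = m j" for l j i
  proof -
    have sum: "coef (\<Sum>j'<n. a l j') i = coef (a l j) i" if "j < n" for n
    proof -
      have "coef (\<Sum>j'<n. a l j') i = (\<Sum>j'\<in>{j}. coef (a l j') i)"
        unfolding coef_sum
      proof (rule sum.mono_neutral_right)
        show "\<forall>j'\<in>{..<n} - {j}. coef (a l j') i = 0"
        proof
          fix j' assume "j' \<in> {..<n} - {j}"
          then have "m j' \<noteq> m j" using m_mono by (simp add: strict_mono_eq)
          then show "coef (a l j') i = 0" using Tum[of i j'] i by (simp add: a_def)
        qed
      qed (use that in auto)
      then show ?thesis by simp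
    qed
    have "(\<lambda>n. 1 / wt (amp k) s i * ?N ((\<Sum>j<n. a l j) - v l)) \<longlonglongrightarrow> 0"
      by (rule tendsto_mult_right_zero[OF v(2)])
    then have "(\<lambda>n. coef ((\<Sum>j<n. a l j) - v l) i) \<longlonglongrightarrow> 0"
    proof (rule Lim_null_comparison[rotated])
      have "norm (coef ((\<Sum>j<n. a l j) - v l) i) \<le> 1 / wt (amp k) s i * ?N ((\<Sum>j<n. a l j) - v l)" for n
        by (rule coef_le_V_norm) (intro V_diff V_sum aV v(1))
      then show "\<forall>\<^sub>F n in sequentially. norm (coef ((\<Sum>j<n. a l j) - v l) i)
          \<le> 1 / wt (amp k) s i * ?N ((\<Sum>j<n. a l j) - v l)" by (rule always_eventually[OF allI])
    qed
    moreover have "\<forall>\<^sub>F n in sequentially. coef ((\<Sum>j<n. a l j) - v l) i = coef (a l j) i - coef (v l) i"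
      using eventually_gt_at_top[of j] by eventually_elim (simp add: sum)
    ultimately have "(\<lambda>n::nat. coef (a l j) i - coef (v l) i) \<longlonglongrightarrow> 0"
      by (rule Lim_transform_eventually)
    then show ?thesis by (simp add: LIMSEQ_const_iff)
  qed
  have "\<exists>y w. y \<in> ?V \<and> w \<in> state.span B \<and> v l = ?T y + w" for l using B(2)[OF v(1)[of l]] by blast
  then obtain y w where yw: "\<And>l. y l \<in> ?V" "\<And>l. w l \<in> state.span B" "\<And>l. v l = ?T (y l) + w l" by metis
  obtain c l0 where c: "l0 < d" "c l0 \<noteq> 0" "(\<Sum>l<d. cscale (c l) (w l)) = 0"
    by (rule span_family_dependent[OF B(1), of d w]) (auto simp: d_def yw(2))
  define Y where "Y = (\<Sum>l<d. cscale (c l) (y l))"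
  have Y: "Y \<in> ?V" unfolding Y_def by (intro V_sum V_scale yw)
  have "?T Y = (\<Sum>l<d. cscale (c l) (?T (y l)))"
    unfolding Y_def by (simp add: bounded_op_sum[OF Tb] V_scale yw(1) T(4)[OF yw(1)])
  also have "\<dots> = (\<Sum>l<d. cscale (c l) (?T (y l))) + (\<Sum>l<d. cscale (c l) (w l))" using c(3) by simp
  also have "\<dots> = (\<Sum>l<d. cscale (c l) (v l))"
    unfolding yw(3) cscale_distrib sum.distrib ..
  finally have TY: "?T Y = (\<Sum>l<d. cscale (c l) (v l))" .
  \<comment> \<open>On the fibre \<open>m j\<close> both sides have the same image, because only the
    class \<open>l0\<close> contributes there; injectivity beyond \<open>m0\<close> identifies
    them.\<close>
  have fibreY: "fibre (m j) Y = cscale (c l0) (u j)" if j: "j mod d = l0" for j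
  proof -
    have "?T (fibre (m j) Y - cscale (c l0) (u j)) = 0"
    proof (rule state_eqI)
      fix i
      have "coef (?T (fibre (m j) Y - cscale (c l0) (u j))) i
          = coef (fibre (m j) (?T Y)) i - c l0 * coef (?T (u j)) i"
        by (simp add: bounded_op_diff[OF Tb] fibre_in_X[OF Y] V_scale uV T(4)[OF uV] T_fibre)
      also have "\<dots> = 0"
      proof (cases "snd (snd i) = m j")
        case True
        have "coef (?T Y) i = (\<Sum>l<d. c l * coef (a l j) i)"
          unfolding TY coef_sum by (simp add: coef_v[OF True])
        also have "\<dots> = (\<Sum>l<d. if l = l0 then c l0 * coef (?T (u j)) i else 0)"
          by (rule sum.cong) (use j in \<open>auto simp: a_def\<close>)
        also have "\<dots> = c l0 * coef (?T (u j)) i" using c(1) by simp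
        finally show ?thesis using True by (simp add: coef_fibre)
      next
        case False
        then show ?thesis using Tum[OF False] by (simp add: coef_fibre)
      qed
      finally show "coef (?T (fibre (m j) Y - cscale (c l0) (u j))) i = coef 0 i" by simp
    qed
    moreover have "coef (fibre (m j) Y - cscale (c l0) (u j)) i = 0" if "snd (snd i) \<noteq> m j" for i
      using um[OF that] that by (simp add: coef_fibre)
    ultimately have "fibre (m j) Y - cscale (c l0) (u j) = 0"
      using inj[OF m[of j] V_diff[OF fibre_in_X[OF Y] V_scale[OF uV]]] by blast
    then show ?thesis by simp
  qed
  have "emb (amp k) s Y \<in> l2" using Y X_space_iff[of "amp k"] by simp
  moreover have "0 < cmod (c l0) / 2" using c(2) by simp
  \<comment> \<open>A fibre of \<open>Y\<close> that avoids \<open>E\<close> has norm at most half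
    of \<open>cmod (c l0)\<close>, while on the class \<open>l0\<close> its norm equals
    \<open>cmod (c l0)\<close>.\<close>
  ultimately obtain E where E: "finite E"
    "\<And>x. (\<And>i. cmod (x i) \<le> cmod (emb (amp k) s Y i)) \<Longrightarrow> (\<And>i. i \<in> E \<Longrightarrow> x i = 0) \<Longrightarrow>
      l2norm x \<le> cmod (c l0) / 2"
    by (rule l2_tail) blast
  have d0: "0 < d" by (simp add: d_def)
  have "inj (\<lambda>n. m (l0 + d * n))"
    using d0 strict_mono_eq[OF m_mono] by (auto intro!: injI)
  then have "infinite (range (\<lambda>n. m (l0 + d * n)))" by (rule range_inj_infinite)
  then obtain q where q: "m (l0 + d * q) \<notin> (\<lambda>i. snd (snd i)) ` E"
    using E(1) by (metis finite_imageI finite_subset image_subsetI)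
  let ?j = "l0 + d * q"
  have "?N (fibre (m ?j) Y) \<le> cmod (c l0) / 2"
  proof (rule E(2))
    show "cmod (emb (amp k) s (fibre (m ?j) Y) i) \<le> cmod (emb (amp k) s Y i)" for i
      by (simp add: emb_def coef_fibre)
    show "emb (amp k) s (fibre (m ?j) Y) i = 0" if "i \<in> E" for i
    proof -
      have "snd (snd i) \<noteq> m ?j" using q that by (metis image_eqI)
      then show ?thesis by (simp add: emb_def coef_fibre)
    qed
  qed
  moreover have "fibre (m ?j) Y = cscale (c l0) (u ?j)" by (rule fibreY) (use c(1) in simp)
  then have "?N (fibre (m ?j) Y) = cmod (c l0)" using N_scale[OF uV, of "c l0" ?j] u1[of ?j] by simp
  ultimately show False using c(2) by simp
qed

section \<open>Fredholm points and resolvent set\<close>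

lemma fredholm_iff_off_seg:
  assumes "k \<ge> 1"
  shows "fredholm (X_space s) (X_norm s) (shifted z (L_op k)) \<longleftrightarrow> z \<notin> seg k"
  using off_seg_fredholm[of z k s] seg_not_fredholm[OF assms, of z s]
    fredholm_equivalent_norms[OF X_norm_equivalent]
    fredholm_equivalent_norms[OF equivalent_norms_sym[OF X_norm_equivalent]] by blast

text \<open>A resolvent point is Fredholm and hence off the segment; off the segment injectivity
  already gives a bounded inverse. Only the eigenvalues could still depend on
  \<open>s\<close>.\<close>

lemma resolvent_set_iff_eigenvalue:
  assumes "k \<ge> 1"
  shows "z \<in> resolvent_set (X_space s) (X_norm s) (L_op k) \<longleftrightarrow>
    z \<notin> seg k \<and> (\<forall>u\<in>X_space s. L_op k u = cscale z u \<longrightarrow> u = 0)"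
proof -
  interpret normed_banach_states "X_space s" "V_norm k s" "pairings (amp k) s" by (rule V_norm_states)
  note T = shifted_bounded_op[OF L_op_bounded[of s k], of z]
  have "z \<notin> seg k \<and> (\<forall>u\<in>X_space s. L_op k u = cscale z u \<longrightarrow> u = 0)"
    if res: "z \<in> resolvent_set (X_space s) (V_norm k s) (L_op k)"
  proof -
    obtain S where S: "bounded_op (X_space s) (V_norm k s) S"
      "\<And>u. u \<in> X_space s \<Longrightarrow> S (shifted z (L_op k) u) = u"
      "\<And>u. u \<in> X_space s \<Longrightarrow> shifted z (L_op k) (S u) = u"
      using res unfolding resolvent_set_def by blast
    have inj: "u = 0" if "u \<in> X_space s" "shifted z (L_op k) u = 0" for u
      using S(2)[OF that(1)] that(2) bounded_op_zero[OF S(1)] by simp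
    have surj: "\<exists>v\<in>X_space s. u = shifted z (L_op k) v" if "u \<in> X_space s" for u
      using S(3)[OF that] bounded_opD(1)[OF S(1) that] by metis
    have "fredholm (X_space s) (V_norm k s) (shifted z (L_op k))"
      unfolding fredholm_def
    proof (intro conjI T)
      show "\<exists>B. finite B \<and> {u \<in> X_space s. shifted z (L_op k) u = 0} \<subseteq> state.span B"
        using inj state.span_zero by (intro exI[of _ "{}"]) blast
      have "shifted z (L_op k) ` X_space s = X_space s"
        using surj bounded_opD(1)[OF T] by blast
      then show "closed_subspace (X_space s) (V_norm k s) (shifted z (L_op k) ` X_space s)"
        using V_subspace by (simp add: closed_subspace_def)
      show "\<exists>B. finite B \<and> B \<subseteq> X_space s \<and>
          (\<forall>u\<in>X_space s. \<exists>v\<in>X_space s. \<exists>w\<in>state.span B. u = shifted z (L_op k) v + w)"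
      proof (intro exI[of _ "{}"] conjI ballI)
        fix u assume "u \<in> X_space s"
        then obtain v where "v \<in> X_space s" "u = shifted z (L_op k) v + 0" using surj by (metis add.right_neutral)
        then show "\<exists>v\<in>X_space s. \<exists>w\<in>state.span {}. u = shifted z (L_op k) v + w"
          using state.span_zero by blast
      qed simp_all
    qed
    then have "z \<notin> seg k" using seg_not_fredholm[OF assms] by blast
    moreover have "\<forall>u\<in>X_space s. L_op k u = cscale z u \<longrightarrow> u = 0"
      using inj by (simp add: shifted_def)
    ultimately show ?thesis ..
  qed
  then show ?thesis
    unfolding resolvent_set_equivalent_norms[OF X_norm_equivalent[of s k]] using off_seg_resolvent by blast
qed

lemma resolvent_set_subset:
  assumes "k \<ge> 1"
  shows "resolvent_set (X_space s) (X_norm s) (L_op k) \<subseteq> resolvent_set (X_space s') (X_norm s') (L_op k)"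
proof
  fix z assume "z \<in> resolvent_set (X_space s) (X_norm s) (L_op k)"
  then have z: "z \<notin> seg k" "\<And>u. u \<in> X_space s \<Longrightarrow> L_op k u = cscale z u \<Longrightarrow> u = 0"
    by (simp_all add: resolvent_set_iff_eigenvalue[OF assms])
  \<comment> \<open>Zero lies on the segment, so the eigenvalues to be compared are nonzero and the
    bootstrap is available.\<close>
  have "0 \<in> seg k" unfolding seg_def by (intro image_eqI[of _ _ 0]) simp_all
  then have z0: "z \<noteq> 0" using z(1) by blast
  have "u = 0" if u: "u \<in> X_space s'" "L_op k u = cscale z u" for u
  proof (rule ccontr)
    assume "u \<noteq> 0"
    from eigenvalue_independent[OF z0 u(1) this u(2), of s]
    obtain v where "v \<in> X_space s" "v \<noteq> 0" "L_op k v = cscale z v" .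
    with z(2) show False by blast
  qed
  with z(1) show "z \<in> resolvent_set (X_space s') (X_norm s') (L_op k)"
    by (simp add: resolvent_set_iff_eigenvalue[OF assms])
qed

theorem proposition3p5:
  fixes k :: nat
  assumes "k \<ge> 1"
  shows "(\<forall>s\<ge>0. \<forall>s'\<ge>0.
           spectrum (X_space s) (X_norm s) (L_op k) = spectrum (X_space s') (X_norm s') (L_op k))
    \<and> (\<forall>s\<ge>0. ess_spectrum (X_space s) (X_norm s) (L_op k)
           = (\<lambda>y. \<i> * complex_of_real y) `
               {- (real k * sqrt (1 + (real k)\<^sup>2)) .. real k * sqrt (1 + (real k)\<^sup>2)})
    \<and> (\<forall>M N P. P \<subseteq> {refl1 k, refl2} \<longrightarrow>
         (\<forall>s\<ge>0. closed_subspace (X_space s) (X_norm s) (Y_space M N P s) \<longrightarrow>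
           L_op k ` Y_space M N P s \<subseteq> Y_space M N P s \<longrightarrow>
           (\<forall>\<eta>>0. \<exists>C::real. \<forall>t\<ge>0.
              op_norm (Y_space M N P s) (X_norm s) (op_exp (Y_space M N P s) (X_norm s) (L_op k) t)
              \<le> ennreal (C * exp ((spectral_bound (Y_space M N P s) (X_norm s) (L_op k) + \<eta>) * t)))))"
proof (intro conjI allI impI)
  show "spectrum (X_space s) (X_norm s) (L_op k) = spectrum (X_space s') (X_norm s') (L_op k)" for s s'
    unfolding spectrum_def
    using resolvent_set_subset[OF assms, of s s'] resolvent_set_subset[OF assms, of s' s] by blast
  show "ess_spectrum (X_space s) (X_norm s) (L_op k)
           = (\<lambda>y. \<i> * complex_of_real y) `
               {- (real k * sqrt (1 + (real k)\<^sup>2)) .. real k * sqrt (1 + (real k)\<^sup>2)}" for s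
    unfolding ess_spectrum_def fredholm_iff_off_seg[OF assms] by (simp add: seg_def amp_def)
  fix M N :: "(int \<times> int) set" and P :: "(state \<Rightarrow> state) set" and s \<eta> :: real
  let ?Y = "Y_space M N P s"
  assume Y: "closed_subspace (X_space s) (X_norm s) ?Y" and inv: "L_op k ` ?Y \<subseteq> ?Y" and \<eta>: "0 < \<eta>"
  interpret X: normed_banach_states "X_space s" "X_norm s" "pairings 1 s"
    by (rule normed_banach_states_X) (simp_all add: X_norm_eq)
  \<comment> \<open>Closedness makes the subspace complete and invariance makes
    \<open>L_op k\<close> an operator on it, so the growth theorem applies with the spectrum taken
    in the subspace itself.\<close>
  interpret Y: normed_banach_states ?Y "X_norm s" "pairings 1 s"
    by (rule X.closed_subspace_normed_banach_states[OF Y])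
  have "bounded_op (X_space s) (X_norm s) (L_op k)"
    by (rule bounded_op_equivalent_norms[OF equivalent_norms_sym[OF X_norm_equivalent] L_op_bounded])
  then obtain K where K: "\<And>u. u \<in> X_space s \<Longrightarrow> X_norm s (L_op k u) \<le> K * X_norm s u"
    unfolding bounded_op_def by blast
  have "?Y \<subseteq> X_space s" by (auto simp: Y_space_def)
  then have "bounded_op ?Y (X_norm s) (L_op k)"
    using inv K by (intro Y.bounded_opI[where C = K]) (auto simp: L_op_linear)
  from Y.op_exp_growth[OF this \<eta>]
  show "\<exists>C::real. \<forall>t\<ge>0. op_norm ?Y (X_norm s) (op_exp ?Y (X_norm s) (L_op k) t)
              \<le> ennreal (C * exp ((spectral_bound ?Y (X_norm s) (L_op k) + \<eta>) * t))" .
qed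

end
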